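(* Let $\Omega=B_R\subset\mathbb{R}^N$, $q\in(0,1)$, and let $a\in L^\infty(\Omega)$ be a radial function with $\int_\Omega a<0$. Assume there exists $R_0>0$ such that $a\ge0$ in $B_{R_0}$, $a\le0$ in $A_{R_0,R}$, the map $\rho\mapsto a(\rho)$ is differentiable and nonincreasing on $(R_0,R)$, and $$\frac{1-q}{1+q}\int_{A_{R_0,R}}a^-\le\int_{B_{R_0}}a^+.$$ Then $(P_{a,q})$ has a positive solution. If moreover $(H_1)$ holds, this positive solution is unique.
   Context: $B_{\rho}:=\{x\in\mathbb{R}^N:|x|<\rho\}$, $A_{R_0,R}:=\{x:R_0<|x|<R\}$, $a^\pm:=\max(\pm a,0)$; a radial function is written as a function of $|x|$. $(P_{a,q})$ denotes $-\Delta u=a(x)u^q$ in $\Omega$, $\partial u/\partial\nu=0$ on $\partial\Omega$. A positive solution is $u\in W^{2,r}(\Omega)$ ($r>N$) with $u>0$ in $\Omega$ satisfying the equation a.e. and the boundary condition. $\Omega_+$ denotes the largest open subset of $\Omega$ on which $a>0$ a.e. Condition $(H_1)$: $\Omega_+$ has finitely many connected components and $|(\mathrm{supp}\,a^+)\setminus\Omega_+|=0$. *)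

theory Defs
  imports "HOL-Analysis.Analysis"
begin

definition c1c_test :: "'a::euclidean_space set \<Rightarrow> ('a \<Rightarrow> real) \<Rightarrow> ('a \<Rightarrow> 'a) \<Rightarrow> bool" where
  "c1c_test U \<phi> G \<longleftrightarrow>
     continuous_on UNIV G \<and> (\<forall>x. (\<phi> has_derivative (\<lambda>h. G x \<bullet> h)) (at x)) \<and>
     compact (closure {x. \<phi> x \<noteq> 0}) \<and> closure {x. \<phi> x \<noteq> 0} \<subseteq> U"

text \<open>Positive solution of -Laplace u = a u^q in the ball B_R with homogeneous Neumann condition.
  u is in W^{2,r}(B_R), r > N; by the Sobolev embedding it has a C^1 representative on the closed ball,
  whose gradient is Du; H i j are the weak second derivatives (in L^r) of the partial derivatives.\<close>
definition pos_sol_ball :: "real \<Rightarrow> ('a::euclidean_space \<Rightarrow> real) \<Rightarrow> real \<Rightarrow> ('a \<Rightarrow> real) \<Rightarrow> bool" where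
  "pos_sol_ball R a q u \<longleftrightarrow>
    (\<exists>(r::real) (Du::'a \<Rightarrow> 'a) (H::'a \<Rightarrow> 'a \<Rightarrow> 'a \<Rightarrow> real).
       r > real DIM('a) \<and>
       continuous_on (cball 0 R) Du \<and>
       (\<forall>x\<in>cball 0 R. (u has_derivative (\<lambda>h. Du x \<bullet> h)) (at x within cball 0 R)) \<and>
       (\<forall>i\<in>Basis. \<forall>j\<in>Basis.
          H i j \<in> borel_measurable lebesgue \<and>
          set_integrable lebesgue (ball 0 R) (\<lambda>x. \<bar>H i j x\<bar> powr r) \<and>
          (\<forall>\<phi> G. c1c_test (ball 0 R) \<phi> G \<longrightarrow>
             (LINT x:ball 0 R|lebesgue. (Du x \<bullet> j) * (G x \<bullet> i))
               = - (LINT x:ball 0 R|lebesgue. H i j x * \<phi> x))) \<and>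
       (\<forall>x\<in>ball 0 R. u x > 0) \<and>
       (AE x in lebesgue. x \<in> ball 0 R \<longrightarrow> - (\<Sum>i\<in>Basis. H i i x) = a x * u x powr q) \<and>
       (\<forall>x. norm x = R \<longrightarrow> Du x \<bullet> x = 0))"

definition pos_part_set :: "'a::euclidean_space set \<Rightarrow> ('a \<Rightarrow> real) \<Rightarrow> 'a set" where
  "pos_part_set \<Omega> a = \<Union>{U. open U \<and> U \<subseteq> \<Omega> \<and> (AE x in lebesgue. x \<in> U \<longrightarrow> a x > 0)}"

definition ess_supp :: "'a::euclidean_space set \<Rightarrow> ('a \<Rightarrow> real) \<Rightarrow> 'a set" where
  "ess_supp \<Omega> g = \<Omega> - \<Union>{U. open U \<and> (AE x in lebesgue. x \<in> U \<inter> \<Omega> \<longrightarrow> g x = 0)}"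

definition H1 :: "'a::euclidean_space set \<Rightarrow> ('a \<Rightarrow> real) \<Rightarrow> bool" where
  "H1 \<Omega> a \<longleftrightarrow> finite (components (pos_part_set \<Omega> a)) \<and>
     ess_supp \<Omega> (\<lambda>x. max (a x) 0) - pos_part_set \<Omega> a \<in> null_sets lebesgue"

end

theory Submission
  imports Defs "HOL-Complex_Analysis.Great_Picard"
begin

text \<open>
  Existence is a shooting argument. With \<open>u(x) = \<tau> w(|x|)\<close>, \<open>w(0) = 1\<close>, the equation becomes
  \<open>-(r\<^sup>N\<^sup>-\<^sup>1 w')' = \<mu> r\<^sup>N\<^sup>-\<^sup>1 a w\<^sup>q\<close> with \<open>\<mu> = \<tau>\<^sup>q\<^sup>-\<^sup>1\<close>, and \<open>\<mu>\<close> is the shooting parameter: for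
  \<open>\<mu> = 0\<close> the solution is positive with \<open>-\<integral> a w\<^sup>q > 0\<close>, while for large \<open>\<mu>\<close> it vanishes inside
  \<open>B\<^sub>R\<^sub>0\<close>. Since \<open>w\<^sup>q\<close> is not Lipschitz at \<open>0\<close>, the right-hand side is evaluated with a small time delay,
  which makes the problem explicitly solvable and continuous in \<open>\<mu>\<close>; the intermediate value theorem
  and the Arzela-Ascoli theorem then give a limit \<open>w \<ge> 0\<close> which either satisfies the Neumann condition
  or has a zero with vanishing derivative. The second case is excluded by the balance condition:
  multiplying the equation by \<open>w'\<close> gives \<open>w'\<^sup>2 \<ge> 2 \<mu> a\<^sup>- w\<^sup>1\<^sup>+\<^sup>q / (1 + q)\<close> in the annulus because \<open>a\<^sup>-\<close> is
  nondecreasing, and dividing the equation by \<open>w\<^sup>q\<close> and integrating up to the zero yields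
  \<open>\<integral> a\<^sup>+ < (1 - q) / (1 + q) \<integral> a\<^sup>-\<close>.

  Uniqueness holds among all, not necessarily radial, positive solutions. Testing the equation of \<open>u\<close>
  with \<open>u - v\<^sup>1\<^sup>+\<^sup>q u\<^sup>-\<^sup>q\<close> and that of \<open>v\<close> with \<open>v - u\<^sup>1\<^sup>+\<^sup>q v\<^sup>-\<^sup>q\<close> and adding, the right-hand sides cancel
  and what remains is the integral of a quadratic form in \<open>(\<nabla>u, \<nabla>v)\<close> that is nonnegative, and
  positive definite where \<open>u \<noteq> v\<close>. Since \<open>u\<close> and \<open>v\<close> might vanish on the boundary, this is done for
  \<open>u + \<epsilon>\<close>, \<open>v + \<epsilon>\<close>, with Fatou's lemma for \<open>\<epsilon> \<rightarrow> 0\<close>.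
\<close>

section \<open>Integration of radial functions\<close>

text \<open>The obstacle is that \<open>t powr q\<close> with \<open>q < 1\<close> is not Lipschitz
  at \<open>0\<close>: once \<open>w\<close> reaches \<open>0\<close>, solutions of the initial
  value problem need be neither unique nor continuous in a parameter, and a limit of positive
  solutions may vanish somewhere. In the inner ball the coefficient is only measurable, so the
  equation is kept in integrated form (\<open>flux\<close>, \<open>slope\<close>,
  \<open>pot\<close>); the flux is differentiated only in the annulus, where the profile is
  continuous. The balance constant is \<open>(1 - q) / (1 + q) = 1 - 2 * q / (1 + q)\<close>: in the
  derivative of \<open>r^(N-1) * (-w') * w^(-q)\<close> the energy estimate compensates the fraction
  \<open>2 * q / (1 + q)\<close> of the negative coefficient. The balance condition is not strict;
  strictness comes from the inner ball, where \<open>w\<close> drops strictly after a radius that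
  already carries positive mass. In the uniqueness part the exponents are forced: \<open>u^q\<close>
  times the test function is \<open>u^(1+q) - v^(1+q)\<close>, antisymmetric in \<open>u\<close> and
  \<open>v\<close>. These test functions do not vanish on the sphere, so the Neumann condition must
  first be converted into a weak formulation that admits them.\<close>

definition radial_density :: "'a::euclidean_space itself \<Rightarrow> real \<Rightarrow> real" where
  "radial_density _ r =
     (if 0 < r then DIM('a) * unit_ball_vol DIM('a) * r ^ (DIM('a) - 1) else 0)"

lemma radial_density_measurable [measurable]:
  "radial_density TYPE('a::euclidean_space) \<in> borel_measurable borel"
  unfolding radial_density_def by measurable

lemma radial_density_nonneg: "0 \<le> radial_density TYPE('a::euclidean_space) r"
  by (simp add: radial_density_def)

text \<open>The density is the area of the sphere of radius \<open>r\<close>, the derivative of the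
  ball volume, so this is the fundamental theorem of calculus. It is set to \<open>0\<close> for
  \<open>r \<le> 0\<close>, where the law of the norm has no mass.\<close>

lemma emeasure_radial_density:
  "emeasure (density lborel (\<lambda>r. ennreal (radial_density TYPE('a::euclidean_space) r))) {..c}
     = emeasure lborel {x::'a. norm x \<le> c}"
proof (cases "c < 0")
  case True
  then have "{x::'a. norm x \<le> c} = {}"
    using norm_ge_zero by (smt (verit) Collect_empty_eq)
  moreover have "(\<integral>\<^sup>+r. ennreal (radial_density TYPE('a) r) * indicator {..c} r \<partial>lborel) = (\<integral>\<^sup>+r. 0 \<partial>(lborel::real measure))"
    using True by (intro nn_integral_cong) (auto simp: radial_density_def split: split_indicator)
  ultimately show ?thesis
    by (simp add: emeasure_density)
next
  case False
  let ?N = "DIM('a)" and ?V = "unit_ball_vol DIM('a)"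
  have N: "?N > 0" by simp
  have "(\<integral>\<^sup>+r. ennreal (radial_density TYPE('a) r) * indicator {..c} r \<partial>lborel)
      = (\<integral>\<^sup>+r. ennreal (?N * ?V * r ^ (?N - 1)) * indicator {0..c} r \<partial>lborel)"
    by (intro nn_integral_cong_AE AE_I'[of "{0}"]) (auto simp: radial_density_def split: split_indicator)
  also have "\<dots> = ennreal (?V * c ^ ?N - ?V * 0 ^ ?N)"
    using False by (intro nn_integral_FTC_Icc) (auto intro!: derivative_eq_intros)
  also have "\<dots> = emeasure lborel (cball (0::'a) c)"
    using False N by (simp add: emeasure_cball power_0_left)
  finally show ?thesis
    by (simp add: emeasure_density cball_def)
qed

text \<open>Polar coordinates for radial functions: half-lines form an intersection-stable
  generator, so only the volumes of balls have to be compared.\<close>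

lemma distr_norm_lborel:
  "distr lborel borel (norm :: 'a::euclidean_space \<Rightarrow> real)
     = density lborel (\<lambda>r. ennreal (radial_density TYPE('a) r))" (is "?M = ?D")
proof (rule measure_eqI_generator_eq[where E = "range (\<lambda>a. {..a::real})" and \<Omega> = UNIV and A = "\<lambda>n. {..real n}"])
  show "Int_stable (range (\<lambda>a. {..a::real}))"
    by (auto simp: Int_stable_def)
  show "sets ?M = sigma_sets UNIV (range (\<lambda>a. {..a::real}))" 
       "sets ?D = sigma_sets UNIV (range (\<lambda>a. {..a::real}))"
    by (simp_all add: borel_eq_atMost)
  have eq: "emeasure ?M {..c} = emeasure ?D {..c}" for c
    unfolding emeasure_radial_density
    by (subst emeasure_distr) (auto intro!: arg_cong[where f="emeasure lborel"])
  show "emeasure ?M X = emeasure ?D X" if "X \<in> range (\<lambda>a. {..a::real})" for X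
    using that eq by auto
  show "(\<Union>i. {..real i}) = UNIV"
    by (auto intro: real_arch_simple)
  show "emeasure ?M {..real i} \<noteq> \<infinity>" for i
    unfolding eq emeasure_radial_density
    using emeasure_lborel_cball_finite[of "0::'a" "real i"] by (simp add: cball_def)
qed auto

lemma AE_lebesgue_neq: "AE x in lebesgue. x \<noteq> (c::'a::euclidean_space)"
  by (rule AE_I'[of "{c}"]) (auto simp: negligible_iff_null_sets[symmetric])

lemma AE_norm_iff:
  assumes [measurable]: "Measurable.pred borel P"
  shows "(AE x in lebesgue. P (norm (x::'a::euclidean_space))) \<longleftrightarrow> (AE r in lborel. 0 < r \<longrightarrow> P r)"
proof -
  have "(AE x in lebesgue. P (norm (x::'a))) \<longleftrightarrow> (AE x in lborel. P (norm (x::'a)))"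
    by (rule AE_completion_iff)
  also have "\<dots> \<longleftrightarrow> (AE r in distr lborel borel (norm :: 'a \<Rightarrow> real). P r)"
    by (subst AE_distr_iff) auto
  also have "\<dots> \<longleftrightarrow> (AE r in lborel. 0 < r \<longrightarrow> P r)"
    unfolding distr_norm_lborel
    by (subst AE_density) (auto simp: radial_density_def intro!: AE_cong)
  finally show ?thesis .
qed

text \<open>Measurability of \<open>P\<close> is avoided by enlarging the exceptional set of radii
  to a Borel null set, to which \<open>AE_norm_iff\<close> applies.\<close>

lemma AE_norm:
  assumes "AE r in lborel. 0 < r \<longrightarrow> P r"
  shows "AE x in lebesgue. P (norm (x::'a::euclidean_space))"
proof -
  from assms obtain S where S: "{r \<in> space lborel. \<not> (0 < r \<longrightarrow> P r)} \<subseteq> S" "emeasure lborel S = 0" "S \<in> sets lborel"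
    by (auto elim!: AE_E)
  have [measurable]: "S \<in> sets borel" using S by simp
  have "AE r in lborel. 0 < r \<longrightarrow> r \<notin> S"
    by (rule AE_I'[of S]) (use S in auto)
  then have "AE x in lebesgue. norm (x::'a) \<notin> S"
    by (subst AE_norm_iff) auto
  moreover have "AE x in lebesgue. x \<noteq> (0::'a)" by (rule AE_lebesgue_neq)
  ultimately show ?thesis
  proof eventually_elim
    case (elim x)
    have "r \<in> S" if "0 < r" "\<not> P r" for r using S(1) that by auto
    from this[of "norm x"] show ?case using elim by auto
  qed
qed

lemma integral_norm:
  fixes f :: "real \<Rightarrow> real"
  assumes [measurable]: "f \<in> borel_measurable borel"
    and bd: "\<And>r. \<bar>f r\<bar> \<le> C" and supp: "\<And>r. r > R \<Longrightarrow> f r = 0"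
  shows "(LINT x|lebesgue. f (norm (x::'a::euclidean_space)))
     = DIM('a) * unit_ball_vol DIM('a) * integral {0..R} (\<lambda>r. r ^ (DIM('a) - 1) * f r)"
proof -
  let ?N = "DIM('a)" and ?V = "unit_ball_vol DIM('a)"
  have int: "set_integrable lborel {0..R} (\<lambda>r. r ^ (?N - 1) * f r)"
    unfolding set_integrable_def
  proof (rule integrableI_bounded_set_indicator[where B = "(\<bar>R\<bar>) ^ (?N - 1) * C"])
    show "AE x in lborel. x \<in> {0..R} \<longrightarrow> norm (x ^ (?N - 1) * f x) \<le> \<bar>R\<bar> ^ (?N - 1) * C"
      by (intro AE_I2 impI) (auto simp: abs_mult power_abs intro!: mult_mono power_mono bd)
  qed (auto simp: emeasure_lborel_Icc_eq)
  have "(LINT x|lebesgue. f (norm (x::'a))) = (LINT x|lborel. f (norm (x::'a)))"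
    by (rule integral_completion) measurable
  also have "\<dots> = (LINT r|distr lborel borel (norm :: 'a \<Rightarrow> real). f r)"
    by (subst integral_distr) auto
  also have "\<dots> = (LINT r|lborel. radial_density TYPE('a) r * f r)"
    unfolding distr_norm_lborel
    by (subst integral_density) (auto simp: radial_density_nonneg)
  \<comment> \<open>At \<open>r = 0\<close> the two integrands may differ when
    \<open>DIM('a) = 1\<close>, because then the power is \<open>0 ^ 0 = 1\<close>; hence the
    exceptional set \<open>{0}\<close>.\<close>
  also have "\<dots> = (LINT r|lborel. (?N * ?V) * (indicator {0..R} r *\<^sub>R (r ^ (?N - 1) * f r)))"
    by (intro integral_cong_AE AE_I'[of "{0}"])
       (use supp in \<open>force simp: radial_density_def not_le split: split_indicator_asm if_splits\<close>)+
  also have "\<dots> = (?N * ?V) * (LINT r:{0..R}|lborel. r ^ (?N - 1) * f r)"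
    unfolding set_lebesgue_integral_def by simp
  also have "(LINT r:{0..R}|lborel. r ^ (?N - 1) * f r) = integral {0..R} (\<lambda>r. r ^ (?N - 1) * f r)"
    using int by (rule set_borel_integral_eq_integral)
  finally show ?thesis .
qed

text \<open>
  Radial sets are approximated from inside by radial compact sets, since the norm maps compact sets to
  compact sets.
\<close>

lemma radial_lebesgue_set:
  assumes S: "{x::'a::euclidean_space. norm x \<in> T} \<in> sets lebesgue" and T: "T \<subseteq> {0<..}"
  shows "T \<in> sets lebesgue"
proof -
  have inner: "\<exists>B. B \<in> sets borel \<and> B \<subseteq> Q \<and> (AE x in lebesgue. norm (x::'a) \<in> Q \<longrightarrow> norm x \<in> B)"
    if Q: "{x::'a. norm x \<in> Q} \<in> sets lebesgue" for Q
  proof -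
    have "\<exists>T. closed T \<and> T \<subseteq> {x::'a. norm x \<in> Q} \<and> emeasure lebesgue ({x::'a. norm x \<in> Q} - T) < ennreal (1 / Suc n)" for n
      using sets_lebesgue_inner_closed[OF Q, of "1 / Suc n"] by (metis zero_less_divide_1_iff of_nat_0_less_iff zero_less_Suc)
    then obtain K where K: "\<And>n. closed (K n)" "\<And>n. K n \<subseteq> {x::'a. norm x \<in> Q}"
      "\<And>n. emeasure lebesgue ({x::'a. norm x \<in> Q} - K n) < ennreal (1 / Suc n)"
      by metis
    \<comment> \<open>The norm need not map closed sets to Borel sets in an obvious way, but each
      closed set is a countable union of compact pieces.\<close>
    define B where "B = (\<Union>n m. norm ` (K n \<inter> cball 0 (real m)))"
    have "compact (norm ` (K n \<inter> cball 0 (real m)))" for n m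
      by (intro compact_continuous_image continuous_intros closed_Int_compact K compact_cball)
    then have B: "B \<in> sets borel"
      unfolding B_def by (intro sets.countable_UN) (auto intro: borel_compact)
    let ?Z = "{x::'a. norm x \<in> Q} - (\<Union>n. K n)"
    have Z: "?Z \<in> sets lebesgue"
      using Q K(1) by (intro sets.Diff sets.countable_UN) auto
    have "emeasure lebesgue ?Z \<le> ennreal (1 / Suc n)" for n
    proof -
      have "emeasure lebesgue ?Z \<le> emeasure lebesgue ({x::'a. norm x \<in> Q} - K n)"
        using Q K(1) by (intro emeasure_mono sets.Diff) auto
      then show ?thesis using K(3)[of n] by (meson order.trans less_imp_le)
    qed
    then have "emeasure lebesgue ?Z \<le> ennreal e" if "e > 0" for e
      by (meson that order.trans ennreal_leI less_imp_le nat_approx_posE)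
    then have "emeasure lebesgue ?Z = 0"
      by (metis ennreal_le_epsilon add_0 le_zero_eq)
    then have "?Z \<in> null_sets lebesgue" using Z by auto
    then have "AE x in lebesgue. norm (x::'a) \<in> Q \<longrightarrow> norm x \<in> B"
      by (rule AE_I') (auto simp: B_def, metis IntI image_eqI mem_cball_0 real_arch_simple)
    moreover have "B \<subseteq> Q" using K(2) by (auto simp: B_def)
    ultimately show ?thesis using B by blast
  qed
  obtain B1 where B1: "B1 \<in> sets borel" "B1 \<subseteq> T" "AE x in lebesgue. norm (x::'a) \<in> T \<longrightarrow> norm x \<in> B1"
    using inner[OF S] by blast
  \<comment> \<open>Inner approximation of the complement as well: \<open>B1\<close> and the
    complement of \<open>B2\<close> enclose \<open>T\<close>, and almost every positive radius lies
    in \<open>B1\<close> or \<open>B2\<close>, so \<open>T - B1\<close> is null.\<close>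
  have "{x::'a. norm x \<in> - T} = - {x. norm x \<in> T}" by auto
  then have "{x::'a. norm x \<in> - T} \<in> sets lebesgue" using S by (simp add: Compl_in_sets_lebesgue)
  from inner[OF this] obtain B2 where B2: "B2 \<in> sets borel" "B2 \<subseteq> - T"
      "AE x in lebesgue. norm (x::'a) \<in> - T \<longrightarrow> norm x \<in> B2"
    by blast
  note [measurable] = B1(1) B2(1)
  have "AE x in lebesgue. norm (x::'a) \<in> B1 \<union> B2"
    using B1(3) B2(3) by eventually_elim auto
  then have "AE r in lborel. 0 < r \<longrightarrow> r \<in> B1 \<union> B2"
    by (subst (asm) AE_norm_iff) auto
  then have "{r. \<not> (0 < r \<longrightarrow> r \<in> B1 \<union> B2)} \<in> null_sets lborel"
    by (subst (asm) AE_iff_null) auto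
  moreover have "T - B1 \<subseteq> {r. \<not> (0 < r \<longrightarrow> r \<in> B1 \<union> B2)}"
    using T B2(2) by auto
  ultimately have "T - B1 \<in> null_sets lebesgue"
    by (metis null_sets_completion_subset null_sets_completionI)
  then have "B1 \<union> (T - B1) \<in> sets lebesgue"
    using B1(1) by (intro sets.Un) auto
  then show ?thesis using B1(2) by (simp add: Un_absorb1)
qed

section \<open>A bounded Borel version of the radial coefficient\<close>

lemma radial_profile_measurable:
  fixes a :: "'a::euclidean_space \<Rightarrow> real"
  assumes a_meas: "a \<in> borel_measurable lebesgue"
    and a_radial: "\<forall>x\<in>ball 0 R. a x = \<alpha> (norm x)"
  shows "(\<lambda>r. if 0 < r \<and> r < R then \<alpha> r else 0) \<in> borel_measurable lebesgue" (is "?f \<in> _")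
proof (rule measurableI)
  fix B :: "real set" assume B: "B \<in> sets borel"
  \<comment> \<open>The radius \<open>0\<close> is a single point in space and carries no
    information on \<open>\<alpha>\<close> near it; radii \<open>\<ge> R\<close> are dropped because
    \<open>\<alpha>\<close> is tied to \<open>a\<close> only inside the ball.\<close>
  let ?T = "{r. 0 < r \<and> r < R \<and> \<alpha> r \<in> B}"
  have "{x::'a. norm x \<in> ?T} = (a -` B \<inter> space lebesgue) \<inter> (ball 0 R - {0})"
    using a_radial by auto
  also have "\<dots> \<in> sets lebesgue"
    using measurable_sets[OF a_meas B] by (intro sets.Int) auto
  finally have T: "?T \<in> sets lebesgue" by (rule radial_lebesgue_set) auto
  have "?f -` B \<inter> space lebesgue = ?T \<union> (if 0 \<in> B then - {0<..<R} else {})"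
    by (auto split: if_splits)
  also have "\<dots> \<in> sets lebesgue" using T by auto
  finally show "?f -` B \<inter> space lebesgue \<in> sets lebesgue" .
qed auto

text \<open>The shooting argument uses bounds and signs at every radius, whereas
  \<open>\<alpha>\<close> is bounded only almost everywhere. In the annulus \<open>\<beta>\<close>
  must agree with \<open>\<alpha>\<close> itself, since continuity and monotonicity would not
  survive a change on a null set; elsewhere it may be modified freely on null sets.\<close>

lemma radial_profile:
  fixes a :: "'a::euclidean_space \<Rightarrow> real" and \<alpha> :: "real \<Rightarrow> real"
  assumes a_meas: "a \<in> borel_measurable lebesgue"
    and a_bdd: "\<exists>C. AE x in lebesgue. x \<in> ball 0 R \<longrightarrow> \<bar>a x\<bar> \<le> C"
    and a_radial: "\<forall>x\<in>ball 0 R. a x = \<alpha> (norm x)"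
    and R0: "0 < R0" "R0 < R"
    and a_pos_in: "\<forall>x\<in>ball 0 R0. a x \<ge> 0"
    and a_neg_out: "\<forall>x. R0 < norm x \<and> norm x < R \<longrightarrow> a x \<le> 0"
    and \<alpha>_cont: "continuous_on {R0<..<R} \<alpha>"
    and \<alpha>_mono: "\<forall>s\<in>{R0<..<R}. \<forall>t\<in>{R0<..<R}. s \<le> t \<longrightarrow> \<alpha> t \<le> \<alpha> s"
  obtains \<beta> C where "\<beta> \<in> borel_measurable borel" "\<And>r. \<bar>\<beta> r\<bar> \<le> C" "\<And>r. r \<ge> R \<Longrightarrow> \<beta> r = 0"
    "\<And>r. r \<le> R0 \<Longrightarrow> 0 \<le> \<beta> r" "\<And>r. R0 < r \<Longrightarrow> r < R \<Longrightarrow> \<beta> r = \<alpha> r" "\<And>r. R0 \<le> r \<Longrightarrow> \<beta> r \<le> 0"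
    "AE x in lebesgue. x \<in> ball 0 R \<longrightarrow> a x = \<beta> (norm x)"
proof -
  let ?\<alpha> = "\<lambda>r. if 0 < r \<and> r < R then \<alpha> r else 0"
  obtain g where [measurable]: "g \<in> borel_measurable borel" and g: "AE r in lborel. ?\<alpha> r = g r"
    using completion_ex_borel_measurable_real[OF radial_profile_measurable[OF a_meas a_radial]] by auto
  obtain C0 where C0: "AE x in lebesgue. x \<in> ball 0 R \<longrightarrow> \<bar>a x\<bar> \<le> C0" using a_bdd by auto
  define C where "C = max 0 C0"
  have g': "AE x in lebesgue. ?\<alpha> (norm (x::'a)) = g (norm x)"
    by (rule AE_norm) (use g in \<open>eventually_elim, blast\<close>)
  have n0: "AE x in lebesgue. x \<noteq> (0::'a)" by (rule AE_lebesgue_neq)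
  have nR0: "AE x in lebesgue. norm x \<noteq> R0 \<or> x = (0::'a)"
    by (rule AE_I'[of "sphere 0 R0"]) (auto simp: negligible_iff_null_sets[symmetric] negligible_sphere)
  have "AE x in lebesgue. \<bar>g (norm (x::'a))\<bar> \<le> C"
    using C0 g' by eventually_elim (use a_radial in \<open>auto simp: C_def split: if_splits\<close>)
  then have "AE r in lborel. 0 < r \<longrightarrow> \<bar>g r\<bar> \<le> C"
    by (subst (asm) AE_norm_iff) auto
  then have bd: "AE r in lborel. 0 < r \<and> r < R \<longrightarrow> \<bar>\<alpha> r\<bar> \<le> C"
    using g by eventually_elim auto
  have le0: "\<alpha> r \<le> 0" if "R0 < r" "r < R" for r
  proof -
    obtain b :: 'a where b: "b \<in> Basis" by (meson SOME_Basis)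
    have "norm (r *\<^sub>R b) = r" using b that R0 by simp
    then show ?thesis using a_neg_out[rule_format, of "r *\<^sub>R b"] a_radial that by (metis mem_ball_0)
  qed
  have bd_\<alpha>: "\<bar>\<alpha> r\<bar> \<le> C" if r: "R0 < r" "r < R" for r
  proof (rule ccontr)
    assume "\<not> \<bar>\<alpha> r\<bar> \<le> C"
    then have "\<alpha> r < - C" using le0[OF r] by auto
    \<comment> \<open>By monotonicity a violation at \<open>r\<close> propagates to the interval
      from \<open>r\<close> to \<open>R\<close>, which has positive measure.\<close>
    then have "\<alpha> s < - C" if "s \<in> {r<..<R}" for s
      using \<alpha>_mono r that by (smt (verit) greaterThanLessThan_iff)
    then have "s \<notin> {r<..<R}" if "0 < s \<and> s < R \<longrightarrow> \<bar>\<alpha> s\<bar> \<le> C" for s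
      using that r R0 by fastforce
    then have "AE s in lborel. s \<notin> {r<..<R}"
      using AE_mp[OF bd, of "\<lambda>s. s \<notin> {r<..<R}"] by blast
    then have "{r<..<R} \<in> null_sets lborel"
      by (subst (asm) AE_iff_null_sets[symmetric]) auto
    then show False using r by (simp add: null_sets_def)
  qed
  \<comment> \<open>Clipping to \<open>[0, C]\<close> in the inner ball alters \<open>g\<close> only
    on a null set of radii. At \<open>R0\<close> both summands vanish.\<close>
  define \<beta> where "\<beta> r = (if 0 < r \<and> r < R0 then max 0 (min C (g r)) else 0)
      + (if r \<in> {R0<..<R} then \<alpha> r else 0)" for r
  have "(\<lambda>r. if r \<in> {R0<..<R} then \<alpha> r else 0) \<in> borel_measurable borel"
    by (rule borel_measurable_continuous_on_if) (auto intro: \<alpha>_cont)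
  then have m: "\<beta> \<in> borel_measurable borel"
    unfolding \<beta>_def by measurable
  have "AE x in lebesgue. x \<in> ball 0 R \<longrightarrow> a x = \<beta> (norm x)"
    using n0 nR0 g' C0
  proof eventually_elim
    case (elim x)
    show ?case
    proof
      assume x: "x \<in> ball 0 R"
      show "a x = \<beta> (norm x)"
      proof (cases "norm x < R0")
        case True
        then have "0 \<le> a x" using a_pos_in by simp
        moreover have "a x = g (norm x)" "a x \<le> C"
          using elim x a_radial by (auto simp: C_def)
        ultimately have "a x = g (norm x)" "0 \<le> a x" "a x \<le> C" by auto
        then show ?thesis using True elim by (auto simp: \<beta>_def)
      next
        case False
        then show ?thesis using elim x a_radial by (auto simp: \<beta>_def)
      qed
    qed
  qed
  moreover have "0 \<le> C" by (simp add: C_def)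
  ultimately show ?thesis
    using bd_\<alpha> le0 m R0 by (intro that[of \<beta> C]) (auto simp: \<beta>_def)
qed

section \<open>A Picone-type quadratic form\<close>

text \<open>This is the monotonicity of \<open>sinh x / x\<close> with denominators cleared.\<close>

lemma sinh_scaled_less:
  fixes q A t :: real
  assumes "0 < q" "q < A" "0 < t"
  shows "A * sinh (q * t) < q * sinh (A * t)"
proof -
  let ?f = "\<lambda>t. q * sinh (A * t) - A * sinh (q * t)"
  have "?f 0 < ?f t"
  proof (rule DERIV_pos_imp_increasing_open[OF assms(3)])
    fix x assume x: "0 < x" "x < t"
    have "q * x < A * x" "0 < q * x" using assms x by auto
    then have "cosh (q * x) < cosh (A * x)"
      by (intro cosh_real_strict_mono) auto
    then have "0 < q * A * (cosh (A * x) - cosh (q * x))"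
      using assms by auto
    moreover have "(?f has_real_derivative q * A * (cosh (A * x) - cosh (q * x))) (at x)"
      by (auto intro!: derivative_eq_intros simp: algebra_simps)
    ultimately show "\<exists>y. (?f has_real_derivative y) (at x) \<and> 0 < y" by blast
  qed (auto intro!: continuous_intros)
  then show ?thesis by simp
qed

text \<open>With \<open>A = (1 + q) / 2\<close>, the half-angle identities reduce the claim to
  \<open>A^2 * sinh(q t)^2 < q * sinh(A t)^2\<close>. Since \<open>q < A\<close>, the previous lemma
  gives this even with \<open>q^2\<close> on the right, and \<open>q^2 \<le> q\<close>.\<close>

lemma cosh_discriminant:
  fixes q t :: real
  assumes q: "0 < q" "q < 1" and t: "t \<noteq> 0"
  shows "((1 + q) * cosh (q * t))\<^sup>2 < 1 + q\<^sup>2 + 2 * q * cosh ((1 + q) * t)"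
proof -
  have *: "((1 + q) * cosh (q * t))\<^sup>2 < 1 + q\<^sup>2 + 2 * q * cosh ((1 + q) * t)" if t: "t > 0" for t
  proof -
    let ?A = "(1 + q) / 2"
    have "?A * sinh (q * t) < q * sinh (?A * t)"
      using q t by (intro sinh_scaled_less) auto
    then have "(?A * sinh (q * t))\<^sup>2 < (q * sinh (?A * t))\<^sup>2"
      using q t by (intro power_strict_mono) auto
    also have "\<dots> = q * (q * (sinh (?A * t))\<^sup>2)"
      by (simp add: power_mult_distrib power2_eq_square)
    also have "\<dots> \<le> 1 * (q * (sinh (?A * t))\<^sup>2)"
      using q by (intro mult_right_mono) auto
    finally have 1: "(1 + q)\<^sup>2 * (sinh (q * t))\<^sup>2 < 4 * q * (sinh (?A * t))\<^sup>2"
      by (simp add: power_mult_distrib power_divide)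
    have "cosh ((1 + q) * t) = cosh (2 * (?A * t))" by simp
    also have "\<dots> = (cosh (?A * t))\<^sup>2 + (sinh (?A * t))\<^sup>2"
      by (rule cosh_double)
    also have "\<dots> = 1 + 2 * (sinh (?A * t))\<^sup>2"
      by (subst cosh_square_eq) simp
    finally have 2: "cosh ((1 + q) * t) = 1 + 2 * (sinh (?A * t))\<^sup>2" .
    have "((1 + q) * cosh (q * t))\<^sup>2 = (1 + q)\<^sup>2 + (1 + q)\<^sup>2 * (sinh (q * t))\<^sup>2"
      unfolding power_mult_distrib by (subst cosh_square_eq) (simp add: algebra_simps)
    also have "\<dots> < (1 + q)\<^sup>2 + 4 * q * (sinh (?A * t))\<^sup>2"
      using 1 by simp
    also have "\<dots> = 1 + q\<^sup>2 + 2 * q * (1 + 2 * (sinh (?A * t))\<^sup>2)"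
      by (simp add: power2_eq_square distrib_left distrib_right)
    finally show ?thesis unfolding 2 .
  qed
  show ?thesis
  proof (cases "t > 0")
    case False
    then have "- t > 0" using t by simp
    from *[OF this] show ?thesis by simp
  qed (use * in auto)
qed

text \<open>With \<open>X\<close>, \<open>Y\<close> the gradients of \<open>u\<close>,
  \<open>v\<close> and \<open>s = v / u\<close>, this is the sum of the two tested gradient terms,
  see \<open>picone_test_identity\<close>. At \<open>s = 1\<close> it degenerates to
  \<open>(1 + q) * (norm (X - Y))^2\<close>.\<close>

definition picone :: "real \<Rightarrow> 'a::real_inner \<Rightarrow> 'a \<Rightarrow> real \<Rightarrow> real" where
  "picone q X Y s = (1 + q * s powr (1 + q)) * (X \<bullet> X) + (1 + q * s powr (- 1 - q)) * (Y \<bullet> Y)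
      - (1 + q) * (s powr q + s powr (- q)) * (X \<bullet> Y)"

text \<open>The substitution \<open>s = exp t\<close> makes both sides functions of hyperbolic
  cosines. At \<open>s = 1\<close> there is equality, which is why that value is excluded.\<close>

lemma picone_discriminant:
  fixes q s :: real
  assumes "0 < q" "q < 1" "0 < s" "s \<noteq> 1"
  shows "((1 + q) * (s powr q + s powr (- q)) / 2)\<^sup>2
           < (1 + q * s powr (1 + q)) * (1 + q * s powr (- 1 - q))"
proof -
  define t where "t = ln s"
  have s: "s powr x = exp (x * t)" for x using assms by (simp add: powr_def t_def)
  have "t \<noteq> 0" using assms by (simp add: t_def)
  have c: "s powr q + s powr (- q) = 2 * cosh (q * t)"
    by (simp add: s cosh_def)
  have "s powr (1 + q) * s powr (- 1 - q) = 1"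
    using assms by (simp add: powr_add[symmetric])
  then have "(1 + q * s powr (1 + q)) * (1 + q * s powr (- 1 - q))
      = 1 + q\<^sup>2 + q * (s powr (1 + q) + s powr (- 1 - q))"
    by (simp add: algebra_simps power2_eq_square)
  also have "s powr (1 + q) + s powr (- 1 - q) = 2 * cosh ((1 + q) * t)"
    by (simp add: s cosh_def algebra_simps)
  finally show ?thesis
    unfolding c using cosh_discriminant[OF assms(1,2) \<open>t \<noteq> 0\<close>] by (simp add: mult.assoc mult.left_commute)
qed

text \<open>Completing the square in \<open>X\<close> reduces definiteness in any inner product
  space to the sign of a scalar determinant.\<close>

lemma picone_completed_square:
  fixes X Y :: "'a::real_inner"
  defines "A \<equiv> \<lambda>q s. 1 + q * s powr (1 + q)" and "B \<equiv> \<lambda>q s. 1 + q * s powr (- 1 - q)"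
    and "c \<equiv> \<lambda>q s. (1 + q) * (s powr q + s powr (- q)) / 2"
  shows "A q s * picone q X Y s = (norm (A q s *\<^sub>R X - c q s *\<^sub>R Y))\<^sup>2 + (A q s * B q s - (c q s)\<^sup>2) * (norm Y)\<^sup>2"
  unfolding power2_norm_eq_inner
proof -
  have "picone q X Y s = A q s * (X \<bullet> X) + B q s * (Y \<bullet> Y) - 2 * c q s * (X \<bullet> Y)"
    unfolding picone_def A_def B_def c_def by simp
  then have "A q s * picone q X Y s = A q s * (A q s * (X \<bullet> X) + B q s * (Y \<bullet> Y) - 2 * c q s * (X \<bullet> Y))"
    by simp
  then show "A q s * picone q X Y s = (A q s *\<^sub>R X - c q s *\<^sub>R Y) \<bullet> (A q s *\<^sub>R X - c q s *\<^sub>R Y)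
      + (A q s * B q s - (c q s)\<^sup>2) * (Y \<bullet> Y)"
    by (simp add: inner_diff_left inner_diff_right inner_commute algebra_simps power2_eq_square)
qed

lemma picone_nonneg:
  assumes "0 < q" "q < 1" "0 < s"
  shows "0 \<le> picone q X Y s"
proof (cases "s = 1")
  case True
  have "picone q X Y s = (1 + q) * (norm (X - Y))\<^sup>2"
    unfolding picone_def power2_norm_eq_inner True
    by (simp add: inner_diff_left inner_diff_right inner_commute algebra_simps)
  then show ?thesis using assms by simp
next
  case False
  have "0 < 1 + q * s powr (1 + q)"
    using assms by (simp add: add_pos_nonneg)
  moreover have "0 \<le> (1 + q * s powr (1 + q)) * picone q X Y s"
    unfolding picone_completed_square using picone_discriminant[OF assms False] by simp
  ultimately show ?thesis by (simp add: zero_le_mult_iff)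
qed

lemma picone_eq_0D:
  assumes "0 < q" "q < 1" "0 < s" "s \<noteq> 1" and 0: "picone q X Y s = 0"
  shows "X = 0" "Y = 0"
proof -
  note d = picone_discriminant[OF assms(1-4)]
  have A: "0 < 1 + q * s powr (1 + q)"
    using assms by (simp add: add_pos_nonneg)
  have "0 = (1 + q * s powr (1 + q)) * picone q X Y s" using 0 by simp
  note eq = this[unfolded picone_completed_square]
  then have "((1 + q * s powr (1 + q)) * (1 + q * s powr (- 1 - q))
      - ((1 + q) * (s powr q + s powr (- q)) / 2)\<^sup>2) * (norm Y)\<^sup>2 \<le> 0"
    by (smt (verit) zero_le_power2)
  then show Y: "Y = 0"
    using d by (smt (verit) mult_pos_pos zero_less_norm_iff zero_less_power)
  show "X = 0" using eq A unfolding Y by simp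
qed

section \<open>Quadratic spline cutoffs\<close>

definition sqpos :: "real \<Rightarrow> real" where "sqpos t = (max 0 t)\<^sup>2"

lemma sqpos_has_derivative: "(sqpos has_real_derivative 2 * max 0 t) (at t)"
proof -
  have "\<bar>sqpos (t + h) - sqpos t - 2 * max 0 t * h\<bar> \<le> h\<^sup>2" for h
  proof -
    consider "t \<le> 0" "t + h \<le> 0" | "t \<ge> 0" "t + h \<ge> 0" | "t < 0" "t + h > 0" | "t > 0" "t + h < 0" by linarith
    then show ?thesis
    proof cases
      case 3
      then have "(t + h)\<^sup>2 \<le> h\<^sup>2" by (intro power_mono) auto
      then show ?thesis using 3 by (simp add: sqpos_def)
    next
      case 4
      have "- t\<^sup>2 - 2 * t * h = h\<^sup>2 - (t + h)\<^sup>2" by (simp add: power2_eq_square algebra_simps)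
      moreover have "(t + h)\<^sup>2 \<le> h\<^sup>2" using 4 by (simp add: abs_le_square_iff[symmetric])
      ultimately show ?thesis using 4 by (simp add: sqpos_def)
    qed (auto simp: sqpos_def power2_eq_square algebra_simps)
  qed
  then have "\<bar>(sqpos (t + h) - sqpos t) / h - 2 * max 0 t\<bar> \<le> \<bar>h\<bar>" if "h \<noteq> 0" for h
  proof -
    have "\<bar>(sqpos (t + h) - sqpos t) / h - 2 * max 0 t\<bar> = \<bar>sqpos (t + h) - sqpos t - 2 * max 0 t * h\<bar> / \<bar>h\<bar>"
      using that by (simp add: field_simps flip: abs_divide)
    also have "\<dots> \<le> h\<^sup>2 / \<bar>h\<bar>" using \<open>\<And>h. _ \<le> h\<^sup>2\<close> by (intro divide_right_mono) auto
    finally show ?thesis using that by (simp add: power2_eq_square abs_if split: if_splits)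
  qed
  then have "((\<lambda>h. (sqpos (t + h) - sqpos t) / h - 2 * max 0 t) \<longlongrightarrow> 0) (at 0)"
    by (intro Lim_null_comparison[OF _ tendsto_rabs_zero[OF tendsto_ident_at]])
       (auto simp: eventually_at intro!: exI[of _ 1])
  then show ?thesis
    unfolding DERIV_def by (simp add: LIM_zero_iff)
qed

text \<open>Half the second difference of \<open>sqpos\<close>: a quadratic spline rising from
  \<open>0\<close> to \<open>1\<close> on \<open>[0, 2]\<close>, whose derivative is the hat
  function. The test class only asks for C^1.\<close>

definition cutoff :: "real \<Rightarrow> real" where
  "cutoff t = (sqpos t - 2 * sqpos (t - 1) + sqpos (t - 2)) / 2"

definition cutoff' :: "real \<Rightarrow> real" where
  "cutoff' t = max 0 t - 2 * max 0 (t - 1) + max 0 (t - 2)"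

lemma cutoff_has_derivative: "(cutoff has_real_derivative cutoff' t) (at t)"
proof -
  note [derivative_intros] = DERIV_chain2[OF sqpos_has_derivative]
  show ?thesis unfolding cutoff_def cutoff'_def
    by (auto intro!: derivative_eq_intros)
qed

lemma cutoff_0: "t \<le> 0 \<Longrightarrow> cutoff t = 0"
  and cutoff_1: "2 \<le> t \<Longrightarrow> cutoff t = 1"
  by (simp_all add: cutoff_def sqpos_def power2_eq_square algebra_simps)

lemma cutoff'_0: "t \<le> 0 \<Longrightarrow> cutoff' t = 0" "2 \<le> t \<Longrightarrow> cutoff' t = 0"
  and abs_cutoff'_le: "\<bar>cutoff' t\<bar> \<le> 1"
  by (auto simp: cutoff'_def max_def)

lemma cutoff_bounds: "0 \<le> cutoff t" "cutoff t \<le> 1"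
proof -
  have mono: "cutoff x \<le> cutoff y" if "x \<le> y" for x y
  proof (rule DERIV_nonneg_imp_nondecreasing[OF that])
    fix z show "\<exists>d. (cutoff has_real_derivative d) (at z) \<and> 0 \<le> d"
      using cutoff_has_derivative[of z] by (intro exI conjI) (auto simp: cutoff'_def max_def)
  qed
  show "0 \<le> cutoff t" using mono[of "min t 0" t] by (simp add: cutoff_0)
  show "cutoff t \<le> 1" using mono[of t "max t 2"] by (simp add: cutoff_1)
qed

lemma continuous_on_cutoff: "continuous_on S cutoff" "continuous_on S cutoff'"
  unfolding cutoff_def cutoff'_def sqpos_def by (auto intro!: continuous_intros)

section \<open>Neumann test functions and uniqueness\<close>

lemma set_lebesgue_integral_lebesgue_on:
  fixes f :: "'a::euclidean_space \<Rightarrow> real"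
  assumes "S \<in> sets lebesgue"
  shows "(LINT x:S|lebesgue. f x) = (LINT x|lebesgue_on S. f x)"
  using assms by (simp add: set_lebesgue_integral_def integral_restrict_space)

lemma finite_measure_lebesgue_on_ball: "finite_measure (lebesgue_on (ball (c::'a::euclidean_space) r))"
  by (rule finite_measure_lebesgue_on) simp

lemma integrable_lebesgue_on_ball_bounded:
  fixes f :: "'a::euclidean_space \<Rightarrow> real"
  assumes "f \<in> borel_measurable (lebesgue_on (ball c r))" "AE x in lebesgue_on (ball c r). \<bar>f x\<bar> \<le> C"
  shows "integrable (lebesgue_on (ball c r)) f"
  using finite_measure.integrable_const_bound[OF finite_measure_lebesgue_on_ball, of f C c r] assms by auto

lemma AE_lebesgue_on_ballI:
  assumes "AE x in lebesgue. x \<in> ball c r \<longrightarrow> P x"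
  shows "AE x in lebesgue_on (ball (c::'a::euclidean_space) r). P x"
  using assms by (subst AE_restrict_space_iff) auto

lemma AE_lebesgue_on_ballI2:
  assumes "\<And>x. x \<in> ball c r \<Longrightarrow> P x"
  shows "AE x in lebesgue_on (ball (c::'a::euclidean_space) r). P x"
  by (rule AE_lebesgue_on_ballI) (simp add: assms)

lemma continuous_measurable_lebesgue_on_ball:
  fixes f :: "'a::euclidean_space \<Rightarrow> 'b::euclidean_space"
  assumes "continuous_on (ball c r) f"
  shows "f \<in> borel_measurable (lebesgue_on (ball c r))"
  using assms by (intro continuous_imp_measurable_on_sets_lebesgue) auto

lemma measurable_lebesgue_imp_lebesgue_on:
  "f \<in> borel_measurable lebesgue \<Longrightarrow> f \<in> borel_measurable (lebesgue_on S)"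
  by (rule measurable_restrict_space1)

section \<open>From compactly supported test functions to test functions up to the boundary\<close>

definition ball_cutoff :: "real \<Rightarrow> real \<Rightarrow> 'a::real_inner \<Rightarrow> real" where
  "ball_cutoff R k x = cutoff (k * (R\<^sup>2 - x \<bullet> x) - 1)"

definition ball_cutoff' :: "real \<Rightarrow> real \<Rightarrow> 'a::real_inner \<Rightarrow> 'a" where
  "ball_cutoff' R k x = (- 2 * k * cutoff' (k * (R\<^sup>2 - x \<bullet> x) - 1)) *\<^sub>R x"

lemma ball_cutoff_has_derivative:
  fixes x :: "'a::real_inner"
  shows "(ball_cutoff R k has_derivative (\<lambda>h. ball_cutoff' R k x \<bullet> h)) (at x)"
proof -
  have "((\<lambda>x::'a. k * (R\<^sup>2 - x \<bullet> x) - 1) has_derivative (\<lambda>h. - 2 * k * (x \<bullet> h))) (at x)"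
    by (auto intro!: derivative_eq_intros simp: inner_commute algebra_simps)
  from has_derivative_compose[OF this cutoff_has_derivative[unfolded has_field_derivative_def]]
  show ?thesis
    unfolding ball_cutoff_def ball_cutoff'_def by (simp add: algebra_simps)
qed

lemma continuous_on_ball_cutoff:
  "continuous_on S (ball_cutoff R k)" "continuous_on S (ball_cutoff' R k)"
  unfolding ball_cutoff_def ball_cutoff'_def
  by (intro continuous_intros continuous_on_compose2[OF continuous_on_cutoff(1)[of UNIV]]
      continuous_on_compose2[OF continuous_on_cutoff(2)[of UNIV]]; simp)+

text \<open>The shift by \<open>1\<close> in \<open>ball_cutoff\<close> makes the cutoff vanish
  where \<open>R^2 - x \<bullet> x \<le> 1 / k\<close>, so the support stays away from the sphere.
  The ball and the open set \<open>?O\<close>, on which everything vanishes, cover the space;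
  regularity of the extension by zero is checked on each of them.\<close>

lemma ball_cutoff_test:
  fixes \<psi> :: "'a::euclidean_space \<Rightarrow> real"
  assumes R: "0 < R" and k: "0 < k"
    and \<psi>: "\<And>x. x \<in> ball 0 R \<Longrightarrow> (\<psi> has_derivative (\<lambda>h. G x \<bullet> h)) (at x)"
    and G: "continuous_on (ball 0 R) G"
  shows "c1c_test (ball 0 R) (\<lambda>x. if x \<in> ball 0 R then ball_cutoff R k x * \<psi> x else 0)
     (\<lambda>x. if x \<in> ball 0 R then ball_cutoff R k x *\<^sub>R G x + \<psi> x *\<^sub>R ball_cutoff' R k x else 0)"
    (is "c1c_test _ ?\<phi> ?G")
proof -
  let ?O = "{x::'a. R\<^sup>2 - 1 / k < x \<bullet> x}"
  have O: "open ?O" by (intro open_Collect_less continuous_intros)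
  have big: "k * (R\<^sup>2 - x \<bullet> x) - 1 \<le> 0 \<longleftrightarrow> R\<^sup>2 - 1 / k \<le> x \<bullet> x" for x :: 'a
    using k by (simp add: field_simps)
  have \<phi>0: "?\<phi> x = 0" if "x \<in> ?O" for x
    using that big[of x] by (auto simp: ball_cutoff_def cutoff_0)
  have G0: "?G x = 0" if "x \<in> ?O" for x
    using that big[of x] by (auto simp: ball_cutoff_def cutoff_0 ball_cutoff'_def cutoff'_0)
  have norm_sq: "x \<bullet> x < R\<^sup>2 \<longleftrightarrow> norm x < R" for x :: 'a
    using R by (metis abs_norm_cancel abs_of_pos dot_square_norm power2_less_imp_less power_strict_mono norm_ge_zero less_imp_le pos2)
  have cover: "x \<in> ?O" if "x \<notin> ball 0 R" for x
    using that norm_sq[of x] k by auto (smt (verit) divide_pos_pos)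
  have "continuous_on (ball 0 R \<union> ?O) ?G"
  proof (rule continuous_on_open_Un)
    have "continuous_on (ball 0 R) (\<lambda>x. ball_cutoff R k x *\<^sub>R G x + \<psi> x *\<^sub>R ball_cutoff' R k x)"
      by (intro continuous_intros G continuous_on_ball_cutoff differentiable_imp_continuous_on)
         (meson \<psi> differentiable_def differentiable_on_def has_derivative_at_withinI)
    then show "continuous_on (ball 0 R) ?G" by (rule continuous_on_eq) simp
    show "continuous_on ?O ?G"
      using G0 by (subst continuous_on_cong[OF refl, of _ _ "\<lambda>_. 0"]) auto
  qed (use O in auto)
  moreover have "ball 0 R \<union> ?O = UNIV" using cover by auto
  ultimately have c: "continuous_on UNIV ?G" by simp
  have d: "(?\<phi> has_derivative (\<lambda>h. ?G x \<bullet> h)) (at x)" for x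
  proof (cases "x \<in> ball 0 R")
    case True
    have "((\<lambda>x. ball_cutoff R k x * \<psi> x) has_derivative (\<lambda>h. ?G x \<bullet> h)) (at x)"
      using True by (auto intro!: derivative_eq_intros ball_cutoff_has_derivative \<psi> simp: inner_add_left)
    then show ?thesis
      by (rule has_derivative_transform_within_open[OF _ open_ball True]) auto
  next
    case False
    have "((\<lambda>_. 0) has_derivative (\<lambda>h. 0)) (at x)" by simp
    then have "(?\<phi> has_derivative (\<lambda>h. 0)) (at x)"
      by (rule has_derivative_transform_within_open[OF _ O cover[OF False]]) (metis \<phi>0)
    then show ?thesis using G0[OF cover[OF False]] by simp
  qed
  have "closed {x::'a. x \<bullet> x \<le> R\<^sup>2 - 1 / k}"
    by (intro closed_Collect_le continuous_intros)
  moreover have "{x. ?\<phi> x \<noteq> 0} \<subseteq> {x. x \<bullet> x \<le> R\<^sup>2 - 1 / k}"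
    using \<phi>0 by (metis (mono_tags, lifting) mem_Collect_eq not_le subsetI)
  ultimately have "closure {x. ?\<phi> x \<noteq> 0} \<subseteq> {x. x \<bullet> x \<le> R\<^sup>2 - 1 / k}"
    by (rule closure_minimal[rotated])
  also have sub: "\<dots> \<subseteq> ball 0 R"
    using norm_sq k by auto (smt (verit) divide_pos_pos)
  finally have cl: "closure {x. ?\<phi> x \<noteq> 0} \<subseteq> ball 0 R" .
  then have "compact (closure {x. ?\<phi> x \<noteq> 0})"
    by (meson bounded_ball bounded_subset closed_closure compact_eq_bounded_closed)
  with c d cl show ?thesis unfolding c1c_test_def by blast
qed

text \<open>Bernoulli's inequality for \<open>(1 - d / R)^N\<close>. The linear rate in
  \<open>d\<close> is what offsets the factor \<open>k\<close> in the gradient of the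
  cutoff.\<close>

lemma measure_boundary_layer:
  assumes R: "0 < R" and d: "0 < d" "d < R"
  shows "measure lebesgue {x::'a::euclidean_space. R - d \<le> norm x \<and> norm x < R}
           \<le> unit_ball_vol DIM('a) * DIM('a) * R ^ (DIM('a) - 1) * d"
proof -
  let ?N = "DIM('a)" and ?V = "unit_ball_vol DIM('a)"
  have eq: "{x::'a. R - d \<le> norm x \<and> norm x < R} = ball 0 R - ball 0 (R - d)" by auto
  have "measure lebesgue (ball (0::'a) R - ball 0 (R - d)) = measure lebesgue (ball (0::'a) R) - measure lebesgue (ball (0::'a) (R - d))"
    using d by (intro measurable_measure_Diff) auto
  also have "\<dots> = ?V * (R ^ ?N - (R - d) ^ ?N)"
    using R d by (simp add: content_ball algebra_simps)
  also have "\<dots> \<le> ?V * (?N * R ^ (?N - 1) * d)"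
  proof (intro mult_left_mono)
    have "1 + real ?N * (- d / R) \<le> (1 + (- d / R)) ^ ?N"
      using d R by (intro Bernoulli_inequality) simp
    then have "R ^ ?N * (1 + real ?N * (- d / R)) \<le> R ^ ?N * (1 + (- d / R)) ^ ?N"
      using R by (intro mult_left_mono) auto
    also have "\<dots> = (R - d) ^ ?N"
      using R by (simp add: power_mult_distrib[symmetric] algebra_simps)
    finally have "R ^ ?N - (R - d) ^ ?N \<le> R ^ ?N * (?N * (d / R))"
      by (simp add: algebra_simps)
    also have "\<dots> = ?N * R ^ (?N - 1) * d"
      using R by (simp add: power_eq_if[of R ?N])
    finally show "R ^ ?N - (R - d) ^ ?N \<le> ?N * R ^ (?N - 1) * d" .
  qed auto
  finally show ?thesis unfolding eq by (simp add: algebra_simps)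
qed

text \<open>Uniform continuity, comparing \<open>x\<close> with its radial projection to the sphere,
  which lies at distance \<open>R - norm x\<close>.\<close>

lemma small_near_sphere:
  fixes f :: "'a::euclidean_space \<Rightarrow> real"
  assumes R: "0 < R" and f: "continuous_on (cball 0 R) f" and f0: "\<And>x. norm x = R \<Longrightarrow> f x = 0" and e: "0 < e"
  obtains d where "0 < d" "d < R" "\<And>x. R - d \<le> norm x \<Longrightarrow> norm x < R \<Longrightarrow> \<bar>f x\<bar> < e"
proof -
  have "uniformly_continuous_on (cball 0 R) f"
    using f by (intro compact_uniformly_continuous) auto
  then obtain d where d: "d > 0" "\<And>x y. x \<in> cball 0 R \<Longrightarrow> y \<in> cball 0 R \<Longrightarrow> dist y x < d \<Longrightarrow> dist (f y) (f x) < e"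
    using e unfolding uniformly_continuous_on_def by metis
  let ?d = "min (d / 2) (R / 2)"
  show thesis
  proof (rule that[of ?d])
    fix x :: 'a assume x: "R - ?d \<le> norm x" "norm x < R"
    then have nx: "norm x > 0" using R by (auto simp: min_def split: if_splits)
    define y where "y = (R / norm x) *\<^sub>R x"
    have ny: "norm y = R" using nx R by (simp add: y_def)
    have "dist y x = norm ((R / norm x - 1) *\<^sub>R x)"
      by (simp add: dist_norm y_def algebra_simps)
    also have "\<dots> = \<bar>R / norm x - 1\<bar> * norm x" by simp
    also have "\<dots> = R - norm x" using nx x by (simp add: field_simps abs_of_pos)
    also have "\<dots> < d" using x d(1) by auto
    finally have "dist (f y) (f x) < e" using d(2)[of x y] ny x by simp
    then show "\<bar>f x\<bar> < e" using f0[OF ny] by (simp add: dist_real_def)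
  qed (use d R in auto)
qed

text \<open>The gradient of the cutoff is radial, so only \<open>X \<bullet> x\<close> enters. The
  width \<open>3 / (k * R)\<close> comes from
  \<open>R^2 - x \<bullet> x \<ge> R * (R - norm x)\<close>: deeper inside, this exceeds
  \<open>3 / k\<close>, the argument of the cutoff exceeds \<open>2\<close>, and the cutoff is
  constant.\<close>

lemma ball_cutoff'_inner_bound:
  fixes x X :: "'a::real_inner"
  assumes R: "0 < R" and k: "0 < k" and x: "norm x < R"
  shows "\<bar>X \<bullet> ball_cutoff' R k x\<bar> \<le> 2 * k * \<bar>X \<bullet> x\<bar>"
    and "norm x < R - 3 / (k * R) \<Longrightarrow> ball_cutoff' R k x = 0"
proof -
  have "\<bar>X \<bullet> ball_cutoff' R k x\<bar> = 2 * k * \<bar>cutoff' (k * (R\<^sup>2 - x \<bullet> x) - 1)\<bar> * \<bar>X \<bullet> x\<bar>"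
    using k by (simp add: ball_cutoff'_def abs_mult)
  also have "\<dots> \<le> 2 * k * 1 * \<bar>X \<bullet> x\<bar>"
    using k by (intro mult_right_mono mult_left_mono abs_cutoff'_le) auto
  finally show "\<bar>X \<bullet> ball_cutoff' R k x\<bar> \<le> 2 * k * \<bar>X \<bullet> x\<bar>" by simp
  assume "norm x < R - 3 / (k * R)"
  then have "3 / (k * R) * R \<le> (R - norm x) * R"
    using R by (intro mult_right_mono) auto
  also have "\<dots> \<le> (R - norm x) * (R + norm x)"
    using x by (intro mult_left_mono) auto
  also have "\<dots> = R\<^sup>2 - x \<bullet> x"
    by (simp add: dot_square_norm power2_eq_square algebra_simps)
  finally have "3 \<le> k * (R\<^sup>2 - x \<bullet> x)"
    using k R by (simp add: field_simps)
  then show "ball_cutoff' R k x = 0" by (simp add: ball_cutoff'_def cutoff'_0)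
qed

lemma ball_cutoff_tendsto:
  fixes x :: "'a::euclidean_space"
  assumes "x \<in> ball 0 R"
  shows "(\<lambda>n. ball_cutoff R (real (Suc n)) x) \<longlonglongrightarrow> 1"
proof -
  have "x \<bullet> x < R\<^sup>2"
    using assms by (simp add: dot_square_norm power_strict_mono)
  then obtain n0 where n0: "3 < real n0 * (R\<^sup>2 - x \<bullet> x)"
    by (metis diff_gt_0_iff_gt reals_Archimedean3)
  show ?thesis
  proof (rule tendsto_eventually)
    show "\<forall>\<^sub>F n in sequentially. ball_cutoff R (real (Suc n)) x = 1"
      using eventually_ge_at_top[of n0]
    proof eventually_elim
      case (elim n)
      have "real n0 * (R\<^sup>2 - x \<bullet> x) \<le> real (Suc n) * (R\<^sup>2 - x \<bullet> x)"
        using elim \<open>x \<bullet> x < R\<^sup>2\<close> by (intro mult_right_mono) auto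
      then show ?case using n0 unfolding ball_cutoff_def by (intro cutoff_1) linarith
    qed
  qed
qed

text \<open>The gradient of the cutoff has size of order \<open>k\<close> on a layer of volume of
  order \<open>1 / k\<close>, which alone gives only boundedness. Convergence to \<open>0\<close> is
  the effect of the Neumann condition: the integrand sees only \<open>Du x \<bullet> x\<close>,
  which is uniformly small near the sphere.\<close>

lemma boundary_term_tendsto_0:
  fixes Du :: "'a::euclidean_space \<Rightarrow> 'a" and \<psi> :: "'a \<Rightarrow> real"
  assumes R: "0 < R" and Du: "continuous_on (cball 0 R) Du" and Du0: "\<And>x. norm x = R \<Longrightarrow> Du x \<bullet> x = 0"
    and \<psi>: "continuous_on (ball 0 R) \<psi>" and M: "\<And>x. x \<in> ball 0 R \<Longrightarrow> \<bar>\<psi> x\<bar> \<le> M"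
  shows "(\<lambda>n. LINT x|lebesgue_on (ball 0 R). \<psi> x * (Du x \<bullet> ball_cutoff' R (real (Suc n)) x)) \<longlonglongrightarrow> 0"
proof -
  let ?M = "lebesgue_on (ball (0::'a) R)"
  \<comment> \<open>The product of \<open>2 * k * M\<close> and the volume bound for a layer of
    width \<open>3 / (k * R)\<close>; the factors \<open>k\<close> cancel.\<close>
  define K where "K = 6 * M * unit_ball_vol DIM('a) * DIM('a) * R ^ (DIM('a) - 1) / R"
  have M0: "0 \<le> M" using M[of 0] R by auto
  then have K0: "0 \<le> K" using R by (simp add: K_def)
  have Dum: "continuous_on (ball 0 R) Du" using Du by (rule continuous_on_subset) auto
  have main: "\<forall>\<^sub>F n in sequentially. \<bar>LINT x|?M. \<psi> x * (Du x \<bullet> ball_cutoff' R (real (Suc n)) x)\<bar> \<le> e * K"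
    if e: "0 < e" for e
  proof -
    have c: "continuous_on (cball 0 R) (\<lambda>x. Du x \<bullet> x)"
      by (intro continuous_intros Du)
    obtain d where d: "0 < d" "d < R" "\<And>x. R - d \<le> norm x \<Longrightarrow> norm x < R \<Longrightarrow> \<bar>Du x \<bullet> x\<bar> < e"
      using small_near_sphere[OF R c Du0 e] by blast
    obtain n0 where n0: "3 / (R * d) < real n0" using reals_Archimedean2 by blast
    show ?thesis
      using eventually_ge_at_top[of n0]
    proof eventually_elim
      case (elim n)
      define k where "k = real (Suc n)"
      have k: "0 < k" by (simp add: k_def)
      define dk where "dk = 3 / (k * R)"
      have "3 / (R * d) < k" using n0 elim by (simp add: k_def)
      then have dk: "0 < dk" "dk < d" using R k d by (auto simp: dk_def field_simps)
      let ?L = "{x::'a. R - dk \<le> norm x \<and> norm x < R}"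
      have L: "?L = ball 0 R - ball 0 (R - dk)" by auto
      then have Lm: "?L \<in> sets lebesgue" by auto
      have bound: "\<bar>\<psi> x * (Du x \<bullet> ball_cutoff' R k x)\<bar> \<le> 2 * k * M * e * indicator ?L x" if x: "x \<in> ball 0 R" for x
      proof (cases "x \<in> ?L")
        case True
        have "\<bar>\<psi> x * (Du x \<bullet> ball_cutoff' R k x)\<bar> \<le> M * (2 * k * \<bar>Du x \<bullet> x\<bar>)"
          unfolding abs_mult using x M M0 ball_cutoff'_inner_bound(1)[OF R k] by (intro mult_mono) auto
        also have "\<dots> \<le> M * (2 * k * e)"
          using True d(3)[of x] dk k M0 by (intro mult_left_mono) auto
        finally show ?thesis using True by (simp add: algebra_simps)
      next
        case False
        then show ?thesis
          using x ball_cutoff'_inner_bound(2)[OF R k, of x] by (auto simp: dk_def)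
      qed
      have ind: "integrable ?M (\<lambda>x. 2 * k * M * e * indicator ?L x)"
        using Lm by (intro integrable_lebesgue_on_ball_bounded[where C="\<bar>2 * k * M * e\<bar>"]
            measurable_lebesgue_imp_lebesgue_on AE_I2 borel_measurable_times borel_measurable_const
            borel_measurable_indicator) (auto split: split_indicator)
      have "integrable ?M (\<lambda>x. \<psi> x * (Du x \<bullet> ball_cutoff' R k x))"
        by (rule Bochner_Integration.integrable_bound[OF ind])
           (use bound \<psi> Dum k M0 e in \<open>auto intro!: continuous_measurable_lebesgue_on_ball continuous_intros
              continuous_on_ball_cutoff AE_lebesgue_on_ballI2\<close>)
      then have "\<bar>LINT x|?M. \<psi> x * (Du x \<bullet> ball_cutoff' R k x)\<bar> \<le> (LINT x|?M. 2 * k * M * e * indicator ?L x)"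
        by (intro order_trans[OF integral_abs_bound] integral_mono_AE integrable_abs ind AE_lebesgue_on_ballI2 bound)
      also have "\<dots> = 2 * k * M * e * measure lebesgue ?L"
      proof -
        have "(LINT x|?M. indicator ?L x) = measure ?M (?L \<inter> space ?M)"
          by (rule Bochner_Integration.integral_indicator)
        also have "?L \<inter> space ?M = ?L" by auto
        also have "measure ?M ?L = measure lebesgue ?L"
          using L by (subst measure_restrict_space) auto
        finally show ?thesis by simp
      qed
      also have "\<dots> \<le> 2 * k * M * e * (unit_ball_vol DIM('a) * DIM('a) * R ^ (DIM('a) - 1) * dk)"
        using measure_boundary_layer[OF R dk(1)] dk d k M0 e by (intro mult_left_mono) auto
      also have "\<dots> = e * K" using k R by (simp add: K_def dk_def field_simps)
      finally show ?case by (simp add: k_def)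
    qed
  qed
  show ?thesis
  proof (rule LIMSEQ_I)
    fix e :: real assume e: "0 < e"
    have "\<forall>\<^sub>F n in sequentially. \<bar>LINT x|?M. \<psi> x * (Du x \<bullet> ball_cutoff' R (real (Suc n)) x)\<bar> \<le> e / (2 * (K + 1)) * K"
      using e K0 by (intro main) auto
    moreover have "e / (2 * (K + 1)) * K < e"
      using e K0 by (simp add: field_simps add_nonneg_pos)
    ultimately have "\<forall>\<^sub>F n in sequentially. norm ((LINT x|?M. \<psi> x * (Du x \<bullet> ball_cutoff' R (real (Suc n)) x)) - 0) < e"
      by (elim eventually_mono) (simp only: diff_0_right real_norm_def)
    then show "\<exists>n0. \<forall>n\<ge>n0. norm ((LINT x|?M. \<psi> x * (Du x \<bullet> ball_cutoff' R (real (Suc n)) x)) - 0) < e"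
      unfolding eventually_sequentially .
  qed
qed

lemma bounded_on_cball:
  fixes f :: "'a::euclidean_space \<Rightarrow> 'b::real_normed_vector"
  assumes "continuous_on (cball 0 R) f"
  obtains B where "0 \<le> B" "\<And>x. x \<in> ball 0 R \<Longrightarrow> norm (f x) \<le> B"
proof -
  have "bounded (f ` cball 0 R)"
    using assms by (intro compact_imp_bounded compact_continuous_image) auto
  then obtain B where "\<And>x. x \<in> cball 0 R \<Longrightarrow> norm (f x) \<le> B" by (metis bounded_iff imageI)
  then show ?thesis by (intro that[of "max 0 B"]) (auto simp: le_max_iff_disj)
qed

text \<open>Sum of the diagonal identities \<open>i = j\<close> over the basis. Since
  \<open>H\<close> is only in L^r, integrability against the bounded \<open>\<phi>\<close> follows
  from \<open>t \<le> 1 + t powr r\<close> for \<open>t \<ge> 0\<close>.\<close>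

lemma pos_sol_ball_test:
  fixes a u :: "'a::euclidean_space \<Rightarrow> real" and Du :: "'a \<Rightarrow> 'a" and H :: "'a \<Rightarrow> 'a \<Rightarrow> 'a \<Rightarrow> real"
  assumes r: "1 \<le> r"
    and Du: "continuous_on (cball 0 R) Du"
    and Hm: "\<And>i. i \<in> Basis \<Longrightarrow> H i i \<in> borel_measurable lebesgue"
    and Hr: "\<And>i. i \<in> Basis \<Longrightarrow> set_integrable lebesgue (ball 0 R) (\<lambda>x. \<bar>H i i x\<bar> powr r)"
    and weak: "\<And>i \<phi> G. i \<in> Basis \<Longrightarrow> c1c_test (ball 0 R) \<phi> G \<Longrightarrow>
             (LINT x:ball 0 R|lebesgue. (Du x \<bullet> i) * (G x \<bullet> i)) = - (LINT x:ball 0 R|lebesgue. H i i x * \<phi> x)"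
    and eqn: "AE x in lebesgue. x \<in> ball 0 R \<longrightarrow> - (\<Sum>i\<in>Basis. H i i x) = a x * u x powr q"
    and test: "c1c_test (ball 0 R) \<phi> G"
  shows "(LINT x|lebesgue_on (ball 0 R). Du x \<bullet> G x) = (LINT x|lebesgue_on (ball 0 R). a x * u x powr q * \<phi> x)"
proof -
  let ?M = "lebesgue_on (ball (0::'a) R)"
  have Dub: "continuous_on (ball 0 R) Du" using Du by (rule continuous_on_subset) auto
  obtain B where B: "0 \<le> B" "\<And>x. x \<in> ball 0 R \<Longrightarrow> norm (Du x) \<le> B" using bounded_on_cball[OF Du] by blast
  have G: "continuous_on UNIV G" and \<phi>: "continuous_on UNIV \<phi>"
    using test unfolding c1c_test_def
    by (auto intro!: continuous_at_imp_continuous_on has_derivative_continuous)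
  obtain B' where B': "0 \<le> B'" "\<And>x. x \<in> ball 0 R \<Longrightarrow> norm (G x) \<le> B'"
    using bounded_on_cball continuous_on_subset[OF G subset_UNIV] by metis
  obtain B'' where B'': "0 \<le> B''" "\<And>x. x \<in> ball 0 R \<Longrightarrow> norm (\<phi> x) \<le> B''"
    using bounded_on_cball continuous_on_subset[OF \<phi> subset_UNIV] by metis
  have int1: "integrable ?M (\<lambda>x. (Du x \<bullet> i) * (G x \<bullet> i))" if i: "i \<in> Basis" for i
  proof (rule integrable_lebesgue_on_ball_bounded[where C="B * B'"])
    show "(\<lambda>x. (Du x \<bullet> i) * (G x \<bullet> i)) \<in> borel_measurable ?M"
      by (intro continuous_measurable_lebesgue_on_ball continuous_intros Dub continuous_on_subset[OF G subset_UNIV])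
    show "AE x in ?M. \<bar>(Du x \<bullet> i) * (G x \<bullet> i)\<bar> \<le> B * B'"
    proof (rule AE_lebesgue_on_ballI2)
      fix x :: 'a assume x: "x \<in> ball 0 R"
      have "\<bar>Du x \<bullet> i\<bar> \<le> B" "\<bar>G x \<bullet> i\<bar> \<le> B'"
        using Basis_le_norm[OF i, of "Du x"] Basis_le_norm[OF i, of "G x"] B(2)[OF x] B'(2)[OF x] by auto
      then show "\<bar>(Du x \<bullet> i) * (G x \<bullet> i)\<bar> \<le> B * B'"
        unfolding abs_mult using B B' by (intro mult_mono) auto
    qed
  qed
  have int2: "integrable ?M (\<lambda>x. H i i x * \<phi> x)" if i: "i \<in> Basis" for i
  proof (rule Bochner_Integration.integrable_bound)
    have "integrable ?M (\<lambda>x. \<bar>H i i x\<bar> powr r)"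
      using Hr[OF i] unfolding set_integrable_def by (subst integrable_restrict_space) auto
    then show "integrable ?M (\<lambda>x. B'' * (1 + \<bar>H i i x\<bar> powr r))"
      using finite_measure.integrable_const[OF finite_measure_lebesgue_on_ball, of 0 R "1::real"] by auto
    show "(\<lambda>x. H i i x * \<phi> x) \<in> borel_measurable ?M"
      by (intro borel_measurable_times measurable_lebesgue_imp_lebesgue_on Hm i continuous_measurable_lebesgue_on_ball
          continuous_on_subset[OF \<phi> subset_UNIV])
    show "AE x in ?M. norm (H i i x * \<phi> x) \<le> norm (B'' * (1 + \<bar>H i i x\<bar> powr r))"
    proof (rule AE_lebesgue_on_ballI2)
      fix x :: 'a assume x: "x \<in> ball 0 R"
      have "\<bar>H i i x\<bar> \<le> 1 + \<bar>H i i x\<bar> powr r"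
      proof (cases "\<bar>H i i x\<bar> \<le> 1")
        case False
        then have "\<bar>H i i x\<bar> powr 1 \<le> \<bar>H i i x\<bar> powr r" using r by (intro powr_mono) auto
        then show ?thesis using False by simp
      qed (use powr_ge_zero[of "\<bar>H i i x\<bar>" r] in linarith)
      then have "\<bar>H i i x\<bar> * \<bar>\<phi> x\<bar> \<le> (1 + \<bar>H i i x\<bar> powr r) * B''"
        using B''(2)[OF x] by (intro mult_mono) auto
      then show "norm (H i i x * \<phi> x) \<le> norm (B'' * (1 + \<bar>H i i x\<bar> powr r))"
        using B''(1) by (simp add: abs_mult mult.commute)
    qed
  qed
  have "(LINT x|?M. Du x \<bullet> G x) = (LINT x|?M. (\<Sum>i\<in>Basis. (Du x \<bullet> i) * (G x \<bullet> i)))"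
    by (intro Bochner_Integration.integral_cong refl euclidean_inner)
  also have "\<dots> = (\<Sum>i\<in>Basis. (LINT x|?M. (Du x \<bullet> i) * (G x \<bullet> i)))"
    by (intro Bochner_Integration.integral_sum int1)
  also have "\<dots> = (\<Sum>i\<in>Basis. - (LINT x|?M. H i i x * \<phi> x))"
    using weak[OF _ test] by (intro sum.cong) (auto simp: set_lebesgue_integral_lebesgue_on)
  also have "\<dots> = - (LINT x|?M. (\<Sum>i\<in>Basis. H i i x * \<phi> x))"
    by (subst Bochner_Integration.integral_sum) (auto intro: int2 simp: sum_negf)
  also have "\<dots> = (LINT x|?M. - (\<Sum>i\<in>Basis. H i i x * \<phi> x))" by simp
  also have "\<dots> = (LINT x|?M. - (\<Sum>i\<in>Basis. H i i x) * \<phi> x)" by (simp add: sum_distrib_right)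
  also have "\<dots> = (LINT x|?M. a x * u x powr q * \<phi> x)"
  proof -
    have m: "(\<lambda>x. - (\<Sum>i\<in>Basis. H i i x) * \<phi> x) \<in> borel_measurable ?M"
      by (intro borel_measurable_times borel_measurable_uminus borel_measurable_sum measurable_lebesgue_imp_lebesgue_on Hm
          continuous_measurable_lebesgue_on_ball continuous_on_subset[OF \<phi> subset_UNIV])
    have ae: "AE x in ?M. - (\<Sum>i\<in>Basis. H i i x) * \<phi> x = a x * u x powr q * \<phi> x"
      using AE_lebesgue_on_ballI[OF eqn] by eventually_elim simp
    show ?thesis
    proof (rule integral_cong_AE[OF m _ ae])
      \<comment> \<open>Measurability of the right-hand side is inherited from the trace of
        \<open>H\<close> through the equation.\<close>
      have "(\<lambda>x. if x \<in> ball 0 R then - (\<Sum>i\<in>Basis. H i i x) else 0) \<in> borel_measurable lebesgue"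
        by (intro measurable_If borel_measurable_uminus borel_measurable_sum Hm) auto
      then have "(\<lambda>x. if x \<in> ball 0 R then a x * u x powr q else 0) \<in> borel_measurable lebesgue"
        by (rule borel_measurable_AE) (use eqn in \<open>eventually_elim, simp\<close>)
      then have "(\<lambda>x. (if x \<in> ball 0 R then a x * u x powr q else 0) * \<phi> x) \<in> borel_measurable ?M"
        by (intro borel_measurable_times measurable_lebesgue_imp_lebesgue_on
            continuous_measurable_lebesgue_on_ball continuous_on_subset[OF \<phi> subset_UNIV])
      then show "(\<lambda>x. a x * u x powr q * \<phi> x) \<in> borel_measurable ?M"
        by (subst measurable_cong[where g="\<lambda>x. (if x \<in> ball 0 R then a x * u x powr q else 0) * \<phi> x"]) auto
    qed
  qed
  finally show ?thesis .
qed

text \<open>The test functions are C^1 up to the closed ball and unrestricted on the sphere, so the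
  Neumann condition is encoded in the identity, and second derivatives no longer appear.\<close>

definition weak_pos_sol :: "real \<Rightarrow> ('a::euclidean_space \<Rightarrow> real) \<Rightarrow> real \<Rightarrow> ('a \<Rightarrow> real) \<Rightarrow> ('a \<Rightarrow> 'a) \<Rightarrow> bool" where
  "weak_pos_sol R a q u Du \<longleftrightarrow>
     continuous_on (cball 0 R) Du \<and>
     (\<forall>x\<in>cball 0 R. (u has_derivative (\<lambda>h. Du x \<bullet> h)) (at x within cball 0 R)) \<and>
     (\<forall>x\<in>ball 0 R. 0 < u x) \<and>
     (\<forall>\<psi> G. (\<forall>x\<in>ball 0 R. (\<psi> has_derivative (\<lambda>h. G x \<bullet> h)) (at x)) \<longrightarrow>
        continuous_on (cball 0 R) \<psi> \<longrightarrow> continuous_on (cball 0 R) G \<longrightarrow>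
        (LINT x|lebesgue_on (ball 0 R). Du x \<bullet> G x) = (LINT x|lebesgue_on (ball 0 R). a x * u x powr q * \<psi> x))"

lemma weak_pos_solD:
  assumes "weak_pos_sol R a q u Du"
  shows "continuous_on (cball 0 R) Du"
    and "x \<in> cball 0 R \<Longrightarrow> (u has_derivative (\<lambda>h. Du x \<bullet> h)) (at x within cball 0 R)"
    and "x \<in> ball 0 R \<Longrightarrow> 0 < u x"
    and "(\<And>x. x \<in> ball 0 R \<Longrightarrow> (\<psi> has_derivative (\<lambda>h. G x \<bullet> h)) (at x)) \<Longrightarrow>
        continuous_on (cball 0 R) \<psi> \<Longrightarrow> continuous_on (cball 0 R) G \<Longrightarrow>
        (LINT x|lebesgue_on (ball 0 R). Du x \<bullet> G x) = (LINT x|lebesgue_on (ball 0 R). a x * u x powr q * \<psi> x)"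
    and "x \<in> ball 0 R \<Longrightarrow> (u has_derivative (\<lambda>h. Du x \<bullet> h)) (at x)"
    and "continuous_on (cball 0 R) u"
proof -
  note w = assms[unfolded weak_pos_sol_def]
  show "continuous_on (cball 0 R) Du" using w by blast
  show d: "(u has_derivative (\<lambda>h. Du x \<bullet> h)) (at x within cball 0 R)" if "x \<in> cball 0 R" for x using w that by blast
  show "0 < u x" if "x \<in> ball 0 R" using w that by blast
  show "(LINT x|lebesgue_on (ball 0 R). Du x \<bullet> G x) = (LINT x|lebesgue_on (ball 0 R). a x * u x powr q * \<psi> x)"
    if "\<And>x. x \<in> ball 0 R \<Longrightarrow> (\<psi> has_derivative (\<lambda>h. G x \<bullet> h)) (at x)"
      "continuous_on (cball 0 R) \<psi>" "continuous_on (cball 0 R) G"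
    using w that by blast
  show "(u has_derivative (\<lambda>h. Du x \<bullet> h)) (at x)" if "x \<in> ball 0 R"
    using that d[of x] at_within_interior[of x "cball 0 R"] by auto
  show "continuous_on (cball 0 R) u"
    using has_derivative_continuous[OF d] by (auto simp: continuous_on_eq_continuous_within)
qed

text \<open>Testing with the cutoff times \<open>\<psi>\<close> produces one extra term, carrying
  the gradient of the cutoff, which tends to \<open>0\<close>; the other two integrals converge by
  dominated convergence.\<close>

lemma pos_sol_ball_weak:
  fixes a u :: "'a::euclidean_space \<Rightarrow> real"
  assumes R: "0 < R" and q: "0 < q"
    and a_meas: "a \<in> borel_measurable lebesgue"
    and a_bdd: "\<exists>C. AE x in lebesgue. x \<in> ball 0 R \<longrightarrow> \<bar>a x\<bar> \<le> C"
    and sol: "pos_sol_ball R a q u"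
  shows "\<exists>Du. weak_pos_sol R a q u Du"
proof -
  let ?M = "lebesgue_on (ball (0::'a) R)"
  obtain r Du H where *: "real DIM('a) < r" "continuous_on (cball 0 R) Du"
       "\<forall>x\<in>cball 0 R. (u has_derivative (\<lambda>h. Du x \<bullet> h)) (at x within cball 0 R)"
       "\<forall>i\<in>Basis. \<forall>j\<in>Basis.
          H i j \<in> borel_measurable lebesgue \<and>
          set_integrable lebesgue (ball 0 R) (\<lambda>x. \<bar>H i j x\<bar> powr r) \<and>
          (\<forall>\<phi> G. c1c_test (ball 0 R) \<phi> G \<longrightarrow>
             (LINT x:ball 0 R|lebesgue. (Du x \<bullet> j) * (G x \<bullet> i))
               = - (LINT x:ball 0 R|lebesgue. H i j x * \<phi> x))"
       "\<forall>x\<in>ball 0 R. u x > 0"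
       "AE x in lebesgue. x \<in> ball 0 R \<longrightarrow> - (\<Sum>i\<in>Basis. H i i x) = a x * u x powr q"
       "\<forall>x. norm x = R \<longrightarrow> Du x \<bullet> x = 0"
    using sol unfolding pos_sol_ball_def by blast
  note Du = *(2)
  have Dub: "continuous_on (ball 0 R) Du" using Du by (rule continuous_on_subset) auto
  obtain B where B: "0 \<le> B" "\<And>x. x \<in> ball 0 R \<Longrightarrow> norm (Du x) \<le> B" using bounded_on_cball[OF Du] by blast
  have uc: "continuous_on (cball 0 R) u"
    using *(3) by (auto simp: continuous_on_eq_continuous_within intro: has_derivative_continuous)
  obtain B1 where B1: "0 \<le> B1" "\<And>x. x \<in> ball 0 R \<Longrightarrow> norm (u x) \<le> B1" using bounded_on_cball[OF uc] by blast
  obtain C where "AE x in lebesgue. x \<in> ball 0 R \<longrightarrow> \<bar>a x\<bar> \<le> C" using a_bdd ..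
  then have C: "AE x in ?M. \<bar>a x\<bar> \<le> C" by (rule AE_lebesgue_on_ballI)
  have r1: "1 \<le> r" using *(1) DIM_positive[where 'a='a] by linarith
  have c1: "(LINT x|?M. Du x \<bullet> G x) = (LINT x|?M. a x * u x powr q * \<phi> x)" if "c1c_test (ball 0 R) \<phi> G" for \<phi> G
  proof (rule pos_sol_ball_test[where H = H and a = a and u = u, OF r1 Du _ _ _ *(6) that])
    fix i :: 'a and \<phi> :: "'a \<Rightarrow> real" and G :: "'a \<Rightarrow> 'a" assume i: "i \<in> Basis"
    note h = bspec[OF bspec[OF *(4) i] i]
    show "H i i \<in> borel_measurable lebesgue" using h by (rule conjunct1)
    show "set_integrable lebesgue (ball 0 R) (\<lambda>x. \<bar>H i i x\<bar> powr r)"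
      using h[THEN conjunct2] by (rule conjunct1)
    assume "c1c_test (ball 0 R) \<phi> G"
    then show "(LINT x:ball 0 R|lebesgue. (Du x \<bullet> i) * (G x \<bullet> i)) = - (LINT x:ball 0 R|lebesgue. H i i x * \<phi> x)"
      using h[THEN conjunct2, THEN conjunct2] by blast
  qed
  have "(LINT x|?M. Du x \<bullet> G x) = (LINT x|?M. a x * u x powr q * \<psi> x)"
    if d\<psi>: "\<forall>x\<in>ball 0 R. (\<psi> has_derivative (\<lambda>h. G x \<bullet> h)) (at x)"
      and \<psi>: "continuous_on (cball 0 R) \<psi>" and G: "continuous_on (cball 0 R) G"
    for \<psi> :: "'a \<Rightarrow> real" and G :: "'a \<Rightarrow> 'a"
  proof -
    obtain M1 where M1: "0 \<le> M1" "\<And>x. x \<in> ball 0 R \<Longrightarrow> norm (\<psi> x) \<le> M1" using bounded_on_cball[OF \<psi>] by blast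
    obtain M2 where M2: "0 \<le> M2" "\<And>x. x \<in> ball 0 R \<Longrightarrow> norm (G x) \<le> M2" using bounded_on_cball[OF G] by blast
    have \<psi>b: "continuous_on (ball 0 R) \<psi>" and Gb: "continuous_on (ball 0 R) G"
      and ub: "continuous_on (ball 0 R) u"
      using \<psi> G uc by (auto elim!: continuous_on_subset)
    let ?z = "\<lambda>n. ball_cutoff R (real (Suc n)) :: 'a \<Rightarrow> real"
    let ?z' = "\<lambda>n. ball_cutoff' R (real (Suc n)) :: 'a \<Rightarrow> 'a"
    have zle: "\<bar>?z n x\<bar> \<le> 1" for n x using cutoff_bounds by (auto simp: ball_cutoff_def abs_le_iff order_trans[OF _ cutoff_bounds(1)])
    have zDG: "\<bar>?z n x * (Du x \<bullet> G x)\<bar> \<le> B * M2" if x: "x \<in> ball 0 R" for n x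
    proof -
      have "\<bar>?z n x\<bar> * \<bar>Du x \<bullet> G x\<bar> \<le> 1 * (norm (Du x) * norm (G x))"
        by (intro mult_mono zle Cauchy_Schwarz_ineq2) auto
      also have "\<dots> \<le> 1 * (B * M2)"
        using B(2)[OF x] M2(2)[OF x] B M2 by (intro mult_left_mono mult_mono) auto
      finally show ?thesis by (simp add: abs_mult)
    qed
    have A: "(\<lambda>n. LINT x|?M. ?z n x * (Du x \<bullet> G x)) \<longlonglongrightarrow> (LINT x|?M. 1 * (Du x \<bullet> G x))"
    proof (rule integral_dominated_convergence[where w="\<lambda>_. B * M2"])
      show "integrable ?M (\<lambda>_. B * M2)"
        by (rule finite_measure.integrable_const[OF finite_measure_lebesgue_on_ball])
      show "AE x in ?M. (\<lambda>n. ?z n x * (Du x \<bullet> G x)) \<longlonglongrightarrow> 1 * (Du x \<bullet> G x)"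
        by (intro AE_lebesgue_on_ballI2 tendsto_mult ball_cutoff_tendsto tendsto_const)
      show "AE x in ?M. norm (?z n x * (Du x \<bullet> G x)) \<le> B * M2" for n
        unfolding real_norm_def by (intro AE_lebesgue_on_ballI2 zDG)
    qed (intro continuous_measurable_lebesgue_on_ball continuous_intros Dub Gb continuous_on_ball_cutoff)+
    have Bt: "(\<lambda>n. LINT x|?M. \<psi> x * (Du x \<bullet> ?z' n x)) \<longlonglongrightarrow> 0"
      using M1 *(7) by (intro boundary_term_tendsto_0[OF R Du _ \<psi>b]) auto
    have "continuous_on (ball 0 R) (\<lambda>x. u x powr q)"
      using *(5) by (intro continuous_intros ub) force
    then have meas_auq: "(\<lambda>x. a x * u x powr q) \<in> borel_measurable ?M"
      by (intro borel_measurable_times measurable_lebesgue_imp_lebesgue_on[OF a_meas]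
          continuous_measurable_lebesgue_on_ball)
    have Ct: "(\<lambda>n. LINT x|?M. a x * u x powr q * (?z n x * \<psi> x)) \<longlonglongrightarrow> (LINT x|?M. a x * u x powr q * (1 * \<psi> x))"
    proof (rule integral_dominated_convergence[where w="\<lambda>_. C * B1 powr q * M1"])
      show "integrable ?M (\<lambda>_. C * B1 powr q * M1)"
        by (rule finite_measure.integrable_const[OF finite_measure_lebesgue_on_ball])
      show "AE x in ?M. (\<lambda>n. a x * u x powr q * (?z n x * \<psi> x)) \<longlonglongrightarrow> a x * u x powr q * (1 * \<psi> x)"
        by (intro AE_lebesgue_on_ballI2 tendsto_mult ball_cutoff_tendsto tendsto_const)
      show "AE x in ?M. norm (a x * u x powr q * (?z n x * \<psi> x)) \<le> C * B1 powr q * M1" for n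
        using C AE_space[of ?M]
      proof eventually_elim
        case (elim x)
        have u: "0 < u x" "u x \<le> B1" using *(5) B1(2)[of x] elim by auto
        have "\<bar>a x\<bar> * u x powr q * (\<bar>?z n x\<bar> * \<bar>\<psi> x\<bar>) \<le> C * B1 powr q * (1 * M1)"
          using elim u q M1 B1 zle[of n x] by (intro mult_mono powr_mono2) auto
        then show ?case by (simp add: abs_mult)
      qed
    qed (intro borel_measurable_times meas_auq continuous_measurable_lebesgue_on_ball continuous_intros \<psi>b continuous_on_ball_cutoff)+
    have split: "(LINT x|?M. ?z n x * (Du x \<bullet> G x)) + (LINT x|?M. \<psi> x * (Du x \<bullet> ?z' n x))
          = (LINT x|?M. a x * u x powr q * (?z n x * \<psi> x))" for n
    proof -
      have i1: "integrable ?M (\<lambda>x. ?z n x * (Du x \<bullet> G x))"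
      proof (rule integrable_lebesgue_on_ball_bounded[where C="B * M2"])
        show "(\<lambda>x. ?z n x * (Du x \<bullet> G x)) \<in> borel_measurable ?M"
          by (intro continuous_measurable_lebesgue_on_ball continuous_intros Dub Gb continuous_on_ball_cutoff)
        show "AE x in ?M. \<bar>?z n x * (Du x \<bullet> G x)\<bar> \<le> B * M2" by (intro AE_lebesgue_on_ballI2 zDG)
      qed
      have "continuous_on (cball 0 R) (\<lambda>x. \<psi> x * (Du x \<bullet> ?z' n x))"
        by (intro continuous_intros Du \<psi> continuous_on_ball_cutoff)
      from bounded_on_cball[OF this] obtain B3 where "\<And>x. x \<in> ball 0 R \<Longrightarrow> norm (\<psi> x * (Du x \<bullet> ?z' n x)) \<le> B3"
        by blast
      then have i2: "integrable ?M (\<lambda>x. \<psi> x * (Du x \<bullet> ?z' n x))"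
        by (intro integrable_lebesgue_on_ball_bounded[where C=B3] AE_lebesgue_on_ballI2)
           (auto intro!: continuous_measurable_lebesgue_on_ball continuous_intros Dub \<psi>b continuous_on_ball_cutoff)
      have "(LINT x|?M. ?z n x * (Du x \<bullet> G x)) + (LINT x|?M. \<psi> x * (Du x \<bullet> ?z' n x))
          = (LINT x|?M. ?z n x * (Du x \<bullet> G x) + \<psi> x * (Du x \<bullet> ?z' n x))"
        using i1 i2 by simp
      also have "\<dots> = (LINT x|?M. Du x \<bullet> (if x \<in> ball 0 R then ?z n x *\<^sub>R G x + \<psi> x *\<^sub>R ?z' n x else 0))"
        by (rule Bochner_Integration.integral_cong) (auto simp: inner_add_right)
      also have "\<dots> = (LINT x|?M. a x * u x powr q * (if x \<in> ball 0 R then ?z n x * \<psi> x else 0))"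
        using d\<psi> Gb by (intro c1 ball_cutoff_test R) auto
      also have "\<dots> = (LINT x|?M. a x * u x powr q * (?z n x * \<psi> x))"
        by (rule Bochner_Integration.integral_cong) auto
      finally show ?thesis .
    qed
    have "(\<lambda>n. LINT x|?M. a x * u x powr q * (?z n x * \<psi> x)) \<longlonglongrightarrow> (LINT x|?M. 1 * (Du x \<bullet> G x)) + 0"
      using tendsto_add[OF A Bt] unfolding split .
    then show ?thesis using LIMSEQ_unique[OF Ct] by simp
  qed
  with * have "weak_pos_sol R a q u Du" unfolding weak_pos_sol_def by blast
  then show ?thesis by blast
qed

section \<open>Picone test functions and uniqueness\<close>

lemma powr_has_derivative:
  fixes f :: "'a::real_inner \<Rightarrow> real"
  assumes f: "(f has_derivative (\<lambda>h. F \<bullet> h)) (at x)" and pos: "0 < f x"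
  shows "((\<lambda>x. f x powr p) has_derivative (\<lambda>h. (p * f x powr (p - 1)) *\<^sub>R F \<bullet> h)) (at x)"
  using has_derivative_compose[OF f has_real_derivative_powr[OF pos, of p, unfolded has_field_derivative_def]]
  by simp

definition picone_test :: "real \<Rightarrow> real \<Rightarrow> real \<Rightarrow> real" where
  "picone_test q u v = u - v powr (1 + q) * u powr (- q)"

definition picone_test_grad :: "real \<Rightarrow> real \<Rightarrow> real \<Rightarrow> 'a::real_vector \<Rightarrow> 'a \<Rightarrow> 'a" where
  "picone_test_grad q u v X Y =
     (1 + q * v powr (1 + q) * u powr (- q - 1)) *\<^sub>R X - ((1 + q) * v powr q * u powr (- q)) *\<^sub>R Y"

lemma picone_test_has_derivative:
  fixes f g :: "'a::real_inner \<Rightarrow> real"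
  assumes f: "(f has_derivative (\<lambda>h. F \<bullet> h)) (at x)" "0 < f x"
    and g: "(g has_derivative (\<lambda>h. G \<bullet> h)) (at x)" "0 < g x"
  shows "((\<lambda>x. picone_test q (f x) (g x)) has_derivative (\<lambda>h. picone_test_grad q (f x) (g x) F G \<bullet> h)) (at x)"
proof -
  have "((\<lambda>x. picone_test q (f x) (g x)) has_derivative
      (\<lambda>h. F \<bullet> h - (g x powr (1 + q) * ((- q * f x powr (- q - 1)) *\<^sub>R F \<bullet> h)
          + (((1 + q) * g x powr (1 + q - 1)) *\<^sub>R G \<bullet> h) * f x powr (- q)))) (at x)"
    unfolding picone_test_def
    by (intro has_derivative_diff has_derivative_mult f g powr_has_derivative)
  also have "(\<lambda>h. F \<bullet> h - (g x powr (1 + q) * ((- q * f x powr (- q - 1)) *\<^sub>R F \<bullet> h)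
          + (((1 + q) * g x powr (1 + q - 1)) *\<^sub>R G \<bullet> h) * f x powr (- q)))
      = (\<lambda>h. picone_test_grad q (f x) (g x) F G \<bullet> h)"
    by (rule ext) (simp add: picone_test_grad_def inner_diff_left inner_add_left distrib_left distrib_right mult.assoc mult.commute mult.left_commute)
  finally show ?thesis .
qed

lemma picone_test_identity:
  fixes X Y :: "'a::real_inner"
  assumes "0 < u" "0 < v"
  shows "X \<bullet> picone_test_grad q u v X Y + Y \<bullet> picone_test_grad q v u Y X = picone q X Y (v / u)"
proof -
  have p: "(v / u) powr c = v powr c * u powr (- c)" for c
    using assms by (simp add: powr_divide powr_minus_divide)
  have "(v / u) powr (- 1 - q) = u powr (1 + q) * v powr (- q - 1)"
    by (subst p, subst mult.commute, intro arg_cong2[where f="(*)"] arg_cong2[where f="(powr)"] refl) simp_all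
  moreover have "(v / u) powr (1 + q) = v powr (1 + q) * u powr (- q - 1)"
    by (subst p, intro arg_cong2[where f="(*)"] arg_cong2[where f="(powr)"] refl) simp_all
  moreover have "(v / u) powr q = v powr q * u powr (- q)" "(v / u) powr (- q) = u powr q * v powr (- q)"
    by (subst p, simp)+
  ultimately show ?thesis
    unfolding picone_def picone_test_grad_def
    by (simp add: inner_add_right inner_diff_right inner_commute algebra_simps)
qed

lemma picone_test_times_powr:
  assumes "0 < u"
  shows "u powr q * picone_test q u v = u powr (1 + q) - v powr (1 + q)"
proof -
  have "u powr q * u powr (- q) = 1" using assms by (simp add: powr_add[symmetric])
  moreover have "u powr q * u = u powr (1 + q)" using assms by (simp add: powr_add)
  ultimately show ?thesis unfolding picone_test_def by (simp add: algebra_simps)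
qed

text \<open>The bound must be uniform in the shift: for \<open>U = u + \<epsilon>\<close> near
  \<open>0\<close> the test function is singular like \<open>U powr (- q)\<close>, but the weight
  satisfies \<open>u powr q \<le> U powr q\<close> and absorbs this.\<close>

lemma picone_test_bound:
  assumes q: "0 < q" and u: "0 < u" "u \<le> U" "U \<le> B" and v: "0 < v" "v \<le> B"
  shows "\<bar>u powr q * picone_test q U v\<bar> \<le> 2 * B powr (1 + q)"
proof -
  have U: "0 < U" "0 < B" using u by auto
  have "\<bar>u powr q * picone_test q U v\<bar> = u powr q * \<bar>picone_test q U v\<bar>"
    by (simp add: abs_mult)
  also have "\<dots> \<le> U powr q * \<bar>picone_test q U v\<bar>"
    using u q by (intro mult_right_mono powr_mono2) auto
  also have "\<dots> = \<bar>U powr q * picone_test q U v\<bar>" by (simp add: abs_mult)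
  also have "\<dots> = \<bar>U powr (1 + q) - v powr (1 + q)\<bar>"
    by (simp only: picone_test_times_powr[OF U(1)])
  also have "\<dots> \<le> U powr (1 + q) + v powr (1 + q)"
    using powr_ge_zero[of U "1 + q"] powr_ge_zero[of v "1 + q"] by (simp add: abs_le_iff)
  also have "\<dots> \<le> B powr (1 + q) + B powr (1 + q)"
    using u v U q by (intro add_mono powr_mono2) auto
  finally show ?thesis by simp
qed

lemma picone_test_tendsto:
  assumes "0 < u" "0 < v"
  shows "(\<lambda>n. u powr q * picone_test q (u + inverse (real (Suc n))) (v + inverse (real (Suc n))))
     \<longlonglongrightarrow> u powr (1 + q) - v powr (1 + q)"
proof -
  have "(\<lambda>n. u powr q * picone_test q (u + inverse (real (Suc n))) (v + inverse (real (Suc n))))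
     \<longlonglongrightarrow> u powr q * picone_test q (u + 0) (v + 0)"
    unfolding picone_test_def using assms
    by (intro tendsto_intros LIMSEQ_inverse_real_of_nat) auto
  then show ?thesis using picone_test_times_powr[OF assms(1)] by simp
qed

lemma picone_tendsto:
  assumes "(s \<longlongrightarrow> t) F" "0 < t"
  shows "((\<lambda>n. picone q X Y (s n)) \<longlongrightarrow> picone q X Y t) F"
  unfolding picone_def using assms by (intro tendsto_intros) auto

lemma AE_zero_continuous_on_ball:
  fixes f :: "'a::euclidean_space \<Rightarrow> real"
  assumes f: "continuous_on (ball c r) f" and ae: "AE x in lebesgue_on (ball c r). f x = 0" and x: "x \<in> ball c r"
  shows "f x = 0"
proof (rule ccontr)
  assume "f x \<noteq> 0"
  let ?T = "ball c r \<inter> f -` (- {0})"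
  have T: "open ?T" using f by (intro continuous_open_preimage) auto
  have "AE x in lebesgue. x \<in> ball c r \<longrightarrow> f x = 0"
    using ae by (subst (asm) AE_restrict_space_iff) auto
  then have "AE x in lebesgue. x \<notin> ?T" by eventually_elim auto
  then have "?T \<in> null_sets lebesgue"
    using T by (subst (asm) AE_iff_null_sets[symmetric]) auto
  then have "negligible ?T" by (simp add: negligible_iff_null_sets)
  moreover have "?T \<noteq> {}" using x \<open>f x \<noteq> 0\<close> by auto
  ultimately show False using T open_not_negligible by blast
qed

text \<open>Shifting \<open>u\<close> and \<open>v\<close> by a constant leaves the gradients
  unchanged and makes the test functions admissible on the closed ball, but the weights remain
  \<open>u powr q\<close> and \<open>v powr q\<close>, so the right-hand sides cancel only in the
  limit. The integral of the nonnegative limit form is thus \<open>0\<close>, and continuity turns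
  vanishing almost everywhere into vanishing at every point.\<close>

lemma pos_sol_ball_picone_zero:
  fixes a u v :: "'a::euclidean_space \<Rightarrow> real" and Du Dv :: "'a \<Rightarrow> 'a"
  assumes R: "0 < R" and q: "0 < q" "q < 1"
    and a_meas: "a \<in> borel_measurable lebesgue"
    and a_bdd: "\<exists>C. AE x in lebesgue. x \<in> ball 0 R \<longrightarrow> \<bar>a x\<bar> \<le> C"
    and u: "weak_pos_sol R a q u Du" and v: "weak_pos_sol R a q v Dv"
    and x: "x \<in> ball 0 R"
  shows "picone q (Du x) (Dv x) (v x / u x) = 0"
proof -
  note Du = weak_pos_solD[OF u] and Dv = weak_pos_solD[OF v]
  let ?M = "lebesgue_on (ball (0::'a) R)"
  define e where "e n = inverse (real (Suc n))" for n
  have e: "0 < e n" "e n \<le> 1" "e \<longlonglongrightarrow> 0" for n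
    unfolding e_def using LIMSEQ_inverse_real_of_nat by (auto simp: field_simps)
  note cont = Du(6) Dv(6)
  have contb: "continuous_on (ball 0 R) u" "continuous_on (ball 0 R) v"
     "continuous_on (ball 0 R) Du" "continuous_on (ball 0 R) Dv"
    using cont Du(1) Dv(1) by (auto elim!: continuous_on_subset)
  have cl: "closure (ball (0::'a) R) = cball 0 R" using R by simp
  have nonneg: "0 \<le> u x" "0 \<le> v x" if "x \<in> cball 0 R" for x
  proof -
    show "0 \<le> u x"
      by (rule continuous_ge_on_closure[of "ball 0 R"]) (use that cl cont less_imp_le[OF Du(3)] in simp_all)
    show "0 \<le> v x"
      by (rule continuous_ge_on_closure[of "ball 0 R"]) (use that cl cont less_imp_le[OF Dv(3)] in simp_all)
  qed
  obtain B1 B2 where B1: "0 \<le> B1" "\<And>x. x \<in> ball 0 R \<Longrightarrow> norm (u x) \<le> B1"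
    and B2: "0 \<le> B2" "\<And>x. x \<in> ball 0 R \<Longrightarrow> norm (v x) \<le> B2"
    using bounded_on_cball[OF cont(1)] bounded_on_cball[OF cont(2)] by metis
  define B where "B = max B1 B2 + 1"
  have B: "u x + e n \<le> B" "v x + e n \<le> B" if "x \<in> ball 0 R" for x n
    using B1(2)[OF that] B2(2)[OF that] e(2)[of n] by (auto simp: B_def)
  have meas_a: "a \<in> borel_measurable ?M" by (intro measurable_lebesgue_imp_lebesgue_on a_meas)
  obtain C where "AE x in lebesgue. x \<in> ball 0 R \<longrightarrow> \<bar>a x\<bar> \<le> C" using a_bdd ..
  then have C: "AE x in ?M. \<bar>a x\<bar> \<le> C" by (rule AE_lebesgue_on_ballI)
  let ?p1 = "\<lambda>n x. picone_test q (u x + e n) (v x + e n)" and ?p2 = "\<lambda>n x. picone_test q (v x + e n) (u x + e n)"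
  let ?g1 = "\<lambda>n x. picone_test_grad q (u x + e n) (v x + e n) (Du x) (Dv x)"
  let ?g2 = "\<lambda>n x. picone_test_grad q (v x + e n) (u x + e n) (Dv x) (Du x)"
  let ?P = "\<lambda>n x. picone q (Du x) (Dv x) ((v x + e n) / (u x + e n))"
  have pos: "0 < u x + e n" "0 < v x + e n" if "x \<in> cball 0 R" for x n
    using nonneg[OF that] e(1)[of n] by linarith+
  have nz: "u x + e n \<noteq> 0" "v x + e n \<noteq> 0" if "x \<in> cball 0 R" for x n
    using pos[OF that, of n] by simp_all
  have cp: "continuous_on (cball 0 R) (?p1 n)" "continuous_on (cball 0 R) (?p2 n)" for n
    unfolding picone_test_def using nz by (auto intro!: continuous_intros cont)
  have cg: "continuous_on (cball 0 R) (?g1 n)" "continuous_on (cball 0 R) (?g2 n)" for n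
    unfolding picone_test_grad_def using nz by (auto intro!: continuous_intros cont Du(1) Dv(1))
  have dp: "(?p1 n has_derivative (\<lambda>h. ?g1 n x \<bullet> h)) (at x)" "(?p2 n has_derivative (\<lambda>h. ?g2 n x \<bullet> h)) (at x)"
    if "x \<in> ball 0 R" for x n
    using Du(5)[OF that] Dv(5)[OF that] pos[of x n] that
    by (auto intro!: picone_test_has_derivative has_derivative_add_const)
  have eq1: "(LINT x|?M. Du x \<bullet> ?g1 n x) = (LINT x|?M. a x * u x powr q * ?p1 n x)" for n
    by (rule Du(4)[OF dp(1) cp(1) cg(1)])
  have eq2: "(LINT x|?M. Dv x \<bullet> ?g2 n x) = (LINT x|?M. a x * v x powr q * ?p2 n x)" for n
    by (rule Dv(4)[OF dp(2) cp(2) cg(2)])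
  have intc: "integrable ?M f" if "continuous_on (cball 0 R) f" for f :: "'a \<Rightarrow> real"
  proof -
    obtain K where "\<And>x. x \<in> ball 0 R \<Longrightarrow> norm (f x) \<le> K" using bounded_on_cball[OF \<open>continuous_on _ f\<close>] by blast
    then show ?thesis
      using continuous_on_subset[OF that ball_subset_cball]
      by (intro integrable_lebesgue_on_ball_bounded[where C=K] AE_lebesgue_on_ballI2 continuous_measurable_lebesgue_on_ball) auto
  qed
  have mq: "(\<lambda>x. u x powr q) \<in> borel_measurable ?M" "(\<lambda>x. v x powr q) \<in> borel_measurable ?M"
    using Du(3) Dv(3) by (force intro!: continuous_measurable_lebesgue_on_ball continuous_intros contb)+
  have mp: "?p1 n \<in> borel_measurable ?M" "?p2 n \<in> borel_measurable ?M" for n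
    by (intro continuous_measurable_lebesgue_on_ball continuous_on_subset[OF cp(1) ball_subset_cball]
       continuous_on_subset[OF cp(2) ball_subset_cball])+
  let ?K = "C * (2 * B powr (1 + q))"
  have bd: "AE x in ?M. \<bar>a x * u x powr q * ?p1 n x\<bar> \<le> ?K" "AE x in ?M. \<bar>a x * v x powr q * ?p2 n x\<bar> \<le> ?K" for n
  proof -
    have 1: "\<bar>u x powr q * ?p1 n x\<bar> \<le> 2 * B powr (1 + q)" "\<bar>v x powr q * ?p2 n x\<bar> \<le> 2 * B powr (1 + q)"
      if "x \<in> ball 0 R" for x
      using that Du(3) Dv(3) B[OF that, of n] e(1)[of n]
      by (auto intro!: picone_test_bound q simp: less_imp_le add_pos_pos)
    show "AE x in ?M. \<bar>a x * u x powr q * ?p1 n x\<bar> \<le> ?K"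
      using C AE_space[of ?M]
      by eventually_elim (use 1(1) in \<open>simp add: mult.assoc abs_mult[of "a _"] mult_mono\<close>)
    show "AE x in ?M. \<bar>a x * v x powr q * ?p2 n x\<bar> \<le> ?K"
      using C AE_space[of ?M]
      by eventually_elim (use 1(2) in \<open>simp add: mult.assoc abs_mult[of "a _"] mult_mono\<close>)
  qed
  have m1: "(\<lambda>x. a x * u x powr q * ?p1 n x) \<in> borel_measurable ?M" "(\<lambda>x. a x * v x powr q * ?p2 n x) \<in> borel_measurable ?M" for n
    using meas_a mq mp by (auto intro!: borel_measurable_times)
  have S: "(\<lambda>n. LINT x|?M. a x * u x powr q * ?p1 n x + a x * v x powr q * ?p2 n x) \<longlonglongrightarrow> (LINT x|?M. 0)"
  proof (rule integral_dominated_convergence[where w="\<lambda>_. 2 * ?K"])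
    show "integrable ?M (\<lambda>_. 2 * ?K)"
      by (rule finite_measure.integrable_const[OF finite_measure_lebesgue_on_ball])
    show "AE x in ?M. (\<lambda>n. a x * u x powr q * ?p1 n x + a x * v x powr q * ?p2 n x) \<longlonglongrightarrow> 0"
    proof (rule AE_lebesgue_on_ballI2)
      fix x :: 'a assume x: "x \<in> ball 0 R"
      have "(\<lambda>n. a x * (u x powr q * ?p1 n x) + a x * (v x powr q * ?p2 n x))
        \<longlonglongrightarrow> a x * (u x powr (1 + q) - v x powr (1 + q)) + a x * (v x powr (1 + q) - u x powr (1 + q))"
        unfolding e_def using Du(3)[OF x] Dv(3)[OF x] by (intro tendsto_intros picone_test_tendsto)
      then show "(\<lambda>n. a x * u x powr q * ?p1 n x + a x * v x powr q * ?p2 n x) \<longlonglongrightarrow> 0"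
        by (simp add: algebra_simps)
    qed
    show "AE x in ?M. norm (a x * u x powr q * ?p1 n x + a x * v x powr q * ?p2 n x) \<le> 2 * ?K" for n
      using bd[of n] by eventually_elim (simp add: abs_le_iff)
  qed (use m1 in auto)
  have cP: "continuous_on (cball 0 R) (?P n)" for n
  proof -
    have "continuous_on (cball 0 R) (\<lambda>x. Du x \<bullet> ?g1 n x + Dv x \<bullet> ?g2 n x)"
      by (intro continuous_intros Du(1) Dv(1) cg)
    then show ?thesis
      by (rule continuous_on_eq) (use pos in \<open>auto intro!: picone_test_identity\<close>)
  qed
  have "(LINT x|?M. ?P n x) = (LINT x|?M. a x * u x powr q * ?p1 n x + a x * v x powr q * ?p2 n x)" for n
  proof -
    have "(LINT x|?M. ?P n x) = (LINT x|?M. Du x \<bullet> ?g1 n x + Dv x \<bullet> ?g2 n x)"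
      using pos by (intro Bochner_Integration.integral_cong refl picone_test_identity[symmetric]) auto
    also have "\<dots> = (LINT x|?M. Du x \<bullet> ?g1 n x) + (LINT x|?M. Dv x \<bullet> ?g2 n x)"
      by (intro Bochner_Integration.integral_add intc continuous_intros Du(1) Dv(1) cg)
    also have "\<dots> = (LINT x|?M. a x * u x powr q * ?p1 n x) + (LINT x|?M. a x * v x powr q * ?p2 n x)"
      by (simp only: eq1 eq2)
    also have "\<dots> = (LINT x|?M. a x * u x powr q * ?p1 n x + a x * v x powr q * ?p2 n x)"
      using bd[of n] m1[of n]
      by (intro Bochner_Integration.integral_add[symmetric] integrable_lebesgue_on_ball_bounded[where C="?K"]) auto
    finally show ?thesis .
  qed
  then have lim0: "(\<lambda>n. LINT x|?M. ?P n x) \<longlonglongrightarrow> 0" using S by simp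
  have P0: "0 \<le> ?P n x" if "x \<in> ball 0 R" for n x
    using pos[of x n] that by (intro picone_nonneg q) auto
  let ?Q = "\<lambda>x. picone q (Du x) (Dv x) (v x / u x)"
  have Q0: "0 \<le> ?Q x" if "x \<in> ball 0 R" for x
    using Du(3)[OF that] Dv(3)[OF that] by (intro picone_nonneg q) auto
  have cQ: "continuous_on (ball 0 R) ?Q"
    unfolding picone_def using Du(3) Dv(3) by (force intro!: continuous_intros contb)
  have PQ: "(\<lambda>n. ?P n x) \<longlonglongrightarrow> ?Q x" if "x \<in> ball 0 R" for x
  proof -
    have "(\<lambda>n. (v x + e n) / (u x + e n)) \<longlonglongrightarrow> (v x + 0) / (u x + 0)"
      using Du(3)[OF that] by (intro tendsto_intros e) auto
    then show ?thesis
      using Du(3)[OF that] Dv(3)[OF that] by (intro picone_tendsto) auto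
  qed
  have "(\<integral>\<^sup>+x. ennreal (?Q x) \<partial>?M) \<le> (\<integral>\<^sup>+x. liminf (\<lambda>n. ennreal (?P n x)) \<partial>?M)"
  proof (rule nn_integral_mono)
    fix x assume "x \<in> space ?M"
    then have "(\<lambda>n. ennreal (?P n x)) \<longlonglongrightarrow> ennreal (?Q x)"
      using PQ by (intro tendsto_ennrealI) auto
    then show "ennreal (?Q x) \<le> liminf (\<lambda>n. ennreal (?P n x))"
      using lim_imp_Liminf[OF sequentially_bot] by (metis order_refl)
  qed
  also have "\<dots> \<le> liminf (\<lambda>n. \<integral>\<^sup>+x. ennreal (?P n x) \<partial>?M)"
    by (intro nn_integral_liminf measurable_compose[OF _ measurable_ennreal]
        continuous_measurable_lebesgue_on_ball continuous_on_subset[OF cP ball_subset_cball])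
  also have "(\<lambda>n. \<integral>\<^sup>+x. ennreal (?P n x) \<partial>?M) = (\<lambda>n. ennreal (LINT x|?M. ?P n x))"
    using P0 by (intro ext nn_integral_eq_integral intc cP AE_lebesgue_on_ballI2) auto
  also have "liminf (\<lambda>n. ennreal (LINT x|?M. ?P n x)) = ennreal 0"
    using lim0 by (intro lim_imp_Liminf tendsto_ennrealI) auto
  finally have "(\<integral>\<^sup>+x. ennreal (?Q x) \<partial>?M) = 0" by simp
  then have "AE x in ?M. ennreal (?Q x) = 0"
    by (subst (asm) nn_integral_0_iff_AE)
       (intro measurable_compose[OF _ measurable_ennreal] continuous_measurable_lebesgue_on_ball cQ)
  moreover have "AE x in ?M. 0 \<le> ?Q x" by (rule AE_lebesgue_on_ballI2) (rule Q0)
  ultimately have "AE x in ?M. ?Q x = 0" by eventually_elim (simp add: ennreal_eq_0_iff)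
  then show ?thesis using AE_zero_continuous_on_ball[OF cQ _ x] by blast
qed

text \<open>Where \<open>u \<noteq> v\<close> both gradients vanish, hence the derivative of
  \<open>(u - v)^2\<close> vanishes everywhere and a difference at one point means a difference at
  all points. Then \<open>u\<close> is constant, and testing its equation with the function
  \<open>1\<close> contradicts the nonzero integral of \<open>a\<close>.\<close>

proposition pos_sol_ball_unique:
  fixes a u v :: "'a::euclidean_space \<Rightarrow> real"
  assumes R: "0 < R" and q: "0 < q" "q < 1"
    and a_meas: "a \<in> borel_measurable lebesgue"
    and a_bdd: "\<exists>C. AE x in lebesgue. x \<in> ball 0 R \<longrightarrow> \<bar>a x\<bar> \<le> C"
    and a_int: "(LINT x:ball 0 R|lebesgue. a x) \<noteq> 0"
    and u: "pos_sol_ball R a q u" and v: "pos_sol_ball R a q v"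
    and x: "x \<in> ball 0 R"
  shows "u x = v x"
proof (rule ccontr)
  assume neq: "u x \<noteq> v x"
  let ?M = "lebesgue_on (ball (0::'a) R)"
  obtain Du Dv where Du: "weak_pos_sol R a q u Du" and Dv: "weak_pos_sol R a q v Dv"
    using pos_sol_ball_weak[OF R q(1) a_meas a_bdd] u v by blast
  note pos = weak_pos_solD(3)[OF Du] weak_pos_solD(3)[OF Dv]
    and der = weak_pos_solD(5)[OF Du] weak_pos_solD(5)[OF Dv]
  have zero: "Du x = 0 \<and> Dv x = 0" if x: "x \<in> ball 0 R" and ne: "u x \<noteq> v x" for x
  proof -
    have "picone q (Du x) (Dv x) (v x / u x) = 0"
      by (rule pos_sol_ball_picone_zero[OF R q a_meas a_bdd Du Dv x])
    moreover have "0 < v x / u x" "v x / u x \<noteq> 1"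
      using pos[OF x] ne by auto
    ultimately show ?thesis using picone_eq_0D[OF q, of "v x / u x"] by blast
  qed
  have "((\<lambda>x. (u x - v x)\<^sup>2) has_derivative (\<lambda>h. 0)) (at y within ball 0 R)" if y: "y \<in> ball 0 R" for y
  proof -
    have "((\<lambda>x. (u x - v x)\<^sup>2) has_derivative (\<lambda>h. 2 * (u y - v y) * (Du y \<bullet> h - Dv y \<bullet> h))) (at y)"
      by (auto intro!: derivative_eq_intros der y simp: fun_eq_iff algebra_simps)
    moreover have "2 * (u y - v y) * (Du y \<bullet> h - Dv y \<bullet> h) = 0" for h
      using zero[OF y] by (cases "u y = v y") auto
    ultimately show ?thesis by (simp only: has_derivative_at_withinI)
  qed
  then have "(u y - v y)\<^sup>2 = (u x - v x)\<^sup>2" if "y \<in> ball 0 R" for y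
    using has_derivative_zero_unique[OF convex_ball _ that x, of "\<lambda>x. (u x - v x)\<^sup>2"] by blast
  then have ne: "u y \<noteq> v y" if "y \<in> ball 0 R" for y
    using neq that by (metis eq_iff_diff_eq_0 zero_eq_power2)
  then have Du0: "Du y = 0" if "y \<in> ball 0 R" for y using zero that by blast
  have const: "u y = u x" if "y \<in> ball 0 R" for y
    using has_derivative_zero_unique[OF convex_ball _ that x, of u] der(1) Du0
    by (metis (no_types, lifting) ext has_derivative_at_withinI inner_zero_left)
  have "(LINT y|?M. Du y \<bullet> 0) = (LINT y|?M. a y * u y powr q * 1)"
    by (rule weak_pos_solD(4)[OF Du]) auto
  also have "\<dots> = (LINT y|?M. a y * u x powr q)"
    by (rule Bochner_Integration.integral_cong) (auto simp: const)
  also have "\<dots> = (LINT y:ball 0 R|lebesgue. a y) * u x powr q"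
    by (simp add: set_lebesgue_integral_lebesgue_on)
  finally show False using a_int pos(1)[OF x] by simp
qed

section \<open>The radial integral operators\<close>

text \<open>Here \<open>m\<close> stands for \<open>N - 1\<close>. Keeping signs and radii out of
  this locale allows a second instance with coefficient \<open>\<beta> t * h t\<close>, in which the
  nonlinearity is part of the coefficient.\<close>

locale bounded_coeff =
  fixes \<beta> :: "real \<Rightarrow> real" and C :: real and m :: nat
  assumes \<beta>_measurable [measurable]: "\<beta> \<in> borel_measurable borel"
    and \<beta>_bound: "\<bar>\<beta> r\<bar> \<le> C"
begin

text \<open>The function \<open>p = pot h\<close> defined below is the integrated form of
  \<open>(r^m p')' = r^m \<beta> h\<close> with \<open>p(0) = p'(0) = 0\<close>; it makes sense for
  merely measurable \<open>\<beta>\<close>.\<close>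

definition flux :: "(real \<Rightarrow> real) \<Rightarrow> real \<Rightarrow> real" where
  "flux h s = integral {0..s} (\<lambda>t. t ^ m * (\<beta> t * h t))"

definition slope :: "(real \<Rightarrow> real) \<Rightarrow> real \<Rightarrow> real" where
  "slope h s = flux h s / s ^ m"

definition pot :: "(real \<Rightarrow> real) \<Rightarrow> real \<Rightarrow> real" where
  "pot h r = integral {0..r} (slope h)"

lemma C_nonneg: "0 \<le> C"
  using \<beta>_bound[of 0] by linarith

lemma integrable_weighted:
  assumes [measurable]: "h \<in> borel_measurable borel" and bd: "\<And>t. t \<in> {a..b} \<Longrightarrow> \<bar>h t\<bar> \<le> M"
  shows "(\<lambda>t. t ^ m * (\<beta> t * h t)) integrable_on {a..b}"
proof -
  have "set_integrable lborel {a..b} (\<lambda>t. t ^ m * (\<beta> t * h t))"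
    unfolding set_integrable_def
  proof (rule integrableI_bounded_set_indicator[where B = "max \<bar>a\<bar> \<bar>b\<bar> ^ m * (C * M)"])
    show "AE t in lborel. t \<in> {a..b} \<longrightarrow> norm (t ^ m * (\<beta> t * h t)) \<le> max \<bar>a\<bar> \<bar>b\<bar> ^ m * (C * M)"
      using C_nonneg by (intro AE_I2 impI) (auto simp: abs_mult power_abs intro!: mult_mono power_mono \<beta>_bound bd)
  qed (auto simp: emeasure_lborel_Icc_eq)
  then show ?thesis by (rule set_borel_integral_eq_integral)
qed

lemma weighted_integral_bound:
  assumes "h \<in> borel_measurable borel" and bd: "\<And>t. t \<in> {a..b} \<Longrightarrow> \<bar>h t\<bar> \<le> M" and ab: "0 \<le> a" "a \<le> b" and M: "0 \<le> M"
  shows "\<bar>integral {a..b} (\<lambda>t. t ^ m * (\<beta> t * h t))\<bar> \<le> C * M * b ^ m * (b - a)"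
proof -
  have "norm (integral {a..b} (\<lambda>t. t ^ m * (\<beta> t * h t))) \<le> integral {a..b} (\<lambda>t. b ^ m * (C * M))"
    using ab C_nonneg M by (intro integral_norm_bound_integral integrable_weighted[where M=M] assms)
      (auto simp: abs_mult power_abs intro!: mult_mono power_mono \<beta>_bound bd)
  then show ?thesis using ab by (simp add: algebra_simps)
qed

lemma flux_0 [simp]: "flux h 0 = 0" and slope_0 [simp]: "slope h 0 = 0" and pot_0 [simp]: "pot h 0 = 0"
  by (simp_all add: flux_def slope_def pot_def)

lemma flux_bound:
  assumes "h \<in> borel_measurable borel" "\<And>t. t \<in> {0..s} \<Longrightarrow> \<bar>h t\<bar> \<le> M" "0 \<le> s" "0 \<le> M"
  shows "\<bar>flux h s\<bar> \<le> C * M * s ^ m * s"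
  using weighted_integral_bound[of h 0 s M] assms by (simp add: flux_def)

text \<open>The weight inside the flux compensates the division by \<open>s ^ m\<close> and leaves
  one factor \<open>s\<close>, whence continuity of the slope at the singular point
  \<open>0\<close>.\<close>

lemma slope_bound:
  assumes "h \<in> borel_measurable borel" "\<And>t. t \<in> {0..s} \<Longrightarrow> \<bar>h t\<bar> \<le> M" "0 \<le> s" "0 \<le> M"
  shows "\<bar>slope h s\<bar> \<le> C * M * s"
proof (cases "s = 0")
  case False
  then have s: "0 < s ^ m" using assms by simp
  have "\<bar>slope h s\<bar> = \<bar>flux h s\<bar> / s ^ m" using s by (simp add: slope_def)
  also have "\<dots> \<le> C * M * s ^ m * s / s ^ m" using s by (intro divide_right_mono flux_bound assms) auto
  also have "\<dots> = C * M * s" using s False by simp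
  finally show ?thesis .
qed simp

lemma flux_diff:
  assumes "h \<in> borel_measurable borel" "\<And>t. t \<in> {0..s} \<Longrightarrow> \<bar>h t\<bar> \<le> M"
    and "k \<in> borel_measurable borel" "\<And>t. t \<in> {0..s} \<Longrightarrow> \<bar>k t\<bar> \<le> M"
  shows "flux h s - flux k s = flux (\<lambda>t. h t - k t) s"
  unfolding flux_def
  by (subst Henstock_Kurzweil_Integration.integral_diff[symmetric])
     (auto intro!: integrable_weighted[where M=M] assms simp: right_diff_distrib)

lemma flux_split:
  assumes "h \<in> borel_measurable borel" "\<And>t. t \<in> {0..s} \<Longrightarrow> \<bar>h t\<bar> \<le> M" "0 \<le> r" "r \<le> s"
  shows "flux h s = flux h r + integral {r..s} (\<lambda>t. t ^ m * (\<beta> t * h t))"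
  unfolding flux_def
  by (rule Henstock_Kurzweil_Integration.integral_combine[symmetric]) (use assms in \<open>auto intro!: integrable_weighted[where M=M]\<close>)

lemma flux_cong: "(\<And>t. t \<in> {0..s} \<Longrightarrow> h t = k t) \<Longrightarrow> flux h s = flux k s"
  unfolding flux_def by (rule integral_cong) auto

lemma pot_cong:
  assumes "\<And>t. t \<in> {0..r} \<Longrightarrow> h t = k t"
  shows "pot h r = pot k r"
  unfolding pot_def
proof (rule integral_cong)
  fix s assume "s \<in> {0..r}"
  then have "flux h s = flux k s" using assms by (intro flux_cong) auto
  then show "slope h s = slope k s" by (simp add: slope_def)
qed

lemma continuous_on_flux:
  assumes "h \<in> borel_measurable borel" "\<And>t. t \<in> {0..X} \<Longrightarrow> \<bar>h t\<bar> \<le> M"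
  shows "continuous_on {0..X} (flux h)"
  unfolding flux_def by (intro indefinite_integral_continuous_1 integrable_weighted[where M=M] assms)

lemma continuous_on_half_line:
  fixes f :: "real \<Rightarrow> real"
  assumes f: "\<And>X. continuous_on {0..X} f"
  shows "continuous_on {0..} f"
  unfolding continuous_on_eq_continuous_within
proof
  fix r :: real assume r: "r \<in> {0..}"
  have "continuous (at r within {0..r + 1}) f"
    using f[of "r + 1"] r by (auto simp: continuous_on_eq_continuous_within)
  moreover have "at r within {0..r + 1} = at r within {0..}"
    using r by (intro at_within_nhd[of _ "{r - 1<..<r + 1}"]) auto
  ultimately show "continuous (at r within {0..}) f" by simp
qed

lemma continuous_on_slope:
  assumes h: "h \<in> borel_measurable borel" "\<And>t. t \<in> {0..X} \<Longrightarrow> \<bar>h t\<bar> \<le> M"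
  shows "continuous_on {0..X} (slope h)"
proof (cases "0 < X")
  case X: True
  have M: "0 \<le> M" using h(2)[of 0] X by auto
  show ?thesis
    unfolding continuous_on_eq_continuous_within
  proof
    fix s assume s: "s \<in> {0..X}"
    show "continuous (at s within {0..X}) (slope h)"
    proof (cases "s = 0")
      case True
      have "(slope h \<longlongrightarrow> 0) (at 0 within {0..X})"
      proof (rule Lim_null_comparison)
        show "\<forall>\<^sub>F s in at 0 within {0..X}. norm (slope h s) \<le> C * M * s"
          unfolding eventually_at_filter
          by (intro always_eventually allI impI) (auto intro!: slope_bound[of h _ M] h M)
        show "((\<lambda>s. C * M * s) \<longlongrightarrow> 0) (at 0 within {0..X})"
          by (auto intro!: tendsto_eq_intros)
      qed
      then show ?thesis using True by (simp add: continuous_within)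
    next
      case False
      have "continuous (at s within {0..X}) (flux h)"
        using continuous_on_flux[OF h] s by (simp add: continuous_on_eq_continuous_within)
      then show ?thesis
        unfolding slope_def using False by (intro continuous_intros) auto
    qed
  qed
next
  case False
  then have "{0..X} = {} \<or> {0..X} = {0}" by auto
  then show ?thesis by auto
qed

lemma pot_has_derivative_within:
  assumes "h \<in> borel_measurable borel" "\<And>t. t \<in> {0..X} \<Longrightarrow> \<bar>h t\<bar> \<le> M" "r \<in> {0..X}"
  shows "(pot h has_real_derivative slope h r) (at r within {0..X})"
  unfolding pot_def by (rule integral_has_real_derivative[OF continuous_on_slope]) (use assms in auto)

lemma pot_has_derivative:
  assumes "h \<in> borel_measurable borel" "\<And>t. t \<in> {0..X} \<Longrightarrow> \<bar>h t\<bar> \<le> M" "0 < r" "r < X"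
  shows "(pot h has_real_derivative slope h r) (at r)"
proof -
  have "(pot h has_real_derivative slope h r) (at r within {0..X})"
    by (rule pot_has_derivative_within) (use assms in auto)
  then show ?thesis using assms at_within_interior[of r "{0..X}"] by simp
qed

lemma continuous_on_pot:
  assumes "h \<in> borel_measurable borel" "\<And>t. t \<in> {0..X} \<Longrightarrow> \<bar>h t\<bar> \<le> M"
  shows "continuous_on {0..X} (pot h)"
  by (rule DERIV_continuous_on[OF pot_has_derivative_within]) (use assms in auto)

lemma pot_split:
  assumes "h \<in> borel_measurable borel" "\<And>t. t \<in> {0..s} \<Longrightarrow> \<bar>h t\<bar> \<le> M" "0 \<le> r" "r \<le> s"
  shows "pot h s = pot h r + integral {r..s} (slope h)"
  unfolding pot_def
  by (rule Henstock_Kurzweil_Integration.integral_combine[symmetric])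
     (use assms in \<open>auto intro!: integrable_continuous_real continuous_on_slope[where M=M]\<close>)

lemma pot_lipschitz:
  assumes h: "h \<in> borel_measurable borel" "\<And>t. t \<in> {0..X} \<Longrightarrow> \<bar>h t\<bar> \<le> M" and rs: "0 \<le> r" "r \<le> s" "s \<le> X" and M: "0 \<le> M"
  shows "\<bar>pot h s - pot h r\<bar> \<le> C * M * X * (s - r)"
proof -
  have "pot h s - pot h r = integral {r..s} (slope h)"
    using pot_split[of h s M r] h rs by auto
  moreover have "norm (integral {r..s} (slope h)) \<le> integral {r..s} (\<lambda>t. C * M * X)"
  proof (intro integral_norm_bound_integral integrable_continuous_real)
    show "continuous_on {r..s} (slope h)"
      using continuous_on_slope[OF h] by (rule continuous_on_subset) (use rs in auto)
    fix t assume t: "t \<in> {r..s}"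
    have "\<bar>slope h t\<bar> \<le> C * M * t" using t rs M h by (intro slope_bound) auto
    also have "\<dots> \<le> C * M * X" using t rs M C_nonneg by (intro mult_left_mono) auto
    finally show "norm (slope h t) \<le> C * M * X" by simp
  qed auto
  ultimately show ?thesis using rs by (simp add: algebra_simps)
qed

lemma pot_diff_bound:
  assumes h: "h \<in> borel_measurable borel" "\<And>t. t \<in> {0..X} \<Longrightarrow> \<bar>h t\<bar> \<le> M"
    and k: "k \<in> borel_measurable borel" "\<And>t. t \<in> {0..X} \<Longrightarrow> \<bar>k t\<bar> \<le> M"
    and hk: "\<And>t. t \<in> {0..X} \<Longrightarrow> \<bar>h t - k t\<bar> \<le> e" and r: "0 \<le> r" "r \<le> X"
  shows "\<bar>pot h r - pot k r\<bar> \<le> C * e * X * X"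
proof -
  have e: "0 \<le> e" using hk[of 0] r by auto
  have [measurable]: "(\<lambda>t. h t - k t) \<in> borel_measurable borel" using h k by measurable
  have int: "slope h integrable_on {0..r}" "slope k integrable_on {0..r}"
    using h k r by (auto intro!: integrable_continuous_real continuous_on_slope[where M=M])
  have "pot h r - pot k r = integral {0..r} (\<lambda>s. slope h s - slope k s)"
    unfolding pot_def using int by (simp add: integral_diff)
  also have "\<dots> = pot (\<lambda>t. h t - k t) r"
    unfolding pot_def
  proof (rule integral_cong)
    fix s assume s: "s \<in> {0..r}"
    have "flux h s - flux k s = flux (\<lambda>t. h t - k t) s"
      by (rule flux_diff[where M=M]) (use h k s r in auto)
    then show "slope h s - slope k s = slope (\<lambda>t. h t - k t) s"
      by (simp add: slope_def diff_divide_distrib[symmetric])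
  qed
  also have "\<bar>\<dots>\<bar> \<le> C * e * X * (r - 0)"
    using pot_lipschitz[of "\<lambda>t. h t - k t" X e 0 r] hk r e by simp
  also have "\<dots> \<le> C * e * X * X"
    using r e C_nonneg by (intro mult_left_mono) auto
  finally show ?thesis .
qed

lemma flux_has_derivative:
  assumes h: "h \<in> borel_measurable borel" "\<And>t. t \<in> {0..X} \<Longrightarrow> \<bar>h t\<bar> \<le> M"
    and s: "0 < s" "s < X" and cont: "isCont \<beta> s" "isCont h s"
  shows "(flux h has_real_derivative s ^ m * (\<beta> s * h s)) (at s)"
proof -
  have "((\<lambda>u. integral {0..u} (\<lambda>t. t ^ m * (\<beta> t * h t))) has_vector_derivative s ^ m * (\<beta> s * h s))
          (at s within ({0..X} - {}))"
  proof (rule integral_has_vector_derivative_continuous_at)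
    show "(\<lambda>t. t ^ m * (\<beta> t * h t)) integrable_on {0..X}"
      by (rule integrable_weighted[OF h])
    have "isCont (\<lambda>t. t ^ m * (\<beta> t * h t)) s" using cont by (intro continuous_intros)
    then show "continuous (at s within ({0..X} - {})) (\<lambda>t. t ^ m * (\<beta> t * h t))"
      by (rule continuous_at_imp_continuous_at_within)
  qed (use s in auto)
  then show ?thesis
    using s at_within_interior[of s "{0..X}"]
    by (simp add: flux_def[abs_def] has_real_derivative_iff_has_vector_derivative)
qed

end

section \<open>Shooting for the radial problem\<close>

text \<open>Up to a common factor, \<open>flux (\<lambda>_. 1) R0\<close> is the integral of
  \<open>a^+\<close> and its excess over \<open>flux (\<lambda>_. 1) R\<close> is the integral of
  \<open>a^-\<close>; the last two assumptions are the integral hypotheses on \<open>a\<close>. Both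
  sign conditions include \<open>R0\<close>, so \<open>\<beta> R0 = 0\<close>.\<close>

locale radial_coeff = bounded_coeff +
  fixes R R0 q :: real
  assumes R0: "0 < R0" "R0 < R" and q: "0 < q" "q < 1"
    and \<beta>_pos: "r \<le> R0 \<Longrightarrow> 0 \<le> \<beta> r"
    and \<beta>_neg: "R0 \<le> r \<Longrightarrow> \<beta> r \<le> 0"
    and \<beta>_cont: "R0 < r \<Longrightarrow> r < R \<Longrightarrow> isCont \<beta> r"
    and \<beta>_mono: "R0 < r \<Longrightarrow> r \<le> s \<Longrightarrow> s < R \<Longrightarrow> \<beta> s \<le> \<beta> r"
    and total_neg: "flux (\<lambda>_. 1) R < 0"
    and balance: "(1 - q) / (1 + q) * (flux (\<lambda>_. 1) R0 - flux (\<lambda>_. 1) R) \<le> flux (\<lambda>_. 1) R0"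
begin

text \<open>Clipping below lets shooting solutions become negative, clipping above gives a bound on
  the data that is uniform in the parameter; the solutions finally obtained take values in
  \<open>[0, 1]\<close>.\<close>

definition trunc :: "real \<Rightarrow> real" where
  "trunc x = (min 1 (max 0 x)) powr q"

lemma trunc_bounds: "0 \<le> trunc x" "trunc x \<le> 1" "\<bar>trunc x\<bar> \<le> 1"
  using q by (auto simp: trunc_def powr_le1)

lemma continuous_on_trunc: "continuous_on S trunc"
  unfolding trunc_def using q by (intro continuous_on_powr' continuous_intros) auto

lemma trunc_eq: "0 \<le> x \<Longrightarrow> x \<le> 1 \<Longrightarrow> trunc x = x powr q"
  by (simp add: trunc_def)

lemma trunc_mono: "x \<le> y \<Longrightarrow> trunc x \<le> trunc y"
  unfolding trunc_def using q by (intro powr_mono2) auto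

lemma trunc_ge: "0 \<le> x \<Longrightarrow> x \<le> 1 \<Longrightarrow> x \<le> trunc x"
  using powr_mono'[of q 1 x] q by (simp add: trunc_eq)

lemma continuous_trunc_comp:
  "continuous_on UNIV w \<Longrightarrow> continuous_on UNIV (\<lambda>t. trunc (w t))"
  by (rule continuous_on_compose2[OF continuous_on_trunc]) auto

section \<open>Flux estimates inside and outside the radius \<open>R0\<close>\<close>

lemma flux_mono_inner:
  assumes h: "h \<in> borel_measurable borel" "\<And>t. t \<in> {0..s} \<Longrightarrow> \<bar>h t\<bar> \<le> M" "\<And>t. t \<in> {0..s} \<Longrightarrow> 0 \<le> h t"
    and rs: "0 \<le> r" "r \<le> s" "s \<le> R0"
  shows "flux h r \<le> flux h s"
proof -
  have "0 \<le> integral {r..s} (\<lambda>t. t ^ m * (\<beta> t * h t))"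
    using rs h by (intro integral_nonneg integrable_weighted[where M=M]) (auto intro!: mult_nonneg_nonneg \<beta>_pos)
  then show ?thesis using flux_split[of h s M r] h rs by simp
qed

lemma flux_antimono_outer:
  assumes h: "h \<in> borel_measurable borel" "\<And>t. t \<in> {0..s} \<Longrightarrow> \<bar>h t\<bar> \<le> M" "\<And>t. t \<in> {0..s} \<Longrightarrow> 0 \<le> h t"
    and rs: "R0 \<le> r" "r \<le> s"
  shows "flux h s \<le> flux h r"
proof -
  have "0 \<le> integral {r..s} (\<lambda>t. - (t ^ m * (\<beta> t * h t)))"
    using rs h R0
    by (intro integral_nonneg integrable_neg integrable_weighted[where M=M])
       (auto simp: mult_nonneg_nonpos mult_nonpos_nonneg \<beta>_neg)
  then show ?thesis using flux_split[of h s M r] h rs R0 by simp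
qed

lemma flux_1_R0_pos: "0 < flux (\<lambda>_. 1) R0"
proof -
  have "0 \<le> flux (\<lambda>_. 1) R0"
    using flux_mono_inner[of "\<lambda>_. 1" R0 1 0] R0 by simp
  then have "0 < flux (\<lambda>_. 1) R0 - flux (\<lambda>_. 1) R" using total_neg by simp
  then have "0 < (1 - q) / (1 + q) * (flux (\<lambda>_. 1) R0 - flux (\<lambda>_. 1) R)"
    using q by (intro mult_pos_pos) auto
  then show ?thesis using balance by simp
qed

text \<open>A radius that already carries positive mass but leaves a gap to \<open>R0\<close>,
  across which \<open>w\<close> must drop. It is obtained by choosing the shell
  \<open>[R0 - d, R0]\<close> so thin that it holds at most half of the inner mass.\<close>

lemma inner_radius:
  obtains r1 where "0 \<le> r1" "r1 < R0" "0 < flux (\<lambda>_. 1) r1"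
proof -
  define F where "F = flux (\<lambda>_. 1) R0"
  define d where "d = min R0 (F / (2 * (C * R0 ^ m + 1)))"
  have CR: "0 < C * R0 ^ m + 1" using C_nonneg R0 by (intro add_nonneg_pos) auto
  have F: "0 < F" using flux_1_R0_pos by (simp add: F_def)
  have d: "0 < d" "d \<le> R0" using F CR R0 by (auto simp: d_def)
  have "\<bar>integral {R0 - d..R0} (\<lambda>t. t ^ m * (\<beta> t * 1))\<bar> \<le> C * 1 * R0 ^ m * (R0 - (R0 - d))"
    using d by (intro weighted_integral_bound) auto
  then have "\<bar>integral {R0 - d..R0} (\<lambda>t. t ^ m * (\<beta> t * 1))\<bar> \<le> C * R0 ^ m * d" by simp
  also have "\<dots> \<le> (C * R0 ^ m + 1) * d" using d by (simp add: algebra_simps)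
  also have "\<dots> \<le> (C * R0 ^ m + 1) * (F / (2 * (C * R0 ^ m + 1)))"
    using CR by (intro mult_left_mono) (auto simp: d_def)
  also have "\<dots> = F / 2"
  proof -
    have "K * (F / (2 * K)) = F / 2" if "0 < K" for K using that by simp
    then show ?thesis using CR by blast
  qed
  finally have "F - flux (\<lambda>_. 1) (R0 - d) \<le> F / 2"
    using flux_split[of "\<lambda>_. 1" R0 1 "R0 - d"] d by (simp add: F_def)
  then show thesis using that[of "R0 - d"] d F by simp
qed

text \<open>Up to \<open>R0\<close> the flux does not fall below its value at \<open>r\<close>, and
  it is divided by at most \<open>R0 ^ m\<close>.\<close>

lemma pot_increment_inner:
  assumes h: "h \<in> borel_measurable borel" "\<And>t. t \<in> {0..R0} \<Longrightarrow> \<bar>h t\<bar> \<le> M" "\<And>t. t \<in> {0..R0} \<Longrightarrow> 0 \<le> h t"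
    and r: "0 \<le> r" "r \<le> R0"
  shows "flux h r * ((R0 - r) / R0 ^ m) \<le> pot h R0 - pot h r"
proof -
  have "integral {r..R0} (\<lambda>_. flux h r / R0 ^ m) \<le> integral {r..R0} (slope h)"
  proof (rule integral_le)
    show "slope h integrable_on {r..R0}"
      by (intro integrable_continuous_real continuous_on_subset[OF continuous_on_slope[OF h(1,2)]]) (use r in auto)
    fix s assume s: "s \<in> {r..R0}"
    have f: "0 \<le> flux h r" "flux h r \<le> flux h s"
      using flux_mono_inner[of h r M 0] flux_mono_inner[of h s M r] h r s by auto
    show "flux h r / R0 ^ m \<le> slope h s"
    proof (cases "s = 0")
      case True
      then show ?thesis using s r by simp
    next
      case False
      then show ?thesis
        unfolding slope_def using f s r by (intro frac_le power_mono) auto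
    qed
  qed auto
  then show ?thesis using pot_split[of h R0 M r] h r by (simp add: mult.commute)
qed

lemma weighted_flux_ge:
  assumes h: "h \<in> borel_measurable borel" "\<And>t. t \<in> {0..s} \<Longrightarrow> \<bar>h t\<bar> \<le> M"
    and c: "\<And>t. t \<in> {r..s} \<Longrightarrow> c \<le> h t" and rs: "0 \<le> r" "r \<le> s" "s \<le> R0"
  shows "flux h r + c * (flux (\<lambda>_. 1) s - flux (\<lambda>_. 1) r) \<le> flux h s"
proof -
  have "c * integral {r..s} (\<lambda>t. t ^ m * (\<beta> t * 1)) = integral {r..s} (\<lambda>t. c * (t ^ m * (\<beta> t * 1)))"
    by simp
  also have "\<dots> \<le> integral {r..s} (\<lambda>t. t ^ m * (\<beta> t * h t))"
  proof (rule integral_le)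
    show "(\<lambda>t. c * (t ^ m * (\<beta> t * 1))) integrable_on {r..s}"
      by (intro integrable_on_mult_right integrable_weighted[where M=1]) auto
    show "(\<lambda>t. t ^ m * (\<beta> t * h t)) integrable_on {r..s}"
      using h rs by (intro integrable_weighted[where M=M]) auto
    fix t assume t: "t \<in> {r..s}"
    have "(t ^ m * \<beta> t) * c \<le> (t ^ m * \<beta> t) * h t"
      using t rs c[OF t] by (intro mult_left_mono mult_nonneg_nonneg \<beta>_pos) auto
    then show "c * (t ^ m * (\<beta> t * 1)) \<le> t ^ m * (\<beta> t * h t)" by (simp add: mult_ac)
  qed
  finally show ?thesis
    using flux_split[of h s M r] flux_split[of "\<lambda>_. 1" s 1 r] h rs by simp
qed

text \<open>At the first zero \<open>R1\<close> the flux \<open>g\<close> vanishes, whether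
  \<open>R1\<close> is interior or equals \<open>R\<close>. The quantity
  \<open>g * w powr (- q)\<close> strictly exceeds the inner mass at \<open>R0\<close>, loses at
  most \<open>c\<close> times the negative mass on the way to \<open>R1\<close>, and tends to
  \<open>0\<close> there. The balance condition makes the loss at most the inner mass, so a positive
  excess would have to tend to \<open>0\<close>.\<close>

lemma no_dead_core:
  assumes \<mu>: "0 < \<mu>" and wc: "continuous_on UNIV w"
    and weq: "\<And>r. r \<in> {0..R} \<Longrightarrow> w r = 1 - \<mu> * pot (\<lambda>t. trunc (w t)) r"
    and w0: "\<And>r. r \<in> {0..R} \<Longrightarrow> 0 \<le> w r"
    and fluxR: "flux (\<lambda>t. trunc (w t)) R \<le> 0"
    and z: "z \<in> {0..R}" "w z = 0"
  shows False
proof -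
  define h where "h t = trunc (w t)" for t
  define g where "g = flux h"
  have hc: "continuous_on UNIV h" unfolding h_def by (rule continuous_trunc_comp[OF wc])
  have hm: "h \<in> borel_measurable borel" using hc by (rule borel_measurable_continuous_onI)
  have hb: "\<bar>h t\<bar> \<le> 1" and h0: "0 \<le> h t" for t unfolding h_def using trunc_bounds by auto
  have gc: "continuous_on {0..R} g" unfolding g_def by (rule continuous_on_flux[OF hm hb])
  have weq': "w r = 1 - \<mu> * pot h r" if "r \<in> {0..R}" for r
    using weq[OF that] by (simp add: h_def[abs_def])
  have wd: "(w has_real_derivative - \<mu> * (g r / r ^ m)) (at r)" if r: "0 < r" "r < R" for r
  proof -
    have "((\<lambda>r. 1 - \<mu> * pot h r) has_real_derivative - \<mu> * slope h r) (at r)"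
      by (rule derivative_eq_intros pot_has_derivative[OF hm hb r] refl)+ simp
    then have "(w has_real_derivative - \<mu> * slope h r) (at r)"
      by (rule DERIV_cong_ev[OF refl _ refl, THEN iffD2, rotated])
         (use r weq' in \<open>auto intro!: eventually_mono[OF eventually_nhds_in_open[of "{0<..<R}"]]\<close>)
    then show ?thesis by (simp add: slope_def g_def)
  qed
  have wcS: "continuous_on S w" for S using wc by (rule continuous_on_subset) auto
  have w_0: "w 0 = 1" using weq'[of 0] R0 by simp

  define Z where "Z = {0..R} \<inter> w -` {0}"
  have "closed Z" unfolding Z_def by (intro continuous_closed_preimage wcS) auto
  then have Zc: "compact Z" by (metis Z_def bounded_closed_interval bounded_Int compact_eq_bounded_closed)
  have "Z \<noteq> {}" using z by (auto simp: Z_def)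
  from compact_attains_inf[OF Zc this] obtain R1 where R1: "R1 \<in> Z" "\<And>t. t \<in> Z \<Longrightarrow> R1 \<le> t" by auto
  have R1': "0 \<le> R1" "R1 \<le> R" "w R1 = 0" using R1(1) by (auto simp: Z_def)
  have "R1 \<noteq> 0" using w_0 R1' by auto
  then have R1p: "0 < R1" using R1' by simp
  have wpos: "0 < w r" if "0 \<le> r" "r < R1" for r
  proof -
    have "r \<notin> Z" using R1(2)[of r] that by auto
    then show ?thesis using w0[of r] that R1' by (force simp: Z_def)
  qed

  have g_R1: "g R1 = 0"
  proof (cases "R1 < R")
    case True
    have "- \<mu> * (g R1 / R1 ^ m) = 0"
    proof (rule DERIV_local_min[OF wd])
      show "0 < min R1 (R - R1)" using True R1p by simp
      show "\<forall>y. \<bar>R1 - y\<bar> < min R1 (R - R1) \<longrightarrow> w R1 \<le> w y"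
        using w0 R1' by (auto simp: abs_less_iff)
    qed (use True R1p in auto)
    then show ?thesis using \<mu> R1p by simp
  next
    case False
    then have R1R: "R1 = R" using R1' by simp
    \<comment> \<open>A negative flux at \<open>R\<close> makes \<open>w\<close> increase up to
      \<open>w R = 0\<close> just before \<open>R\<close>, against positivity there.\<close>
    have "0 \<le> g R"
    proof (rule ccontr)
      assume neg: "\<not> 0 \<le> g R"
      have "\<exists>d>0. \<forall>x\<in>{0..R}. dist x R < d \<longrightarrow> dist (g x) (g R) < - g R"
        using gc R0 neg by (auto simp: continuous_on_iff)
      then obtain d where d: "d > 0" "\<And>x. x \<in> {0..R} \<Longrightarrow> dist x R < d \<Longrightarrow> dist (g x) (g R) < - g R" by auto
      define r where "r = max (R / 2) (R - d / 2)"
      have r: "0 < r" "r < R" "R - r < d" using d R0 by (auto simp: r_def max_def)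
      have "w r \<le> w R"
      proof (rule DERIV_nonneg_imp_increasing_open[where f = w])
        fix x assume x: "r < x" "x < R"
        then have "g x < 0" using d(2)[of x] r by (auto simp: dist_real_def)
        then show "\<exists>y. (w has_real_derivative y) (at x) \<and> 0 \<le> y"
          using wd[of x] x r \<mu> by (intro exI[of _ "- \<mu> * (g x / x ^ m)"]) (auto simp: mult_le_0_iff divide_le_0_iff)
      qed (use r wcS in auto)
      then show False using wpos[of r] r R1R R1' by simp
    qed
    then show ?thesis using fluxR R1R unfolding g_def h_def[abs_def] by simp
  qed

  have g_nonneg_in: "0 \<le> g r" if "0 \<le> r" "r \<le> R0" for r
    using flux_mono_inner[OF hm hb h0, of 0 r] that by (simp add: g_def)
  \<comment> \<open>Up to \<open>R0\<close> the flux is nondecreasing and starts at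
    \<open>0\<close>; vanishing again at \<open>R1 \<le> R0\<close> it would be zero throughout, and
    \<open>w\<close> would stay equal to \<open>1\<close>.\<close>
  have R1R0: "R0 < R1"
  proof (rule ccontr)
    assume n: "\<not> R0 < R1"
    have "slope h s = 0" if "s \<in> {0..R1}" for s
    proof -
      have "g s \<le> g R1" unfolding g_def using that n by (intro flux_mono_inner[OF hm hb h0]) auto
      then have "g s = 0" using g_nonneg_in[of s] that n g_R1 by simp
      then show ?thesis by (simp add: slope_def g_def)
    qed
    then have "pot h R1 = integral {0..R1} (\<lambda>_. 0)" unfolding pot_def by (intro integral_cong) auto
    then have "w R1 = 1" using weq'[of R1] R1' by simp
    then show False using R1' by simp
  qed
  have g_nonneg: "0 \<le> g r" if "0 \<le> r" "r \<le> R1" for r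
  proof (cases "r \<le> R0")
    case False
    then have "g R1 \<le> g r" unfolding g_def using that by (intro flux_antimono_outer[OF hm hb h0]) auto
    then show ?thesis using g_R1 by simp
  qed (use g_nonneg_in that in auto)
  have w_dec: "w s \<le> w r" if "0 \<le> r" "r \<le> s" "s \<le> R1" for r s
  proof (rule DERIV_nonpos_imp_decreasing_open[OF that(2), where f = w])
    fix x assume x: "r < x" "x < s"
    then show "\<exists>y. (w has_real_derivative y) (at x) \<and> y \<le> 0"
      using wd[of x] that R1' g_nonneg[of x] \<mu>
      by (intro exI[of _ "- \<mu> * (g x / x ^ m)"]) (auto simp: zero_le_mult_iff zero_le_divide_iff)
  qed (rule wcS)
  have h_eq: "h r = w r powr q" if "0 \<le> r" "r \<le> R1" for r
    using w_dec[of 0 r] w0[of r] that R1' w_0 by (simp add: h_def trunc_eq)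
  have w_R0: "0 < w R0" using wpos[of R0] R0 R1R0 by simp

  \<comment> \<open>Source of the strict inequality: on \<open>[0, r1]\<close>, which carries
    positive mass, the weight is at least \<open>w r1 powr q\<close>, strictly more than
    \<open>w R0 powr q\<close>.\<close>
  obtain r1 where r1: "0 \<le> r1" "r1 < R0" "0 < flux (\<lambda>_. 1) r1" by (rule inner_radius)
  have g_r1: "w r1 powr q * flux (\<lambda>_. 1) r1 \<le> g r1"
  proof -
    have "w r1 powr q \<le> h t" if "t \<in> {0..r1}" for t
      using that r1 R1R0 w_dec[of t r1] q w0[of r1] R1' by (subst h_eq) (auto intro!: powr_mono2)
    then show ?thesis
      using weighted_flux_ge[of h r1 1 0 "w r1 powr q"] hm hb r1 by (simp add: g_def)
  qed
  have w_r1: "0 < w r1" using wpos[of r1] r1 R1R0 by simp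
  then have g_r1p: "0 < g r1" using g_r1 r1 by (smt (verit) mult_pos_pos powr_gt_zero)
  have "w R0 < w r1"
  proof -
    have "0 < g r1 * ((R0 - r1) / R0 ^ m)" using g_r1p r1 R0 by simp
    also have "\<dots> \<le> pot h R0 - pot h r1"
      unfolding g_def using r1 by (intro pot_increment_inner[OF hm hb h0]) auto
    finally show ?thesis using weq'[of R0] weq'[of r1] r1 R0 \<mu> by simp
  qed
  then have "w R0 powr q < w r1 powr q" using q w_R0 by (intro powr_less_mono2) auto
  then have "w R0 powr q * flux (\<lambda>_. 1) r1 < w r1 powr q * flux (\<lambda>_. 1) r1" using r1 by simp
  also have "\<dots> \<le> g r1" by (rule g_r1)
  finally have "w R0 powr q * flux (\<lambda>_. 1) R0 < g r1 + w R0 powr q * (flux (\<lambda>_. 1) R0 - flux (\<lambda>_. 1) r1)"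
    by (simp add: algebra_simps)
  also have "\<dots> \<le> g R0"
    unfolding g_def
  proof (rule weighted_flux_ge[OF hm hb])
    fix t assume "t \<in> {r1..R0}"
    then show "w R0 powr q \<le> h t"
      using r1 R1R0 w_dec[of t R0] q w_R0 R1' by (subst h_eq) (auto intro!: powr_mono2)
  qed (use r1 in auto)
  finally have strict: "flux (\<lambda>_. 1) R0 < g R0 * w R0 powr (- q)"
    using w_R0 by (simp add: powr_minus field_simps)

  have gd: "(g has_real_derivative s ^ m * (\<beta> s * w s powr q)) (at s)" if s: "R0 < s" "s < R1" for s
  proof -
    have "isCont h s" using hc by (simp add: continuous_on_eq_continuous_at)
    then have "(g has_real_derivative s ^ m * (\<beta> s * h s)) (at s)"
      unfolding g_def using s R0 R1' by (intro flux_has_derivative[OF hm hb, where X=R] \<beta>_cont) auto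
    then show ?thesis using h_eq[of s] s R0 by simp
  qed
  \<comment> \<open>This is \<open>- w'\<close>. It is differentiable only where
    \<open>\<beta>\<close> is continuous, so the next facts are confined to the annulus.\<close>
  define p where "p s = \<mu> * (g s / s ^ m)" for s
  have p_nonneg: "0 \<le> p s" if "0 \<le> s" "s \<le> R1" for s using g_nonneg[OF that] that \<mu> by (simp add: p_def)
  have wd': "(w has_real_derivative - p s) (at s)" if "0 < s" "s < R1" for s
    using wd[of s] that R1' by (simp add: p_def)
  have pd: "(p has_real_derivative \<mu> * (\<beta> s * w s powr q) - real m / s * p s) (at s)" if s: "R0 < s" "s < R1" for s
  proof -
    have s0: "0 < s" using s R0 by simp
    have "((\<lambda>s. \<mu> * (g s / s ^ m)) has_real_derivative
       \<mu> * ((s ^ m * (\<beta> s * w s powr q) * s ^ m - g s * (real m * s ^ (m - Suc 0))) / (s ^ m * s ^ m))) (at s)"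
      using s0 by (auto intro!: derivative_eq_intros gd[OF s] simp: algebra_simps)
    also have "\<mu> * ((s ^ m * (\<beta> s * w s powr q) * s ^ m - g s * (real m * s ^ (m - Suc 0))) / (s ^ m * s ^ m))
        = \<mu> * (\<beta> s * w s powr q) - real m / s * p s"
      using s0 by (cases m) (simp_all add: p_def field_simps)
    finally show ?thesis by (simp add: p_def[abs_def])
  qed
  have pc: "continuous_on {R0..R1} p"
    unfolding p_def using R0 R1' by (intro continuous_intros continuous_on_subset[OF gc]) auto
  \<comment> \<open>Multiplying the equation by \<open>w'\<close>: the energy with frozen coefficient decreases to \<open>0\<close> at \<open>R1\<close>.\<close>
  have energy: "2 * \<mu> * (- \<beta> r) / (1 + q) * w r powr (1 + q) \<le> (p r)\<^sup>2" if r: "R0 < r" "r < R1" for r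
  proof -
    define F where "F s = (p s)\<^sup>2 / 2 - \<mu> * (- \<beta> r) / (1 + q) * w s powr (1 + q)" for s
    have "F R1 \<le> F r"
    proof (rule DERIV_nonpos_imp_decreasing_open[where f = F])
      show "continuous_on {r..R1} F"
        unfolding F_def using r q w0 R0 R1' 
        by (intro continuous_intros continuous_on_powr' continuous_on_subset[OF pc] wcS) auto
      fix s assume s: "r < s" "s < R1"
      have s': "R0 < s" "0 < s" "0 < w s" using s r R0 wpos[of s] by auto
      let ?D = "p s * (\<mu> * (\<beta> s * w s powr q) - real m / s * p s) - \<mu> * (- \<beta> r) * (w s powr q * (- p s))"
      have "((\<lambda>x. w x powr (1 + q)) has_real_derivative (1 + q) * w s powr q * (- p s)) (at s)"
        using DERIV_chain2[OF has_real_derivative_powr[OF s'(3), of "1 + q"] wd'[OF s'(2) s(2)]] by simp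
      moreover have "((\<lambda>x. (p x)\<^sup>2 / 2) has_real_derivative
          p s * (\<mu> * (\<beta> s * w s powr q) - real m / s * p s)) (at s)"
        using DERIV_cdivide[OF DERIV_power[OF pd[OF s'(1) s(2)], of 2], of 2] by (simp add: mult.commute)
      ultimately have "(F has_real_derivative p s * (\<mu> * (\<beta> s * w s powr q) - real m / s * p s)
          - \<mu> * (- \<beta> r) / (1 + q) * ((1 + q) * w s powr q * (- p s))) (at s)"
        unfolding F_def by (intro DERIV_diff DERIV_cmult)
      then have "(F has_real_derivative ?D) (at s)" using q by (simp add: mult.assoc)
      moreover have "?D = p s * (\<mu> * w s powr q * (\<beta> s - \<beta> r)) - real m / s * (p s)\<^sup>2"
        by (simp add: algebra_simps power2_eq_square)
      \<comment> \<open>Both contributions are nonpositive: the first because \<open>\<beta>\<close>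
        is nonincreasing, the second because the first-order term of the radial Laplacian acts as
        friction.\<close>
      moreover have "p s * (\<mu> * w s powr q * (\<beta> s - \<beta> r)) \<le> 0"
        using p_nonneg[of s] s' s \<mu> \<beta>_mono[of r s] r R1' by (intro mult_nonneg_nonpos) auto
      moreover have "0 \<le> real m / s * (p s)\<^sup>2" using s' by simp
      ultimately show "\<exists>y. (F has_real_derivative y) (at s) \<and> y \<le> 0"
        by (intro exI[of _ ?D] conjI) (auto simp only:)
    qed (use r in simp)
    moreover have "F R1 = 0" using g_R1 R1' q by (simp add: F_def p_def)
    ultimately have "0 \<le> (p r)\<^sup>2 / 2 - \<mu> * (- \<beta> r) / (1 + q) * w r powr (1 + q)" by (simp add: F_def)
    moreover have "2 * \<mu> * (- \<beta> r) / (1 + q) * w r powr (1 + q) = 2 * (\<mu> * (- \<beta> r) / (1 + q) * w r powr (1 + q))"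
      by simp
    ultimately show ?thesis by linarith
  qed

  \<comment> \<open>Dividing by \<open>w powr q\<close> turns the equation into a derivative of
    \<open>g * w powr (- q)\<close> consisting of \<open>x ^ m * \<beta> x\<close> and a positive
    term; by \<open>energy\<close> the latter is at least \<open>2 * q / (1 + q)\<close> times
    \<open>x ^ m * (- \<beta> x)\<close>. What is left of the coefficient is the factor
    \<open>c\<close>.\<close>
  define c where "c = (1 - q) / (1 + q)"
  have c: "0 < c" using q by (simp add: c_def)
  let ?f = "flux (\<lambda>_. 1)"
  have growth: "g R0 * w R0 powr (- q) \<le> g s * w s powr (- q) + c * (?f R0 - ?f s)" if s: "R0 < s" "s < R1" for s
  proof -
    define G where "G x = g x * w x powr (- q) + c * (?f R0 - ?f x)" for x
    have "G R0 \<le> G s"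
    proof (rule DERIV_nonneg_imp_increasing_open[where f = G])
      have wne: "w x \<noteq> 0" if "x \<in> {R0..s}" for x using wpos[of x] that s R0 by auto
      show "continuous_on {R0..s} G"
        unfolding G_def using wne s R0 R1'
        by (intro continuous_intros wcS continuous_on_subset[OF gc]
            continuous_on_subset[OF continuous_on_flux[of "\<lambda>_. 1" R 1]]) auto
      fix x assume x: "R0 < x" "x < s"
      have x': "0 < x" "x < R1" "0 < w x" using x s R0 wpos[of x] by auto
      let ?D = "x ^ m * (\<beta> x * w x powr q) * w x powr (- q) + g x * (q * w x powr (- q - 1) * p x) - c * (x ^ m * (\<beta> x * 1))"
      have "((\<lambda>x. w x powr (- q)) has_real_derivative - q * w x powr (- q - 1) * (- p x)) (at x)"
        by (rule DERIV_chain2[OF has_real_derivative_powr[OF x'(3)] wd'[OF x'(1,2)]])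
      moreover have "(?f has_real_derivative x ^ m * (\<beta> x * 1)) (at x)"
        using x x' R1' by (intro flux_has_derivative[where X=R and M=1] \<beta>_cont) auto
      ultimately have "(G has_real_derivative x ^ m * (\<beta> x * w x powr q) * w x powr (- q)
          + - q * w x powr (- q - 1) * (- p x) * g x + c * (0 - x ^ m * (\<beta> x * 1))) (at x)"
        unfolding G_def by (intro DERIV_add DERIV_mult DERIV_cmult DERIV_diff DERIV_const gd[OF x(1) x'(2)])
      then have D: "(G has_real_derivative ?D) (at x)" by (simp add: mult_ac)
      have g_p: "g x = x ^ m * p x / \<mu>" using \<mu> x' by (simp add: p_def)
      have "w x powr q * w x powr (- q) = 1" using x' by (simp add: powr_add[symmetric])
      then have eq: "?D = x ^ m * (\<beta> x + q / \<mu> * ((p x)\<^sup>2 * w x powr (- q - 1)) - c * \<beta> x)"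
        unfolding g_p using \<mu> by (simp add: field_simps power2_eq_square)
      have "2 * \<mu> * (- \<beta> x) / (1 + q) * w x powr (1 + q) * w x powr (- q - 1) \<le> (p x)\<^sup>2 * w x powr (- q - 1)"
        using energy[OF x(1) x'(2)] by (intro mult_right_mono) auto
      moreover have "w x powr (1 + q) * w x powr (- q - 1) = 1" using x' by (simp add: powr_add[symmetric])
      ultimately have "2 * \<mu> * (- \<beta> x) / (1 + q) \<le> (p x)\<^sup>2 * w x powr (- q - 1)"
        by (metis mult.assoc mult.right_neutral)
      then have "q / \<mu> * (2 * \<mu> * (- \<beta> x) / (1 + q)) \<le> q / \<mu> * ((p x)\<^sup>2 * w x powr (- q - 1))"
        using q \<mu> by (intro mult_left_mono) auto
      also have "q / \<mu> * (2 * \<mu> * (- \<beta> x) / (1 + q)) = - \<beta> x + c * \<beta> x"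
        using q \<mu> by (simp add: c_def field_simps)
      finally have "0 \<le> ?D" unfolding eq using x' by (intro mult_nonneg_nonneg) auto
      with D show "\<exists>y. (G has_real_derivative y) (at x) \<and> 0 \<le> y" by blast
    qed (use s in simp)
    then show ?thesis by (simp add: G_def)
  qed
  \<comment> \<open>The quotient is of the form 0/0 at \<open>R1\<close>. As \<open>w\<close>
    decreases, \<open>h\<close> is at most \<open>w s powr q\<close> on \<open>[s, R1]\<close>, and
    this factor cancels.\<close>
  have tail: "g s * w s powr (- q) \<le> C * R ^ m * (R1 - s)" if s: "R0 < s" "s < R1" for s
  proof -
    have ws: "0 < w s" using wpos[of s] s R0 by simp
    have "g R1 = g s + integral {s..R1} (\<lambda>t. t ^ m * (\<beta> t * h t))"
      unfolding g_def by (rule flux_split[OF hm hb]) (use s R0 in auto)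
    then have "g s = - integral {s..R1} (\<lambda>t. t ^ m * (\<beta> t * h t))" using g_R1 by simp
    also have "\<dots> \<le> C * w s powr q * R1 ^ m * (R1 - s)"
    proof -
      have "\<bar>integral {s..R1} (\<lambda>t. t ^ m * (\<beta> t * h t))\<bar> \<le> C * w s powr q * R1 ^ m * (R1 - s)"
      proof (rule weighted_integral_bound[OF hm])
        fix t assume t: "t \<in> {s..R1}"
        then show "\<bar>h t\<bar> \<le> w s powr q"
          using s R0 w_dec[of s t] w0[of t] R1' q h_eq[of t] by (auto intro!: powr_mono2)
      qed (use s R0 in auto)
      then show ?thesis by linarith
    qed
    also have "\<dots> \<le> C * w s powr q * R ^ m * (R1 - s)"
      using s R1' C_nonneg by (intro mult_right_mono mult_left_mono power_mono) auto
    finally have "g s * w s powr (- q) \<le> C * w s powr q * R ^ m * (R1 - s) * w s powr (- q)"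
      by (intro mult_right_mono) auto
    also have "\<dots> = C * R ^ m * (R1 - s) * (w s powr q * w s powr (- q))" by simp
    also have "w s powr q * w s powr (- q) = 1" using ws by (simp add: powr_add[symmetric])
    finally show ?thesis by simp
  qed
  define e where "e = g R0 * w R0 powr (- q) - ?f R0"
  have e: "0 < e" using strict by (simp add: e_def)
  have bound: "e \<le> C * R ^ m * (R1 - s)" if s: "R0 < s" "s < R1" for s
  proof -
    have "?f R \<le> ?f s"
      using s R1' by (intro flux_antimono_outer[where M=1]) auto
    then have "c * (?f R0 - ?f s) \<le> c * (?f R0 - ?f R)" using c by (intro mult_left_mono) auto
    also have "\<dots> \<le> ?f R0" using balance by (simp add: c_def)
    finally show ?thesis using growth[OF s] tail[OF s] by (simp add: e_def)
  qed
  define K where "K = C * R ^ m + 1"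
  have K: "0 < K" using C_nonneg R0 by (auto simp: K_def intro!: add_nonneg_pos)
  define s where "s = max ((R0 + R1) / 2) (R1 - e / (2 * K))"
  have s: "R0 < s" "s < R1" using R1R0 e K by (auto simp: s_def less_max_iff_disj)
  have "e \<le> C * R ^ m * (R1 - s)" by (rule bound[OF s])
  also have "\<dots> \<le> K * (R1 - s)" using s by (simp add: K_def algebra_simps)
  also have "\<dots> \<le> K * (e / (2 * K))" using K by (intro mult_left_mono) (auto simp: s_def)
  also have "\<dots> = e / 2" using K by simp
  finally show False using e by simp
qed

section \<open>The delayed problem\<close>

lemma trunc_uniformly_continuous:
  assumes "0 < e"
  obtains d where "0 < d" "\<And>x y. \<bar>x - y\<bar> < d \<Longrightarrow> \<bar>trunc x - trunc y\<bar> < e"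
proof -
  have "uniformly_continuous_on {0..1::real} (\<lambda>x. x powr q)"
    using q by (intro compact_uniformly_continuous continuous_on_powr' continuous_intros) auto
  then obtain d where d: "0 < d" "\<And>x y. x \<in> {0..1} \<Longrightarrow> y \<in> {0..1} \<Longrightarrow> dist y x < d \<Longrightarrow> dist (y powr q) (x powr q) < e"
    using assms unfolding uniformly_continuous_on_def by metis
  show thesis
  proof (rule that[OF d(1)])
    fix x y :: real assume "\<bar>x - y\<bar> < d"
    then have "dist (min 1 (max 0 x)) (min 1 (max 0 y)) < d" by (auto simp: dist_real_def)
    then show "\<bar>trunc x - trunc y\<bar> < e"
      using d(2)[of "min 1 (max 0 y)" "min 1 (max 0 x)"] by (simp add: trunc_def dist_real_def)
  qed
qed

text \<open>Times before \<open>0\<close> are replaced by \<open>0\<close>, so the prescribed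
  history is the constant initial value.\<close>

definition delayed :: "real \<Rightarrow> (real \<Rightarrow> real) \<Rightarrow> real \<Rightarrow> real" where
  "delayed \<delta> w t = trunc (w (max 0 (t - \<delta>)))"

text \<open>
  For \<open>k \<delta> \<ge> R\<close> the iterate \<open>iter \<delta> \<mu> k\<close> solves the delayed problem exactly on \<open>[0, R]\<close>.
\<close>

primrec iter :: "real \<Rightarrow> real \<Rightarrow> nat \<Rightarrow> real \<Rightarrow> real" where
  "iter \<delta> \<mu> 0 = (\<lambda>r. 1)"
| "iter \<delta> \<mu> (Suc k) = (\<lambda>r. 1 - \<mu> * pot (delayed \<delta> (iter \<delta> \<mu> k)) r)"

lemma delayed_bounds: "0 \<le> delayed \<delta> w t" "delayed \<delta> w t \<le> 1" "\<bar>delayed \<delta> w t\<bar> \<le> 1"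
  unfolding delayed_def using trunc_bounds by auto

lemma delayed_measurable:
  assumes "continuous_on {0..} w"
  shows "delayed \<delta> w \<in> borel_measurable borel"
proof -
  have "continuous_on UNIV (\<lambda>t. w (max 0 (t - \<delta>)))"
    by (rule continuous_on_compose2[OF assms]) (auto intro!: continuous_intros)
  then have "continuous_on UNIV (delayed \<delta> w)"
    unfolding delayed_def by (rule continuous_trunc_comp)
  then show ?thesis by (rule borel_measurable_continuous_onI)
qed

lemma continuous_on_pot_half_line:
  assumes "h \<in> borel_measurable borel" "\<And>t. \<bar>h t\<bar> \<le> M"
  shows "continuous_on {0..} (pot h)"
  by (intro continuous_on_half_line continuous_on_pot[OF assms])

lemma continuous_on_iter: "continuous_on {0..} (iter \<delta> \<mu> k)"
proof (induction k)
  case (Suc k)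
  show ?case
    by (simp, intro continuous_intros continuous_on_pot_half_line[of _ 1] delayed_measurable Suc delayed_bounds)
qed auto

lemma iter_delayed_measurable: "delayed \<delta> (iter \<delta> \<mu> k) \<in> borel_measurable borel"
  by (intro delayed_measurable continuous_on_iter)

text \<open>The method of steps: the right-hand side at time \<open>t\<close> only sees the previous
  iterate up to \<open>t - \<delta>\<close>, so each iteration extends the interval on which nothing
  changes any more by \<open>\<delta>\<close>.\<close>

lemma iter_stable: "0 \<le> \<delta> \<Longrightarrow> 0 \<le> r \<Longrightarrow> r \<le> real k * \<delta> \<Longrightarrow> iter \<delta> \<mu> (Suc k) r = iter \<delta> \<mu> k r"
proof (induction k arbitrary: r)
  case (Suc k)
  have "pot (delayed \<delta> (iter \<delta> \<mu> (Suc k))) r = pot (delayed \<delta> (iter \<delta> \<mu> k)) r"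
  proof (rule pot_cong)
    fix t assume t: "t \<in> {0..r}"
    have "iter \<delta> \<mu> (Suc k) (max 0 (t - \<delta>)) = iter \<delta> \<mu> k (max 0 (t - \<delta>))"
      using t Suc.prems by (intro Suc.IH) (auto simp: algebra_simps)
    then show "delayed \<delta> (iter \<delta> \<mu> (Suc k)) t = delayed \<delta> (iter \<delta> \<mu> k) t"
      by (simp only: delayed_def)
  qed
  then show ?case by simp
qed auto

text \<open>Uniform continuity of \<open>trunc\<close> is enough, because the number
  \<open>k\<close> of iterations is fixed and no estimate has to be uniform in it; for the equation
  without delay a Lipschitz condition would be the natural requirement.\<close>

lemma iter_continuous_in_parameter:
  assumes \<delta>: "0 \<le> \<delta>" and \<mu>0: "0 \<le> \<mu>0" and e: "0 < e"
  shows "\<exists>d>0. \<forall>\<mu>. \<bar>\<mu> - \<mu>0\<bar> < d \<longrightarrow> (\<forall>r\<in>{0..R}. \<bar>iter \<delta> \<mu> k r - iter \<delta> \<mu>0 k r\<bar> < e)"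
  using e
proof (induction k arbitrary: e)
  case 0
  then show ?case by (intro exI[of _ 1]) auto
next
  case (Suc k)
  have R: "0 < R" using R0 by simp
  \<comment> \<open>A bound for \<open>pot\<close> on \<open>[0, R]\<close> with data bounded by
    \<open>1\<close>, made positive by the added \<open>1\<close>. The tolerance \<open>e\<close> is
    split evenly between the change of \<open>\<mu>\<close> and the change of the previous iterate,
    which explains \<open>e'\<close>.\<close>
  define K where "K = C * R * R + 1"
  have K: "0 < K" using C_nonneg R by (auto simp: K_def intro!: add_nonneg_pos)
  define e' where "e' = e / (2 * (\<mu>0 + 1) * K)"
  have e': "0 < e'" using Suc.prems \<mu>0 K by (simp add: e'_def)
  obtain d1 where d1: "0 < d1" "\<And>x y. \<bar>x - y\<bar> < d1 \<Longrightarrow> \<bar>trunc x - trunc y\<bar> < e'"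
    using trunc_uniformly_continuous[OF e'] by blast
  obtain d2 where d2: "0 < d2" "\<And>\<mu> r. \<bar>\<mu> - \<mu>0\<bar> < d2 \<Longrightarrow> r \<in> {0..R} \<Longrightarrow> \<bar>iter \<delta> \<mu> k r - iter \<delta> \<mu>0 k r\<bar> < d1"
    using Suc.IH[OF d1(1)] by blast
  show ?case
  proof (intro exI[of _ "min d2 (e / (2 * K))"] conjI allI impI ballI)
    show "0 < min d2 (e / (2 * K))" using d2 Suc.prems K by simp
    fix \<mu> r assume \<mu>: "\<bar>\<mu> - \<mu>0\<bar> < min d2 (e / (2 * K))" and r: "r \<in> {0..R}"
    let ?h = "delayed \<delta> (iter \<delta> \<mu> k)" and ?k = "delayed \<delta> (iter \<delta> \<mu>0 k)"
    have hh: "\<bar>?h t - ?k t\<bar> \<le> e'" if t: "t \<in> {0..R}" for t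
      unfolding delayed_def using t \<delta> \<mu> by (intro less_imp_le d1(2) d2(2)) auto
    have 1: "\<bar>pot ?h r - pot ?k r\<bar> \<le> C * e' * R * R"
      using r hh by (intro pot_diff_bound[where M=1] iter_delayed_measurable delayed_bounds) auto
    have 2: "\<bar>pot ?h r\<bar> \<le> C * R * R"
    proof -
      have "\<bar>pot ?h r - pot ?h 0\<bar> \<le> C * 1 * R * (r - 0)"
        using r by (intro pot_lipschitz iter_delayed_measurable delayed_bounds) auto
      also have "\<dots> \<le> C * 1 * R * R" using r C_nonneg by (intro mult_left_mono) auto
      finally show ?thesis by simp
    qed
    have eq: "iter \<delta> \<mu> (Suc k) r - iter \<delta> \<mu>0 (Suc k) r = - ((\<mu> - \<mu>0) * pot ?h r + \<mu>0 * (pot ?h r - pot ?k r))"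
      by (simp only: iter.simps) algebra
    have "\<bar>iter \<delta> \<mu> (Suc k) r - iter \<delta> \<mu>0 (Suc k) r\<bar>
        \<le> \<bar>\<mu> - \<mu>0\<bar> * \<bar>pot ?h r\<bar> + \<mu>0 * \<bar>pot ?h r - pot ?k r\<bar>"
      unfolding eq using abs_triangle_ineq[of "(\<mu> - \<mu>0) * pot ?h r" "\<mu>0 * (pot ?h r - pot ?k r)"] \<mu>0
      by (simp add: abs_mult)
    also have "\<dots> \<le> \<bar>\<mu> - \<mu>0\<bar> * K + \<mu>0 * (e' * K)"
    proof (intro add_mono mult_left_mono)
      show "\<bar>pot ?h r\<bar> \<le> K" using 2 by (simp add: K_def)
      have "C * e' * R * R \<le> e' * K" using e' by (simp add: K_def algebra_simps)
      then show "\<bar>pot ?h r - pot ?k r\<bar> \<le> e' * K" using 1 by linarith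
    qed (use \<mu>0 in auto)
    also have "\<dots> < e / (2 * K) * K + (\<mu>0 + 1) * (e' * K)"
      using \<mu> K e' \<mu>0 by (intro add_strict_mono mult_strict_right_mono) auto
    also have "\<dots> = e"
    proof -
      have "x * (e / (2 * x * K) * K) = e / 2" if "0 < x" for x using that K by simp
      from this[of "\<mu>0 + 1"] have a: "(\<mu>0 + 1) * (e' * K) = e / 2" unfolding e'_def using \<mu>0 by linarith
      have b: "e / (2 * K) * K = e / 2" using K by simp
      show ?thesis unfolding a b by simp
    qed
    finally show "\<bar>iter \<delta> \<mu> (Suc k) r - iter \<delta> \<mu>0 (Suc k) r\<bar> < e" .
  qed
qed

section \<open>The shooting function\<close>

lemma Inf_image_close:
  fixes f g :: "real \<Rightarrow> real"
  assumes S: "S \<noteq> {}" and bdd: "bdd_below (f ` S)" "bdd_below (g ` S)" and e: "\<And>x. x \<in> S \<Longrightarrow> \<bar>f x - g x\<bar> \<le> e"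
  shows "\<bar>Inf (f ` S) - Inf (g ` S)\<bar> \<le> e"
proof -
  have "Inf (f ` S) - e \<le> Inf (g ` S)"
  proof (rule cINF_greatest[OF S])
    fix x assume x: "x \<in> S"
    show "Inf (f ` S) - e \<le> g x" using cINF_lower[OF bdd(1) x] e[OF x] by simp
  qed
  moreover have "Inf (g ` S) - e \<le> Inf (f ` S)"
  proof (rule cINF_greatest[OF S])
    fix x assume x: "x \<in> S"
    show "Inf (g ` S) - e \<le> f x" using cINF_lower[OF bdd(2) x] e[OF x] by simp
  qed
  ultimately show ?thesis by simp
qed

text \<open>A zero of \<open>shoot\<close> is a nonnegative delayed solution that touches \<open>0\<close> or satisfies the Neumann condition.\<close>

definition shoot :: "real \<Rightarrow> nat \<Rightarrow> real \<Rightarrow> real" where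
  "shoot \<delta> k \<mu> = min (Inf (iter \<delta> \<mu> k ` {0..R})) (- flux (delayed \<delta> (iter \<delta> \<mu> k)) R)"

lemma iter_image_compact: "compact (iter \<delta> \<mu> k ` {0..R})" "iter \<delta> \<mu> k ` {0..R} \<noteq> {}" "bdd_below (iter \<delta> \<mu> k ` {0..R})"
proof -
  show "compact (iter \<delta> \<mu> k ` {0..R})"
    by (intro compact_continuous_image continuous_on_subset[OF continuous_on_iter]) auto
  then show "bdd_below (iter \<delta> \<mu> k ` {0..R})"
    by (intro bounded_imp_bdd_below compact_imp_bounded)
  show "iter \<delta> \<mu> k ` {0..R} \<noteq> {}" using R0 by auto
qed

lemma continuous_on_shoot:
  assumes \<delta>: "0 \<le> \<delta>"
  shows "continuous_on {0..} (shoot \<delta> k)"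
proof -
  have a: "continuous_on {0..} (\<lambda>\<mu>. Inf (iter \<delta> \<mu> k ` {0..R}))"
    unfolding continuous_on_iff
  proof (intro ballI allI impI)
    fix \<mu>0 e :: real assume \<mu>0: "\<mu>0 \<in> {0..}" and e: "0 < e"
    obtain d where d: "d > 0" "\<And>\<mu> r. \<bar>\<mu> - \<mu>0\<bar> < d \<Longrightarrow> r \<in> {0..R} \<Longrightarrow> \<bar>iter \<delta> \<mu> k r - iter \<delta> \<mu>0 k r\<bar> < e / 2"
      using iter_continuous_in_parameter[OF \<delta>, of \<mu>0 "e / 2" k] \<mu>0 e by auto
    show "\<exists>d>0. \<forall>\<mu>\<in>{0..}. dist \<mu> \<mu>0 < d \<longrightarrow> dist (Inf (iter \<delta> \<mu> k ` {0..R})) (Inf (iter \<delta> \<mu>0 k ` {0..R})) < e"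
    proof (intro exI[of _ d] conjI ballI impI)
      fix \<mu> assume "dist \<mu> \<mu>0 < d"
      then have "\<bar>Inf (iter \<delta> \<mu> k ` {0..R}) - Inf (iter \<delta> \<mu>0 k ` {0..R})\<bar> \<le> e / 2"
        using R0 by (intro Inf_image_close iter_image_compact less_imp_le d(2)) (auto simp: dist_real_def)
      then show "dist (Inf (iter \<delta> \<mu> k ` {0..R})) (Inf (iter \<delta> \<mu>0 k ` {0..R})) < e"
        using e by (simp add: dist_real_def)
    qed (use d in auto)
  qed
  have b: "continuous_on {0..} (\<lambda>\<mu>. flux (delayed \<delta> (iter \<delta> \<mu> k)) R)"
    unfolding continuous_on_iff
  proof (intro ballI allI impI)
    fix \<mu>0 e :: real assume \<mu>0: "\<mu>0 \<in> {0..}" and e: "0 < e"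
    define K where "K = C * R ^ m * R + 1"
    have K: "0 < K" using C_nonneg R0 by (auto simp: K_def intro!: add_nonneg_pos)
    have e': "0 < e / K" using e K by simp
    obtain d1 where d1: "0 < d1" "\<And>x y. \<bar>x - y\<bar> < d1 \<Longrightarrow> \<bar>trunc x - trunc y\<bar> < e / K"
      using trunc_uniformly_continuous[OF e'] by blast
    obtain d where d: "d > 0" "\<And>\<mu> r. \<bar>\<mu> - \<mu>0\<bar> < d \<Longrightarrow> r \<in> {0..R} \<Longrightarrow> \<bar>iter \<delta> \<mu> k r - iter \<delta> \<mu>0 k r\<bar> < d1"
      using iter_continuous_in_parameter[OF \<delta> _ d1(1), of \<mu>0 k] \<mu>0 by auto
    show "\<exists>d>0. \<forall>\<mu>\<in>{0..}. dist \<mu> \<mu>0 < d \<longrightarrow>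
       dist (flux (delayed \<delta> (iter \<delta> \<mu> k)) R) (flux (delayed \<delta> (iter \<delta> \<mu>0 k)) R) < e"
    proof (intro exI[of _ d] conjI ballI impI)
      fix \<mu> assume \<mu>: "dist \<mu> \<mu>0 < d"
      let ?h = "delayed \<delta> (iter \<delta> \<mu> k)" and ?k = "delayed \<delta> (iter \<delta> \<mu>0 k)"
      have hh: "\<bar>?h t - ?k t\<bar> \<le> e / K" if t: "t \<in> {0..R}" for t
        unfolding delayed_def using t \<delta> \<mu> by (intro less_imp_le d1(2) d(2)) (auto simp: dist_real_def)
      have "flux ?h R - flux ?k R = flux (\<lambda>t. ?h t - ?k t) R"
        by (intro flux_diff[where M=1] iter_delayed_measurable delayed_bounds)
      also have "\<bar>\<dots>\<bar> \<le> C * (e / K) * R ^ m * R"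
        using hh e' R0 iter_delayed_measurable by (intro flux_bound borel_measurable_diff) auto
      also have "\<dots> < e / K * K"
      proof -
        have "C * x * R ^ m * R < x * K" if "0 < x" for x using that by (simp add: K_def algebra_simps)
        then show ?thesis using e' by blast
      qed
      also have "\<dots> = e" using K by simp
      finally show "dist (flux ?h R) (flux ?k R) < e" by (simp add: dist_real_def)
    qed (use d in auto)
  qed
  show ?thesis unfolding shoot_def by (intro continuous_intros a b)
qed

lemma shoot_0_pos: "0 < shoot \<delta> k 0"
proof -
  have one: "iter \<delta> 0 k = (\<lambda>r. 1)" by (induction k) (auto simp: fun_eq_iff)
  have "(\<lambda>r::real. 1::real) ` {0..R} = {1}" using R0 by (simp add: image_constant_conv)
  moreover have "delayed \<delta> (\<lambda>r. 1) = (\<lambda>_. 1)" by (simp add: delayed_def fun_eq_iff trunc_def)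
  ultimately show ?thesis using total_neg by (simp add: shoot_def one)
qed

text \<open>A solution that stays positive decreases on \<open>[0, R0]\<close>, and a delayed value
  is an earlier, hence larger one; so the data are at least \<open>trunc (w r1) \<ge> w r1\<close>
  on \<open>[0, r1]\<close>. The drop from \<open>r1\<close> to \<open>R0\<close> is then more than
  \<open>w r1\<close>. The inequality \<open>x \<le> x powr q\<close> on \<open>[0, 1]\<close> is
  what makes the threshold for \<open>\<mu>\<close> independent of the unknown \<open>w r1\<close>
  and of the delay.\<close>

lemma shoot_nonpos:
  assumes \<delta>: "0 \<le> \<delta>" "R = real k * \<delta>" and r1: "0 \<le> r1" "r1 < R0" "0 < flux (\<lambda>_. 1) r1"
    and \<mu>: "0 \<le> \<mu>" "1 < \<mu> * (flux (\<lambda>_. 1) r1 * ((R0 - r1) / R0 ^ m))"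
  shows "shoot \<delta> k \<mu> \<le> 0"
proof (rule ccontr)
  assume "\<not> shoot \<delta> k \<mu> \<le> 0"
  then have "0 < Inf (iter \<delta> \<mu> k ` {0..R})" by (simp add: shoot_def)
  define w where "w = iter \<delta> \<mu> k"
  define h where "h = delayed \<delta> w"
  have w_pos: "0 < w r" if "r \<in> {0..R}" for r
    using cINF_lower[OF iter_image_compact(3) that, of \<delta> \<mu> k] \<open>0 < Inf _\<close> by (simp add: w_def)
  have hm: "h \<in> borel_measurable borel" unfolding h_def w_def by (rule iter_delayed_measurable)
  have hb: "\<bar>h t\<bar> \<le> 1" "0 \<le> h t" for t unfolding h_def by (rule delayed_bounds)+
  have weq: "w r = 1 - \<mu> * pot h r" if "r \<in> {0..R}" for r
    using iter_stable[OF \<delta>(1), of r k \<mu>] that \<delta>(2) by (simp add: w_def h_def)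
  have w_dec: "w s \<le> w r" if "0 \<le> r" "r \<le> s" "s \<le> R0" for r s
  proof -
    have "0 \<le> integral {r..s} (slope h)"
    proof (rule integral_nonneg)
      show "slope h integrable_on {r..s}"
        by (intro integrable_continuous_real continuous_on_subset[OF continuous_on_slope[OF hm hb(1), of s]])
           (use that in auto)
      fix x assume x: "x \<in> {r..s}"
      have "0 \<le> flux h x" using flux_mono_inner[OF hm hb, of 0 x] x that by simp
      then show "0 \<le> slope h x" using x that by (simp add: slope_def)
    qed
    then have "pot h r \<le> pot h s" using pot_split[OF hm hb(1), of r s] that by simp
    then have "\<mu> * pot h r \<le> \<mu> * pot h s" using \<mu>(1) by (rule mult_left_mono)
    then show ?thesis using weq[of r] weq[of s] that R0 by simp
  qed
  have w_0: "w 0 = 1" using weq[of 0] R0 by simp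
  have wr1: "0 < w r1" using w_pos[of r1] r1 R0 by simp
  have "w r1 \<le> h t" if t: "t \<in> {0..r1}" for t
  proof -
    have "w r1 \<le> trunc (w r1)" using w_dec[of 0 r1] wr1 w_0 r1 by (intro trunc_ge) auto
    also have "\<dots> \<le> h t"
      unfolding h_def delayed_def using t \<delta> r1 by (intro trunc_mono w_dec) auto
    finally show ?thesis .
  qed
  then have "w r1 * flux (\<lambda>_. 1) r1 \<le> flux h r1"
    using weighted_flux_ge[OF hm hb(1), of 0 r1 "w r1"] r1 by simp
  then have "w r1 * flux (\<lambda>_. 1) r1 * ((R0 - r1) / R0 ^ m) \<le> flux h r1 * ((R0 - r1) / R0 ^ m)"
    using r1 R0 by (intro mult_right_mono) auto
  also have "\<dots> \<le> pot h R0 - pot h r1"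
    using r1 by (intro pot_increment_inner[OF hm hb]) auto
  finally have "\<mu> * (w r1 * flux (\<lambda>_. 1) r1 * ((R0 - r1) / R0 ^ m)) \<le> \<mu> * (pot h R0 - pot h r1)"
    using \<mu>(1) by (rule mult_left_mono)
  also have "\<dots> = w r1 - w R0" using weq[of R0] weq[of r1] r1 R0 by (simp add: algebra_simps)
  also have "\<dots> < w r1" using w_pos[of R0] R0 by simp
  finally have "w r1 * (\<mu> * (flux (\<lambda>_. 1) r1 * ((R0 - r1) / R0 ^ m))) < w r1 * 1" by (simp add: mult_ac)
  then show False using \<mu>(2) by (simp only: mult_less_cancel_left_pos[OF wr1])
qed

text \<open>The bound \<open>L\<close> on the parameter is the same for all delays, which is needed
  for compactness. The delay is \<open>R\<close> divided by the number of iterations, so that the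
  iterate is an exact delayed solution on all of \<open>[0, R]\<close>.\<close>

lemma delayed_solution:
  obtains L where "0 \<le> L"
    "\<And>n. \<exists>\<mu> w. 0 \<le> \<mu> \<and> \<mu> \<le> L \<and> continuous_on {0..} w \<and>
        (\<forall>r\<in>{0..R}. w r = 1 - \<mu> * pot (delayed (R / real (Suc n)) w) r \<and> 0 \<le> w r) \<and>
        flux (delayed (R / real (Suc n)) w) R \<le> 0 \<and>
        ((\<exists>r\<in>{0..R}. w r = 0) \<or> flux (delayed (R / real (Suc n)) w) R = 0)"
proof -
  obtain r1 where r1: "0 \<le> r1" "r1 < R0" "0 < flux (\<lambda>_. 1) r1" by (rule inner_radius)
  define B where "B = flux (\<lambda>_. 1) r1 * ((R0 - r1) / R0 ^ m)"
  have B: "0 < B" using r1 R0 by (simp add: B_def)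
  define L where "L = 2 / B"
  have L: "0 \<le> L" "1 < L * B" using B by (auto simp: L_def)
  show thesis
  proof (rule that[OF L(1)])
    fix n
    define k where "k = Suc n"
    define \<delta> where "\<delta> = R / real k"
    have \<delta>: "0 \<le> \<delta>" "R = real k * \<delta>" using R0 by (auto simp: \<delta>_def k_def)
    have "\<exists>\<mu>. 0 \<le> \<mu> \<and> \<mu> \<le> L \<and> shoot \<delta> k \<mu> = 0"
      using shoot_nonpos[OF \<delta> r1 L(1)] L(2) shoot_0_pos[of \<delta> k] L(1)
      by (intro IVT2' continuous_on_subset[OF continuous_on_shoot[OF \<delta>(1)]]) (auto simp: B_def)
    then obtain \<mu> where \<mu>: "0 \<le> \<mu>" "\<mu> \<le> L" "shoot \<delta> k \<mu> = 0" by blast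
    define w where "w = iter \<delta> \<mu> k"
    have Inf0: "0 \<le> Inf (w ` {0..R})" and fl: "flux (delayed \<delta> w) R \<le> 0"
      and alt: "Inf (w ` {0..R}) = 0 \<or> flux (delayed \<delta> w) R = 0"
      using \<mu>(3) by (auto simp: shoot_def w_def min_def split: if_splits)
    have weq: "w r = 1 - \<mu> * pot (delayed \<delta> w) r" if "r \<in> {0..R}" for r
      using iter_stable[OF \<delta>(1), of r k \<mu>] that \<delta>(2) by (simp add: w_def)
    have w0: "0 \<le> w r" if "r \<in> {0..R}" for r
      using cINF_lower[OF iter_image_compact(3) that, of \<delta> \<mu> k] Inf0 by (simp add: w_def)
    \<comment> \<open>The infimum is attained, so its vanishing yields an actual zero.\<close>
    have "Inf (w ` {0..R}) \<in> w ` {0..R}"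
      unfolding w_def using iter_image_compact
      by (intro closed_contains_Inf compact_imp_closed)
    then have "(\<exists>r\<in>{0..R}. w r = 0) \<or> flux (delayed \<delta> w) R = 0" using alt by force
    moreover have "continuous_on {0..} w" unfolding w_def by (rule continuous_on_iter)
    ultimately show "\<exists>\<mu> w. 0 \<le> \<mu> \<and> \<mu> \<le> L \<and> continuous_on {0..} w \<and>
        (\<forall>r\<in>{0..R}. w r = 1 - \<mu> * pot (delayed (R / real (Suc n)) w) r \<and> 0 \<le> w r) \<and>
        flux (delayed (R / real (Suc n)) w) R \<le> 0 \<and>
        ((\<exists>r\<in>{0..R}. w r = 0) \<or> flux (delayed (R / real (Suc n)) w) R = 0)"
      using \<mu> weq w0 fl unfolding \<delta>_def k_def
      by (intro exI[of _ \<mu>] exI[of _ w] conjI ballI)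
  qed
qed

text \<open>No subsequence has to be chosen between the two alternatives. Once the limit is known to
  be bounded away from \<open>0\<close>, uniform convergence rules out zeros of late approximations,
  and a strictly negative limit flux would rule out the other alternative as well.\<close>

proposition radial_solution:
  obtains \<mu> w where "0 < \<mu>" "continuous_on UNIV w"
    "\<And>r. r \<in> {0..R} \<Longrightarrow> w r = 1 - \<mu> * pot (\<lambda>t. w t powr q) r"
    "\<And>r. 0 < w r" "\<And>r. w r \<le> 1"
    "flux (\<lambda>t. w t powr q) R = 0"
proof -
  have R: "0 < R" using R0 by simp
  obtain L where L: "0 \<le> L"
    and ex: "\<And>n. \<exists>\<mu> w. 0 \<le> \<mu> \<and> \<mu> \<le> L \<and> continuous_on {0..} w \<and>
        (\<forall>r\<in>{0..R}. w r = 1 - \<mu> * pot (delayed (R / real (Suc n)) w) r \<and> 0 \<le> w r) \<and>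
        flux (delayed (R / real (Suc n)) w) R \<le> 0 \<and>
        ((\<exists>r\<in>{0..R}. w r = 0) \<or> flux (delayed (R / real (Suc n)) w) R = 0)"
    using delayed_solution by metis
  define \<delta> where "\<delta> n = R / real (Suc n)" for n
  have \<delta>0: "0 \<le> \<delta> n" for n using R by (simp add: \<delta>_def)
  from ex obtain M W where MW: "\<And>n. 0 \<le> M n \<and> M n \<le> L \<and> continuous_on {0..} (W n) \<and>
        (\<forall>r\<in>{0..R}. W n r = 1 - M n * pot (delayed (\<delta> n) (W n)) r \<and> 0 \<le> W n r) \<and>
        flux (delayed (\<delta> n) (W n)) R \<le> 0 \<and>
        ((\<exists>r\<in>{0..R}. W n r = 0) \<or> flux (delayed (\<delta> n) (W n)) R = 0)"
    unfolding \<delta>_def by metis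
  have M: "0 \<le> M n" "M n \<le> L" and Wc: "continuous_on {0..} (W n)"
    and Weq: "\<And>r. r \<in> {0..R} \<Longrightarrow> W n r = 1 - M n * pot (delayed (\<delta> n) (W n)) r"
    and W0: "\<And>r. r \<in> {0..R} \<Longrightarrow> 0 \<le> W n r"
    and Wfl: "flux (delayed (\<delta> n) (W n)) R \<le> 0"
    and alt: "(\<exists>r\<in>{0..R}. W n r = 0) \<or> flux (delayed (\<delta> n) (W n)) R = 0" for n
    using MW[of n] by blast+
  have hm: "delayed (\<delta> n) (W n) \<in> borel_measurable borel" for n
    by (intro delayed_measurable Wc)
  define K where "K = L * (C * R)"
  have K: "0 \<le> K" using L C_nonneg R by (simp add: K_def)
  have lip: "\<bar>W n x - W n y\<bar> \<le> K * \<bar>x - y\<bar>" if "x \<in> {0..R}" "y \<in> {0..R}" for n x y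
  proof -
    have *: "\<bar>W n s - W n r\<bar> \<le> K * (s - r)" if rs: "0 \<le> r" "r \<le> s" "s \<le> R" for r s
    proof -
      have "\<bar>pot (delayed (\<delta> n) (W n)) s - pot (delayed (\<delta> n) (W n)) r\<bar> \<le> C * 1 * R * (s - r)"
        using rs by (intro pot_lipschitz hm delayed_bounds) auto
      then have "M n * \<bar>pot (delayed (\<delta> n) (W n)) s - pot (delayed (\<delta> n) (W n)) r\<bar> \<le> L * (C * 1 * R * (s - r))"
        using M[of n] by (intro mult_mono) auto
      moreover have "\<bar>W n s - W n r\<bar> = M n * \<bar>pot (delayed (\<delta> n) (W n)) s - pot (delayed (\<delta> n) (W n)) r\<bar>"
      proof -
        have "W n s - W n r = - (M n * (pot (delayed (\<delta> n) (W n)) s - pot (delayed (\<delta> n) (W n)) r))"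
          using Weq[of s n] Weq[of r n] rs by (simp add: algebra_simps)
        then show ?thesis using M(1)[of n] by (simp add: abs_mult)
      qed
      ultimately show ?thesis by (simp add: K_def mult_ac)
    qed
    show ?thesis
      using *[of x y] *[of y x] that by (cases "x \<le> y") (auto simp: abs_minus_commute)
  qed
  have W_0: "W n 0 = 1" for n using Weq[of 0 n] R by simp
  have Wbd: "norm (W n x) \<le> 1 + K * R" if "x \<in> {0..R}" for n x
  proof -
    have "\<bar>W n x - W n 0\<bar> \<le> K * \<bar>x - 0\<bar>" by (rule lip) (use that R in auto)
    also have "\<dots> \<le> K * R" using that K by (intro mult_left_mono) auto
    finally show ?thesis using W_0[of n] by simp
  qed
  have equicont: "\<exists>d. 0 < d \<and> (\<forall>n y. y \<in> {0..R} \<and> norm (x - y) < d \<longrightarrow> norm (W n x - W n y) < e)"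
    if x: "x \<in> {0..R}" and e: "0 < e" for x e
  proof (intro exI[of _ "e / (K + 1)"] conjI allI impI)
    show "0 < e / (K + 1)" using e K by simp
    fix n y assume y: "y \<in> {0..R} \<and> norm (x - y) < e / (K + 1)"
    have "\<bar>W n x - W n y\<bar> \<le> K * \<bar>x - y\<bar>" using x y by (intro lip) auto
    also have "\<dots> \<le> (K + 1) * \<bar>x - y\<bar>" by (intro mult_right_mono) auto
    also have "\<dots> < (K + 1) * (e / (K + 1))" using y K by (intro mult_strict_left_mono) auto
    also have "\<dots> = e" using K by simp
    finally show "norm (W n x - W n y) < e" by simp
  qed
  obtain w0 k where w0c: "continuous_on {0..R} w0" and k: "strict_mono (k :: nat \<Rightarrow> nat)"
    and conv: "\<And>e. 0 < e \<Longrightarrow> \<exists>N. \<forall>n x. n \<ge> N \<and> x \<in> {0..R} \<longrightarrow> norm (W (k n) x - w0 x) < e"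
    using Arzela_Ascoli[OF compact_Icc Wbd equicont] by metis
  have "compact {0..L}" by simp
  moreover have "\<forall>n. (M \<circ> k) n \<in> {0..L}" using M by auto
  ultimately obtain \<mu> l where \<mu>: "\<mu> \<in> {0..L}" and l: "strict_mono (l :: nat \<Rightarrow> nat)" and Ml: "((M \<circ> k) \<circ> l) \<longlonglongrightarrow> \<mu>"
    unfolding compact_def by metis
  define j where "j n = k (l n)" for n
  have jn: "n \<le> j n" for n
    unfolding j_def using seq_suble[OF l, of n] seq_suble[OF k, of "l n"] by linarith
  have Mj: "(\<lambda>n. M (j n)) \<longlonglongrightarrow> \<mu>" using Ml by (simp add: comp_def j_def)
  \<comment> \<open>Constant continuation beyond \<open>[0, R]\<close> makes continuity and
    positivity available on the whole line.\<close>
  define w where "w r = w0 (max 0 (min r R))" for r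
  have w_eq: "w r = w0 r" if "r \<in> {0..R}" for r using that by (simp add: w_def)
  have wc: "continuous_on UNIV w"
    unfolding w_def by (rule continuous_on_compose2[OF w0c]) (use R in \<open>auto intro!: continuous_intros\<close>)
  have convj: "\<exists>N. \<forall>n\<ge>N. \<forall>x\<in>{0..R}. \<bar>W (j n) x - w x\<bar> < e" if e: "0 < e" for e
  proof -
    obtain N where N: "\<And>n x. n \<ge> N \<Longrightarrow> x \<in> {0..R} \<Longrightarrow> norm (W (k n) x - w0 x) < e" using conv[OF e] by blast
    have "\<bar>W (j n) x - w x\<bar> < e" if "n \<ge> N" "x \<in> {0..R}" for n x
      using N[of "l n" x] that seq_suble[OF l, of n] w_eq[of x] by (simp add: j_def)
    then show ?thesis by blast
  qed
  have ptw: "(\<lambda>n. W (j n) x) \<longlonglongrightarrow> w x" if "x \<in> {0..R}" for x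
    using convj that unfolding LIMSEQ_iff by (metis real_norm_def)
  define h where "h t = trunc (w t)" for t
  have hc: "continuous_on UNIV h" unfolding h_def by (rule continuous_trunc_comp[OF wc])
  have hm': "h \<in> borel_measurable borel" using hc by (rule borel_measurable_continuous_onI)
  have hb: "\<bar>h t\<bar> \<le> 1" "0 \<le> h t" for t unfolding h_def using trunc_bounds by auto
  define H where "H n = delayed (\<delta> (j n)) (W (j n))" for n
  have Hm: "H n \<in> borel_measurable borel" and Hb: "\<bar>H n t\<bar> \<le> 1" for n t
    unfolding H_def by (rule hm, rule delayed_bounds)
  have Hconv: "\<exists>N. \<forall>n\<ge>N. \<forall>t\<in>{0..R}. \<bar>H n t - h t\<bar> \<le> e" if e: "0 < e" for e
  proof -
    obtain d where d: "0 < d" "\<And>x y. \<bar>x - y\<bar> < d \<Longrightarrow> \<bar>trunc x - trunc y\<bar> < e"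
      using trunc_uniformly_continuous[OF e] by blast
    obtain N1 where N1: "\<And>n x. n \<ge> N1 \<Longrightarrow> x \<in> {0..R} \<Longrightarrow> \<bar>W (j n) x - w x\<bar> < d / 2"
      using convj[OF half_gt_zero[OF d(1)]] by blast
    obtain N2 where N2: "2 * (K + 1) * R / d < real N2" using reals_Archimedean2 by blast
    have "\<bar>H n t - h t\<bar> \<le> e" if n: "n \<ge> max N1 N2" and t: "t \<in> {0..R}" for n t
    proof -
      let ?s = "max 0 (t - \<delta> (j n))"
      have s: "?s \<in> {0..R}" "\<bar>?s - t\<bar> \<le> \<delta> (j n)" using t \<delta>0[of "j n"] by auto
      have "real N2 \<le> real (Suc (j n))" using n jn[of n] by simp
      then have "2 * (K + 1) * R / d < real (Suc (j n))" using N2 by linarith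
      then have dl: "(K + 1) * \<delta> (j n) < d / 2"
        using d by (simp add: \<delta>_def field_simps)
      have "\<bar>W (j n) ?s - W (j n) t\<bar> \<le> K * \<bar>?s - t\<bar>" by (rule lip[OF s(1) t])
      also have "\<dots> \<le> (K + 1) * \<delta> (j n)" using s(2) K by (intro mult_mono) auto
      also have "\<dots> < d / 2" by (rule dl)
      finally have "\<bar>W (j n) ?s - w t\<bar> < d" using N1[of n t] n t by linarith
      then show ?thesis unfolding H_def h_def delayed_def by (intro less_imp_le d(2))
    qed
    then show ?thesis by blast
  qed
  have pot_conv: "(\<lambda>n. pot (H n) r) \<longlonglongrightarrow> pot h r" if r: "r \<in> {0..R}" for r
  proof (rule LIMSEQ_I)
    fix e :: real assume e: "0 < e"
    define K2 where "K2 = C * R * R + 1"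
    have K2: "0 < K2" using C_nonneg R by (auto simp: K2_def intro!: add_nonneg_pos)
    obtain N where N: "\<And>n t. n \<ge> N \<Longrightarrow> t \<in> {0..R} \<Longrightarrow> \<bar>H n t - h t\<bar> \<le> e / K2"
      using Hconv[OF divide_pos_pos[OF e K2]] by blast
    have "norm (pot (H n) r - pot h r) < e" if n: "n \<ge> N" for n
    proof -
      have "\<bar>pot (H n) r - pot h r\<bar> \<le> C * (e / K2) * R * R"
        using r N[OF n] by (intro pot_diff_bound[where M=1] Hm hm' Hb hb) auto
      also have "\<dots> = (C * R * R) * (e / K2)" by simp
      also have "\<dots> < K2 * (e / K2)" using e K2 by (intro mult_strict_right_mono) (auto simp: K2_def)
      also have "\<dots> = e" using K2 by simp
      finally show ?thesis by simp
    qed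
    then show "\<exists>N. \<forall>n\<ge>N. norm (pot (H n) r - pot h r) < e" by blast
  qed
  have flux_conv: "(\<lambda>n. flux (H n) R) \<longlonglongrightarrow> flux h R"
  proof (rule LIMSEQ_I)
    fix e :: real assume e: "0 < e"
    define K2 where "K2 = C * R ^ m * R + 1"
    have K2: "0 < K2" using C_nonneg R by (auto simp: K2_def intro!: add_nonneg_pos)
    obtain N where N: "\<And>n t. n \<ge> N \<Longrightarrow> t \<in> {0..R} \<Longrightarrow> \<bar>H n t - h t\<bar> \<le> e / K2"
      using Hconv[OF divide_pos_pos[OF e K2]] by blast
    have "norm (flux (H n) R - flux h R) < e" if n: "n \<ge> N" for n
    proof -
      have eq: "flux (H n) R - flux h R = flux (\<lambda>t. H n t - h t) R"
        by (intro flux_diff[where M=1] Hm hm' Hb hb)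
      have "\<bar>flux (H n) R - flux h R\<bar> \<le> C * (e / K2) * R ^ m * R"
        unfolding eq using R e K2 N[OF n] Hm hm' by (intro flux_bound borel_measurable_diff) auto
      also have "\<dots> = (C * R ^ m * R) * (e / K2)" by simp
      also have "\<dots> < K2 * (e / K2)" using e K2 by (intro mult_strict_right_mono) (auto simp: K2_def)
      also have "\<dots> = e" using K2 by simp
      finally show ?thesis by simp
    qed
    then show "\<exists>N. \<forall>n\<ge>N. norm (flux (H n) R - flux h R) < e" by blast
  qed
  have weq: "w r = 1 - \<mu> * pot h r" if r: "r \<in> {0..R}" for r
  proof (rule LIMSEQ_unique[OF ptw[OF r]])
    have "(\<lambda>n. 1 - M (j n) * pot (H n) r) \<longlonglongrightarrow> 1 - \<mu> * pot h r"
      by (intro tendsto_intros Mj pot_conv r)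
    then show "(\<lambda>n. W (j n) r) \<longlonglongrightarrow> 1 - \<mu> * pot h r"
      using Weq[OF r] by (simp add: H_def)
  qed
  have wnn: "0 \<le> w r" if "r \<in> {0..R}" for r
    by (rule LIMSEQ_le_const[OF ptw[OF that]]) (use W0 that in auto)
  have flh: "flux h R \<le> 0"
    by (rule LIMSEQ_le_const2[OF flux_conv]) (use Wfl in \<open>auto simp: H_def\<close>)
  \<comment> \<open>For \<open>\<mu> = 0\<close> the limit is the constant \<open>1\<close> with
    strictly negative flux, so late approximations would satisfy neither alternative.\<close>
  have \<mu>pos: "0 < \<mu>"
  proof (rule ccontr)
    assume "\<not> 0 < \<mu>"
    then have "\<mu> = 0" using \<mu> by simp
    then have w1: "w r = 1" if "r \<in> {0..R}" for r using weq[OF that] by simp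
    then have "flux h R = flux (\<lambda>_. 1) R" by (intro flux_cong) (simp add: h_def trunc_def)
    then have "flux h R < 0" using total_neg by simp
    then have ev: "\<forall>\<^sub>F n in sequentially. flux (H n) R < 0" using flux_conv by (simp add: order_tendsto_iff)
    obtain N where N: "\<And>n x. n \<ge> N \<Longrightarrow> x \<in> {0..R} \<Longrightarrow> \<bar>W (j n) x - w x\<bar> < 1" using convj[OF zero_less_one] by blast
    obtain n where n: "n \<ge> N" "flux (H n) R < 0"
      using eventually_happens'[OF sequentially_bot eventually_conj[OF eventually_ge_at_top[of N] ev]] by blast
    then obtain r where "r \<in> {0..R}" "W (j n) r = 0" using alt[of "j n"] by (auto simp: H_def)
    then show False using N[OF n(1), of r] w1[of r] by simp
  qed
  have wpos: "0 < w r" if "r \<in> {0..R}" for r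
  proof (rule ccontr)
    assume "\<not> 0 < w r"
    then have "w r = 0" using wnn[OF that] by simp
    then show False
      using no_dead_core[OF \<mu>pos wc weq[unfolded h_def[abs_def]] wnn flh[unfolded h_def[abs_def]] that] by blast
  qed
  have fl0: "flux h R = 0"
  proof (rule ccontr)
    assume "flux h R \<noteq> 0"
    then have "flux h R < 0" using flh by simp
    then have ev: "\<forall>\<^sub>F n in sequentially. flux (H n) R < 0" using flux_conv by (simp add: order_tendsto_iff)
    have "continuous_on {0..R} w" using wc by (rule continuous_on_subset) auto
    then obtain x0 where x0: "x0 \<in> {0..R}" "\<And>x. x \<in> {0..R} \<Longrightarrow> w x0 \<le> w x"
      using continuous_attains_inf[OF compact_Icc, of 0 R w] R by auto
    obtain N where N: "\<And>n x. n \<ge> N \<Longrightarrow> x \<in> {0..R} \<Longrightarrow> \<bar>W (j n) x - w x\<bar> < w x0"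
      using convj[OF wpos[OF x0(1)]] by blast
    obtain n where n: "n \<ge> N" "flux (H n) R < 0"
      using eventually_happens'[OF sequentially_bot eventually_conj[OF eventually_ge_at_top[of N] ev]] by blast
    then obtain r where "r \<in> {0..R}" "W (j n) r = 0" using alt[of "j n"] by (auto simp: H_def)
    then show False using N[OF n(1), of r] x0(2)[of r] by simp
  qed
  \<comment> \<open>The flux rises from \<open>0\<close> up to \<open>R0\<close> and then falls to
    its final value \<open>0\<close>, so it is nonnegative and \<open>w\<close> does not exceed
    \<open>w 0 = 1\<close>. This is what allows \<open>trunc\<close> to be replaced by the
    power.\<close>
  have wle: "w r \<le> 1" if r: "r \<in> {0..R}" for r
  proof -
    have "0 \<le> integral {0..r} (slope h)"
    proof (rule integral_nonneg)
      show "slope h integrable_on {0..r}"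
        by (intro integrable_continuous_real continuous_on_slope[OF hm' hb(1)])
      fix x assume x: "x \<in> {0..r}"
      have "0 \<le> flux h x"
      proof (cases "x \<le> R0")
        case True
        then show ?thesis using flux_mono_inner[OF hm' hb, of 0 x] x by simp
      next
        case False
        then show ?thesis using flux_antimono_outer[OF hm' hb, of x R] x r fl0 by simp
      qed
      then show "0 \<le> slope h x" using x by (simp add: slope_def)
    qed
    then show ?thesis using weq[OF r] \<mu>pos by (simp add: pot_def)
  qed
  have cl: "max 0 (min r R) \<in> {0..R}" for r using R by auto
  have w_cl: "w r = w (max 0 (min r R))" for r using R by (simp add: w_def)
  have all: "0 < w r" "w r \<le> 1" for r
    using wpos[OF cl[of r]] wle[OF cl[of r]] w_cl[of r] by simp_all
  then have "h = (\<lambda>t. w t powr q)" by (auto simp: h_def trunc_eq less_imp_le)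
  then show thesis using that[OF \<mu>pos wc _ all] weq fl0 by simp
qed

end

section \<open>Weak derivatives of radial vector fields\<close>

text \<open>Every difference quotient has integral \<open>0\<close> by translation invariance, and
  the Lipschitz bound supplies the dominating function. This takes the place of integration by parts
  for Lipschitz functions.\<close>

lemma integral_directional_derivative_eq_0:
  fixes P :: "'a::euclidean_space \<Rightarrow> real"
  assumes lip: "\<And>x y. \<bar>P x - P y\<bar> \<le> K * norm (x - y)" and K: "0 \<le> K"
    and supp: "\<And>x. \<rho> \<le> norm x \<Longrightarrow> P x = 0"
    and D: "D \<in> borel_measurable lebesgue"
    and lim: "AE x in lebesgue. (\<lambda>n. real (Suc n) * (P (x + inverse (real (Suc n)) *\<^sub>R e) - P x)) \<longlonglongrightarrow> D x"
  shows "(LINT x|lebesgue. D x) = 0"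
proof -
  have "continuous_on UNIV P"
  proof (rule lipschitz_on_continuous_on)
    show "K-lipschitz_on UNIV P" using lip K by (auto simp: lipschitz_on_def dist_norm dist_real_def)
  qed
  then have Pm [measurable]: "P \<in> borel_measurable borel" by (rule borel_measurable_continuous_onI)
  define Dn where "Dn n x = real (Suc n) * (P (x + inverse (real (Suc n)) *\<^sub>R e) - P x)" for n x
  \<comment> \<open>The translations have length at most \<open>norm e\<close>, so one enlarged ball
    contains the supports of all difference quotients.\<close>
  let ?B = "ball (0::'a) (\<rho> + norm e)"
  have Dn_bd: "\<bar>Dn n x\<bar> \<le> K * norm e" for n x
  proof -
    have "\<bar>P (x + inverse (real (Suc n)) *\<^sub>R e) - P x\<bar> \<le> K * (inverse (real (Suc n)) * norm e)"
      using lip[of "x + inverse (real (Suc n)) *\<^sub>R e" x] by simp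
    then have "real (Suc n) * \<bar>P (x + inverse (real (Suc n)) *\<^sub>R e) - P x\<bar>
        \<le> real (Suc n) * (K * (inverse (real (Suc n)) * norm e))"
      by (intro mult_left_mono) auto
    also have "\<dots> = K * norm e" by (simp add: field_simps)
    finally show ?thesis by (simp add: Dn_def abs_mult)
  qed
  have Dn_supp: "Dn n x = 0" if "x \<notin> ?B" for n x
  proof -
    have "norm x \<le> norm (x + inverse (real (Suc n)) *\<^sub>R e) + norm (inverse (real (Suc n)) *\<^sub>R e)"
      using norm_triangle_ineq4[of "x + inverse (real (Suc n)) *\<^sub>R e" "inverse (real (Suc n)) *\<^sub>R e"] by simp
    moreover have "norm (inverse (real (Suc n)) *\<^sub>R e) \<le> norm e"
      by (simp add: mult_left_le_one_le inverse_le_1_iff)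
    ultimately have "\<rho> \<le> norm (x + inverse (real (Suc n)) *\<^sub>R e)" using that by simp
    moreover have "\<rho> \<le> norm x" using that norm_ge_zero[of e] by (simp, linarith)
    ultimately show ?thesis by (simp add: Dn_def supp)
  qed
  have Dn_le: "norm (Dn n x) \<le> K * norm e * indicator ?B x" for n x
    using Dn_bd[of n x] Dn_supp[of x n] K by (cases "x \<in> ?B") auto
  have indint: "integrable lebesgue (\<lambda>x. K * norm e * indicator ?B x :: real)"
    by (intro integrable_mult_right integrable_real_indicator) (auto simp: emeasure_lborel_ball_finite[unfolded infinity_ennreal_def])
  have Dnm: "Dn n \<in> borel_measurable borel" for n unfolding Dn_def by measurable
  have "(\<lambda>n. LINT x|lebesgue. Dn n x) \<longlonglongrightarrow> (LINT x|lebesgue. D x)"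
  proof (rule integral_dominated_convergence[where w="\<lambda>x. K * norm e * indicator ?B x"])
    show "AE x in lebesgue. (\<lambda>n. Dn n x) \<longlonglongrightarrow> D x" using lim unfolding Dn_def .
    show "AE x in lebesgue. norm (Dn n x) \<le> K * norm e * indicator ?B x" for n using Dn_le by (intro AE_I2)
    show "Dn n \<in> borel_measurable lebesgue" for n using Dnm by (intro measurable_completion) simp
  qed (use D indint in auto)
  moreover have "(LINT x|lebesgue. Dn n x) = 0" for n
  proof -
    have Pbd: "norm (P x) \<le> K * (\<rho> + norm e + \<rho> + norm e) * indicator (ball 0 \<rho>) x" for x
    proof (cases "x \<in> ball 0 \<rho>")
      case True
      obtain b :: 'a where b: "b \<in> Basis" by (meson SOME_Basis)
      have r: "0 \<le> \<rho>" using True norm_ge_zero[of x] by (simp, linarith)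
      have "P (\<rho> *\<^sub>R b) = 0" using b r by (intro supp) simp
      then have "\<bar>P x\<bar> \<le> K * norm (x - \<rho> *\<^sub>R b)" using lip[of x "\<rho> *\<^sub>R b"] by simp
      also have "norm (x - \<rho> *\<^sub>R b) \<le> \<rho> + \<rho>"
        using norm_triangle_ineq4[of x "\<rho> *\<^sub>R b"] True b r by simp
      finally have "\<bar>P x\<bar> \<le> K * (\<rho> + \<rho>)" using K by (simp add: mult_left_mono)
      also have "\<dots> \<le> K * (\<rho> + norm e + \<rho> + norm e)" using K by (intro mult_left_mono) auto
      finally show ?thesis using True by simp
    qed (use supp in auto)
    have Pint: "integrable lborel P"
    proof (rule Bochner_Integration.integrable_bound)
      show "integrable lborel (\<lambda>x. K * (\<rho> + norm e + \<rho> + norm e) * indicator (ball (0::'a) \<rho>) x :: real)"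
        by (intro integrable_mult_right integrable_real_indicator) (auto simp: emeasure_lborel_ball_finite[unfolded infinity_ennreal_def])
      show "AE x in lborel. norm (P x) \<le> norm (K * (\<rho> + norm e + \<rho> + norm e) * indicator (ball (0::'a) \<rho>) x :: real)"
        using Pbd by (intro AE_I2) (smt (verit) real_norm_def)
    qed simp
    define c where "c = inverse (real (Suc n)) *\<^sub>R e"
    have tr: "distr lborel borel ((+) c) = lborel" by (rule lborel_distr_plus)
    have int': "integrable lborel (\<lambda>x. P (c + x))"
      using Pint by (subst (asm) tr[symmetric]) (simp add: integrable_distr_eq)
    have "(LINT x|lborel. P x) = (LINT x|distr lborel borel ((+) c). P x)" by (simp add: tr)
    also have "\<dots> = (LINT x|lborel. P (c + x))" by (subst integral_distr) auto
    finally have eq: "(LINT x|lborel. P (c + x)) = (LINT x|lborel. P x)" ..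
    have "(LINT x|lebesgue. Dn n x) = (LINT x|lborel. Dn n x)"
      using Dnm by (intro integral_completion) simp
    also have "\<dots> = (LINT x|lborel. real (Suc n) * (P (c + x) - P x))"
      by (simp add: Dn_def c_def add.commute)
    also have "\<dots> = real (Suc n) * ((LINT x|lborel. P (c + x)) - (LINT x|lborel. P x))"
      using int' Pint by simp
    finally show ?thesis using eq by simp
  qed
  ultimately show ?thesis by (simp add: LIMSEQ_const_iff)
qed

lemma has_derivative_difference_quotient:
  fixes P :: "'a::real_normed_vector \<Rightarrow> real"
  assumes "(P has_derivative P') (at x)"
  shows "(\<lambda>n. real (Suc n) * (P (x + inverse (real (Suc n)) *\<^sub>R e) - P x)) \<longlonglongrightarrow> P' e"
proof -
  have lin: "((\<lambda>t::real. x + t *\<^sub>R e) has_derivative (\<lambda>t. t *\<^sub>R e)) (at 0)"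
    by (auto intro!: derivative_eq_intros)
  have "((\<lambda>t. P (x + t *\<^sub>R e)) has_derivative (\<lambda>t. P' (t *\<^sub>R e))) (at 0)"
    by (rule has_derivative_compose[OF lin]) (use assms in simp)
  moreover have "(\<lambda>t. P' (t *\<^sub>R e)) = (*) (P' e)"
    using has_derivative_linear[OF assms] by (auto simp: fun_eq_iff linear_cmul mult.commute)
  ultimately have "((\<lambda>t. P (x + t *\<^sub>R e)) has_real_derivative P' e) (at 0)"
    by (simp add: has_field_derivative_def)
  then have "((\<lambda>h. (P (x + h *\<^sub>R e) - P x) / h) \<longlongrightarrow> P' e) (at 0)"
    by (simp add: DERIV_def)
  moreover have "filterlim (\<lambda>n. inverse (real (Suc n))) (at 0) sequentially"
    using LIMSEQ_inverse_real_of_nat by (simp add: filterlim_at)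
  ultimately have "(\<lambda>n. (P (x + inverse (real (Suc n)) *\<^sub>R e) - P x) / inverse (real (Suc n))) \<longlonglongrightarrow> P' e"
    by (rule filterlim_compose)
  then show ?thesis by (simp add: divide_inverse mult.commute)
qed

section \<open>Lebesgue differentiation on the line\<close>

lemma AE_right_derivative:
  fixes f :: "real \<Rightarrow> real"
  assumes int: "\<And>a b. f integrable_on {a..b}"
  obtains S where "negligible S"
    "\<And>x e. x \<notin> S \<Longrightarrow> 0 < e \<Longrightarrow> \<exists>d>0. \<forall>h. 0 < h \<and> h < d \<longrightarrow> \<bar>integral {x..x + h} f / h - f x\<bar> < e"
proof -
  have "f integrable_on cbox a b" for a b :: real using int by simp
  then obtain S where "negligible S"
       "\<And>x e. \<lbrakk>x \<notin> S; 0 < e\<rbrakk> \<Longrightarrow> \<exists>d>0. \<forall>h. 0 < h \<and> h < d \<longrightarrow>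
                norm (integral (cbox x (x + h *\<^sub>R One)) f /\<^sub>R h ^ DIM(real) - f x) < e"
    using integrable_ccontinuous_explicit[of f] by blast
  then show thesis by (intro that[of S]) (auto simp: divide_inverse mult.commute)
qed

text \<open>The left derivative is a right derivative of the reflected function
  \<open>\<lambda>t. f (- t)\<close>, so two exceptional sets are united, one of them reflected
  back. Only \<open>x > 0\<close> is treated because \<open>integral {0..u} f\<close> is zero for
  negative \<open>u\<close>.\<close>

lemma AE_derivative_indefinite_integral:
  fixes f :: "real \<Rightarrow> real"
  assumes int: "\<And>a b. f integrable_on {a..b}"
  obtains S where "negligible S"
    "\<And>x. 0 < x \<Longrightarrow> x \<notin> S \<Longrightarrow> ((\<lambda>u. integral {0..u} f) has_real_derivative f x) (at x)"
proof -
  obtain S where S: "negligible S"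
    "\<And>x e. x \<notin> S \<Longrightarrow> 0 < e \<Longrightarrow> \<exists>d>0. \<forall>h. 0 < h \<and> h < d \<longrightarrow> \<bar>integral {x..x + h} f / h - f x\<bar> < e"
    using AE_right_derivative[OF int] by blast
  have "(\<lambda>t. f (- t)) integrable_on {a..b}" for a b
    using int[of "- b" "- a"] by (subst Henstock_Kurzweil_Integration.integrable_reflect_real[symmetric]) simp
  from AE_right_derivative[OF this] obtain T where T: "negligible T"
    "\<And>x e. x \<notin> T \<Longrightarrow> 0 < e \<Longrightarrow> \<exists>d>0. \<forall>h. 0 < h \<and> h < d \<longrightarrow> \<bar>integral {x..x + h} (\<lambda>t. f (- t)) / h - f (- x)\<bar> < e"
    by blast
  have neg: "negligible (S \<union> uminus ` T)"
    using S(1) T(1) by (intro negligible_Un negligible_differentiable_image_negligible) (auto intro!: derivative_intros simp: differentiable_on_def)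
  show thesis
  proof (rule that[OF neg])
    fix x :: real assume x: "0 < x" "x \<notin> S \<union> uminus ` T"
    then have xS: "x \<notin> S" and xT: "- x \<notin> T" by (auto, metis imageI minus_minus)
    let ?G = "\<lambda>u. integral {0..u} f"
    have "((\<lambda>h. (?G (x + h) - ?G x) / h) \<longlongrightarrow> f x) (at 0)"
    proof (rule LIM_I)
      fix e :: real assume e: "0 < e"
      obtain d1 where d1: "d1 > 0" "\<And>h. 0 < h \<Longrightarrow> h < d1 \<Longrightarrow> \<bar>integral {x..x + h} f / h - f x\<bar> < e"
        using S(2)[OF xS e] by blast
      obtain d2 where d2: "d2 > 0" "\<And>h. 0 < h \<Longrightarrow> h < d2 \<Longrightarrow> \<bar>integral {- x..- x + h} (\<lambda>t. f (- t)) / h - f x\<bar> < e"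
        using T(2)[OF xT e] by auto
      show "\<exists>s>0. \<forall>h. h \<noteq> 0 \<and> norm (h - 0) < s \<longrightarrow> norm ((?G (x + h) - ?G x) / h - f x) < e"
      proof (intro exI[of _ "min x (min d1 d2)"] conjI allI impI)
        show "0 < min x (min d1 d2)" using x d1 d2 by simp
        fix h :: real assume h: "h \<noteq> 0 \<and> norm (h - 0) < min x (min d1 d2)"
        show "norm ((?G (x + h) - ?G x) / h - f x) < e"
        proof (cases "0 < h")
          case True
          have "?G x + integral {x..x + h} f = ?G (x + h)"
            using x True int by (intro Henstock_Kurzweil_Integration.integral_combine) auto
          then have "?G (x + h) - ?G x = integral {x..x + h} f" by simp
          then show ?thesis using d1(2)[of h] True h by simp
        next
          case False
          then have h': "0 < - h" "- h < d2" "- h < x" using h by auto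
          have "?G (x + h) + integral {x + h..x} f = ?G x"
            using x h' int by (intro Henstock_Kurzweil_Integration.integral_combine) auto
          moreover have "integral {- x..- x + - h} (\<lambda>t. f (- t)) = integral {x + h..x} f"
            using Henstock_Kurzweil_Integration.integral_reflect_real[of x "x + h" f] by (simp add: algebra_simps)
          ultimately have J: "integral {- x..- x + - h} (\<lambda>t. f (- t)) = ?G x - ?G (x + h)" by linarith
          have "(?G (x + h) - ?G x) / h = integral {- x..- x + - h} (\<lambda>t. f (- t)) / - h"
            unfolding J by (simp add: diff_divide_distrib)
          then show ?thesis using d2(2)[OF h'(1,2)] by simp
        qed
      qed
    qed
    then show "(?G has_real_derivative f x) (at x)" by (simp add: DERIV_def)
  qed
qed

section \<open>The gradient field of a radial potential and its Jacobian\<close>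

context bounded_coeff
begin

text \<open>This is \<open>p'(r) / r\<close> for \<open>p = pot (\<lambda>_. 1)\<close>, so
  \<open>radial_field\<close> represents the gradient of \<open>p(|x|)\<close>. Data
  \<open>1\<close> suffice because the power of the solution will be absorbed into the
  coefficient.\<close>

definition ratio :: "real \<Rightarrow> real" where
  "ratio r = flux (\<lambda>_. 1) r / r ^ Suc m"

definition radial_field :: "'a::real_inner \<Rightarrow> 'a" where
  "radial_field x = ratio (norm x) *\<^sub>R x"

text \<open>The a.e. Jacobian of \<open>radial_field\<close>; its values at \<open>0\<close> are junk.\<close>

definition radial_hess :: "'a::real_inner \<Rightarrow> 'a \<Rightarrow> 'a \<Rightarrow> real" where
  "radial_hess i j x = ratio (norm x) * (i \<bullet> j)
     + (\<beta> (norm x) - real (Suc m) * ratio (norm x)) * ((x \<bullet> i) / norm x) * ((x \<bullet> j) / norm x)"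

lemma ratio_0 [simp]: "ratio 0 = 0" by (simp add: ratio_def)

lemma ratio_bound: "0 \<le> r \<Longrightarrow> \<bar>ratio r\<bar> \<le> C"
proof (cases "r = 0")
  case False
  assume "0 \<le> r"
  then have r: "0 < r" using False by simp
  have "\<bar>flux (\<lambda>_. 1) r\<bar> \<le> C * 1 * r ^ m * r" using r by (intro flux_bound) auto
  then have "\<bar>flux (\<lambda>_. 1) r\<bar> / r ^ Suc m \<le> C * r ^ Suc m / r ^ Suc m"
    using r by (intro divide_right_mono) (auto simp: mult_ac)
  then show ?thesis using r by (simp add: ratio_def abs_divide)
qed (use C_nonneg in simp)

lemma power_diff_le:
  fixes r s :: real
  assumes "0 \<le> r" "r \<le> s"
  shows "s ^ Suc m - r ^ Suc m \<le> real (Suc m) * s ^ m * (s - r)"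
proof -
  have "s ^ Suc m - r ^ Suc m = (s - r) * (\<Sum>i<Suc m. s ^ i * r ^ (m - i))"
    using power_diff_sumr2[of s "Suc m" r] by (simp add: diff_Suc_Suc mult_ac)
  also have "\<dots> \<le> (s - r) * (\<Sum>i<Suc m. s ^ m)"
  proof (intro mult_left_mono sum_mono)
    fix i assume i: "i \<in> {..<Suc m}"
    have "s ^ i * r ^ (m - i) \<le> s ^ i * s ^ (m - i)" using assms by (intro mult_left_mono power_mono) auto
    also have "\<dots> = s ^ m" using i by (simp add: power_add[symmetric])
    finally show "s ^ i * r ^ (m - i) \<le> s ^ m" .
  qed (use assms in auto)
  finally show ?thesis by (simp add: mult_ac)
qed

text \<open>The function \<open>ratio\<close> need not be Lipschitz near \<open>0\<close>; the
  factor \<open>r\<close> repairs this. In the constant, \<open>m + 1\<close> comes from the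
  difference of the powers and \<open>1\<close> from the difference of the fluxes.\<close>

lemma ratio_diff_bound:
  assumes rs: "0 < r" "r \<le> s"
  shows "r * \<bar>ratio r - ratio s\<bar> \<le> C * (real m + 2) * (s - r)"
proof -
  let ?g = "flux (\<lambda>_. 1)"
  have s: "0 < s" using rs by simp
  have sp: "?g s - ?g r = integral {r..s} (\<lambda>t. t ^ m * (\<beta> t * 1))"
    using flux_split[of "\<lambda>_. 1" s 1 r] rs by simp
  have 1: "\<bar>?g s - ?g r\<bar> \<le> C * s ^ m * (s - r)"
    unfolding sp using weighted_integral_bound[of "\<lambda>_. 1" r s 1] rs by simp
  have "ratio r - ratio s = ratio r * ((s ^ Suc m - r ^ Suc m) / s ^ Suc m) - (?g s - ?g r) / s ^ Suc m"
    using rs s by (simp add: ratio_def field_simps)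
  then have "\<bar>ratio r - ratio s\<bar> \<le> \<bar>ratio r\<bar> * ((s ^ Suc m - r ^ Suc m) / s ^ Suc m) + \<bar>?g s - ?g r\<bar> / s ^ Suc m"
    using abs_triangle_ineq4[of "ratio r * ((s ^ Suc m - r ^ Suc m) / s ^ Suc m)" "(?g s - ?g r) / s ^ Suc m"] rs s
      power_mono[of r s "Suc m"]
    by (simp add: abs_mult abs_divide del: power_Suc)
  also have "\<dots> \<le> C * (real (Suc m) * s ^ m * (s - r) / s ^ Suc m) + C * s ^ m * (s - r) / s ^ Suc m"
    using ratio_bound[of r] power_diff_le[of r s] 1 rs s C_nonneg power_mono[of r s "Suc m"]
    by (intro add_mono mult_mono divide_right_mono) auto
  also have "\<dots> = C * (real m + 2) * (s - r) / s" using s by (simp add: field_simps)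
  finally have "r * \<bar>ratio r - ratio s\<bar> \<le> r * (C * (real m + 2) * (s - r) / s)"
    using rs by (intro mult_left_mono) auto
  also have "\<dots> \<le> s * (C * (real m + 2) * (s - r) / s)"
    using rs s C_nonneg by (intro mult_right_mono) auto
  also have "\<dots> = C * (real m + 2) * (s - r)" using s by simp
  finally show ?thesis .
qed

lemma radial_field_lipschitz:
  "norm (radial_field x - radial_field y) \<le> C * (real m + 3) * norm (x - y)"
proof -
  \<comment> \<open>The difference of the ratios is attached to the shorter vector, whose norm is
    the factor \<open>r\<close> in \<open>ratio_diff_bound\<close>.\<close>
  have *: "norm (radial_field x - radial_field y) \<le> C * (real m + 3) * norm (x - y)"
    if xy: "norm x \<le> norm y" for x y :: "'a"
  proof -
    have "radial_field x - radial_field y = (ratio (norm x) - ratio (norm y)) *\<^sub>R x + ratio (norm y) *\<^sub>R (x - y)"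
      by (simp add: radial_field_def algebra_simps)
    then have "norm (radial_field x - radial_field y)
        \<le> norm x * \<bar>ratio (norm x) - ratio (norm y)\<bar> + \<bar>ratio (norm y)\<bar> * norm (x - y)"
      using norm_triangle_ineq[of "(ratio (norm x) - ratio (norm y)) *\<^sub>R x" "ratio (norm y) *\<^sub>R (x - y)"]
      by (simp add: mult.commute)
    also have "\<dots> \<le> C * (real m + 2) * norm (x - y) + C * norm (x - y)"
    proof (rule add_mono)
      show "norm x * \<bar>ratio (norm x) - ratio (norm y)\<bar> \<le> C * (real m + 2) * norm (x - y)"
      proof (cases "x = 0")
        case False
        then have "norm x * \<bar>ratio (norm x) - ratio (norm y)\<bar> \<le> C * (real m + 2) * (norm y - norm x)"
          using xy by (intro ratio_diff_bound) auto
        also have "\<dots> \<le> C * (real m + 2) * norm (x - y)"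
          using C_nonneg norm_triangle_ineq2[of y x] by (intro mult_left_mono) (auto simp: norm_minus_commute)
        finally show ?thesis .
      qed (use C_nonneg in simp)
      show "\<bar>ratio (norm y)\<bar> * norm (x - y) \<le> C * norm (x - y)"
        by (intro mult_right_mono ratio_bound) auto
    qed
    finally show ?thesis by (simp add: algebra_simps)
  qed
  show ?thesis using *[of x y] *[of y x] by (cases "norm x \<le> norm y") (auto simp: norm_minus_commute)
qed

lemma norm_radial_field_le: "norm (radial_field x) \<le> C * norm x"
  unfolding radial_field_def using ratio_bound[of "norm x"] by (simp add: mult_right_mono)

lemma continuous_on_radial_field: "continuous_on S (radial_field :: 'a::real_inner \<Rightarrow> 'a)"
proof (rule lipschitz_on_continuous_on)
  show "(C * (real m + 3))-lipschitz_on S (radial_field :: 'a \<Rightarrow> 'a)"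
    using radial_field_lipschitz C_nonneg by (auto simp: lipschitz_on_def dist_norm)
qed

lemma abs_radial_hess_le:
  fixes i j x :: "'a::euclidean_space"
  assumes "i \<in> Basis" "j \<in> Basis"
  shows "\<bar>radial_hess i j x\<bar> \<le> C * (real m + 3)"
proof -
  have unit: "\<bar>(x \<bullet> k) / norm x\<bar> \<le> 1" if "k \<in> Basis" for k
    using Basis_le_norm[OF that, of x] by (cases "x = 0") (auto simp: field_simps)
  have "\<bar>\<beta> (norm x) - real (Suc m) * ratio (norm x)\<bar> \<le> \<bar>\<beta> (norm x)\<bar> + real (Suc m) * \<bar>ratio (norm x)\<bar>"
    using abs_triangle_ineq4[of "\<beta> (norm x)" "real (Suc m) * ratio (norm x)"] by (simp add: abs_mult)
  also have "\<dots> \<le> C + real (Suc m) * C"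
    by (intro add_mono mult_left_mono \<beta>_bound ratio_bound) auto
  finally have 1: "\<bar>\<beta> (norm x) - real (Suc m) * ratio (norm x)\<bar> \<le> C * (real m + 2)" by (simp add: algebra_simps)
  have ij: "\<bar>i \<bullet> j\<bar> \<le> 1" using assms by (auto simp: inner_Basis)
  have "\<bar>radial_hess i j x\<bar> \<le> \<bar>ratio (norm x)\<bar> * \<bar>i \<bullet> j\<bar>
      + \<bar>\<beta> (norm x) - real (Suc m) * ratio (norm x)\<bar> * \<bar>(x \<bullet> i) / norm x\<bar> * \<bar>(x \<bullet> j) / norm x\<bar>"
    unfolding radial_hess_def abs_mult[symmetric] by (rule abs_triangle_ineq)
  also have "\<dots> \<le> C * 1 + C * (real m + 2) * 1 * 1"
    using C_nonneg by (intro add_mono mult_mono 1 ij unit assms ratio_bound) auto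
  finally show ?thesis by (simp add: algebra_simps)
qed

lemma flux_measurable: "(\<lambda>x. flux (\<lambda>_. 1) (norm x)) \<in> borel_measurable (borel :: 'a::real_normed_vector measure)"
proof -
  have "continuous_on {0..} (flux (\<lambda>_. 1))"
    by (intro continuous_on_half_line continuous_on_flux[where M=1]) auto
  then have "continuous_on UNIV (\<lambda>x::'a. flux (\<lambda>_. 1) (norm x))"
    by (rule continuous_on_compose2) (auto intro!: continuous_intros)
  then show ?thesis by (rule borel_measurable_continuous_onI)
qed

lemma radial_hess_measurable:
  "radial_hess i j \<in> borel_measurable (borel :: 'a::euclidean_space measure)"
  using flux_measurable[where 'a = 'a] unfolding radial_hess_def ratio_def by measurable

lemma radial_hess_trace:
  fixes x :: "'a::euclidean_space"
  assumes m: "Suc m = DIM('a)" and x: "x \<noteq> 0"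
  shows "(\<Sum>i\<in>Basis. radial_hess i i x) = \<beta> (norm x)"
proof -
  have "(\<Sum>i\<in>Basis. ((x \<bullet> i) / norm x) * ((x \<bullet> i) / norm x)) = (\<Sum>i\<in>Basis. (x \<bullet> i) * (x \<bullet> i)) / (norm x * norm x)"
    by (simp add: sum_divide_distrib)
  also have "\<dots> = 1" using x by (simp add: euclidean_inner[symmetric] dot_square_norm power2_eq_square)
  finally have 1: "(\<Sum>i\<in>Basis. ((x \<bullet> i) / norm x) * ((x \<bullet> i) / norm x)) = 1" .
  have "(\<Sum>i\<in>Basis. radial_hess i i x) = (\<Sum>i\<in>(Basis::'a set). ratio (norm x))
      + (\<beta> (norm x) - real (Suc m) * ratio (norm x)) * (\<Sum>i\<in>Basis. ((x \<bullet> i) / norm x) * ((x \<bullet> i) / norm x))"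
    unfolding radial_hess_def by (simp add: sum.distrib sum_distrib_left mult.assoc inner_Basis)
  also have "\<dots> = \<beta> (norm x)" unfolding 1 using m by simp
  finally show ?thesis .
qed

text \<open>The chain rule at radii where the indefinite integral is differentiable; the null set of
  bad radii lifts to a null set in space, the same for all \<open>j\<close>.\<close>

lemma radial_field_AE_derivative:
  "AE x in lebesgue. \<forall>j. ((\<lambda>y. radial_field y \<bullet> j) has_derivative (\<lambda>h. radial_hess h j x)) (at (x::'a::euclidean_space))"
proof -
  let ?f = "\<lambda>t. t ^ m * (\<beta> t * 1)"
  obtain S where S: "negligible S"
    "\<And>r. 0 < r \<Longrightarrow> r \<notin> S \<Longrightarrow> ((\<lambda>u. integral {0..u} ?f) has_real_derivative ?f r) (at r)"
    using AE_derivative_indefinite_integral[of ?f] integrable_weighted[of "\<lambda>_. 1" _ _ 1] by auto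
  have "AE r in lborel. r \<notin> S"
    using S(1) AE_completion_iff[of "\<lambda>r. r \<notin> S" "lborel :: real measure"] by (simp add: negligible_iff_null_sets AE_not_in)
  then have "AE r in lborel. 0 < r \<longrightarrow> r \<notin> S" by eventually_elim simp
  then have 1: "AE x in lebesgue. norm (x::'a) \<notin> S" by (rule AE_norm)
  have 2: "AE x in lebesgue. x \<noteq> (0::'a)" by (rule AE_lebesgue_neq)
  show ?thesis using 1 2
  proof eventually_elim
    case (elim x)
    define r where "r = norm x"
    have r: "0 < r" using elim by (simp add: r_def)
    have g: "(flux (\<lambda>_. 1) has_real_derivative r ^ m * \<beta> r) (at r)"
      using S(2)[OF r] elim by (simp add: flux_def[abs_def] r_def)
    have "(ratio has_real_derivative (r ^ m * \<beta> r * r ^ Suc m - flux (\<lambda>_. 1) r * (real (Suc m) * r ^ m)) / (r ^ Suc m * r ^ Suc m)) (at r)"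
      unfolding ratio_def[abs_def] using r DERIV_divide[OF g DERIV_pow[of "Suc m" r]] by simp
    also have "(r ^ m * \<beta> r * r ^ Suc m - flux (\<lambda>_. 1) r * (real (Suc m) * r ^ m)) / (r ^ Suc m * r ^ Suc m)
        = (\<beta> r - real (Suc m) * ratio r) / r"
      using r by (simp add: ratio_def field_simps)
    finally have rd: "(ratio has_derivative (\<lambda>t. (\<beta> r - real (Suc m) * ratio r) / r * t)) (at (norm x))"
      unfolding r_def[symmetric] by (simp only: has_field_derivative_def)
    have nd: "(norm has_derivative (\<lambda>h. h \<bullet> sgn x)) (at x)" using elim by (intro has_derivative_norm) auto
    have cd: "((\<lambda>y. ratio (norm y)) has_derivative (\<lambda>h. (\<beta> r - real (Suc m) * ratio r) / r * (h \<bullet> sgn x))) (at x)"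
      by (rule has_derivative_compose[OF nd rd])
    show ?case
    proof
      fix j :: 'a
      have "((\<lambda>y. ratio (norm y) * (y \<bullet> j)) has_derivative
          (\<lambda>h. ratio (norm x) * (h \<bullet> j) + (\<beta> r - real (Suc m) * ratio r) / r * (h \<bullet> sgn x) * (x \<bullet> j))) (at x)"
        by (intro has_derivative_mult cd has_derivative_inner_left has_derivative_ident)
      also have "(\<lambda>h. ratio (norm x) * (h \<bullet> j) + (\<beta> r - real (Suc m) * ratio r) / r * (h \<bullet> sgn x) * (x \<bullet> j))
          = (\<lambda>h. radial_hess h j x)"
        by (auto simp: fun_eq_iff radial_hess_def r_def sgn_div_norm inner_commute divide_inverse mult_ac)
      finally show "((\<lambda>y. radial_field y \<bullet> j) has_derivative (\<lambda>h. radial_hess h j x)) (at x)"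
        by (simp add: radial_field_def)
    qed
  qed
qed

text \<open>The product of a component of the field with \<open>\<phi>\<close> is Lipschitz and
  vanishes off the ball. The integral of its derivative in direction \<open>i\<close>, known almost
  everywhere from the product rule, is therefore \<open>0\<close>.\<close>

lemma radial_field_weak_derivative:
  fixes i j :: "'a::euclidean_space"
  assumes ij: "i \<in> Basis" "j \<in> Basis" and test: "c1c_test (ball 0 R) \<phi> G"
  shows "(LINT x:ball 0 R|lebesgue. (radial_field x \<bullet> j) * (G x \<bullet> i))
           = - (LINT x:ball 0 R|lebesgue. radial_hess i j x * \<phi> x)"
proof -
  have G: "continuous_on UNIV G" and d\<phi>: "\<And>x. (\<phi> has_derivative (\<lambda>h. G x \<bullet> h)) (at x)"
    and cs: "compact (closure {x. \<phi> x \<noteq> 0})" "closure {x. \<phi> x \<noteq> 0} \<subseteq> ball 0 R"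
    using test by (auto simp: c1c_test_def)
  have \<phi>0: "\<phi> x = 0" if "x \<notin> ball 0 R" for x
    using that cs(2) closure_subset[of "{x. \<phi> x \<noteq> 0}"] by auto
  have G0: "G x = 0" if "x \<notin> ball 0 R" for x
  proof -
    let ?O = "- closure {x. \<phi> x \<noteq> 0}"
    have x: "x \<in> ?O" "open ?O" using that cs by auto
    have z: "0 = \<phi> y" if "y \<in> ?O" for y using that closure_subset[of "{x. \<phi> x \<noteq> 0}"] by auto
    have "((\<lambda>_. 0) has_derivative (\<lambda>h. 0)) (at x)" by simp
    then have "(\<phi> has_derivative (\<lambda>h. 0)) (at x)"
      by (rule has_derivative_transform_within_open[OF _ x(2,1)]) (rule z)
    then have "(\<lambda>h. G x \<bullet> h) = (\<lambda>h. 0)" by (rule has_derivative_unique[OF d\<phi>])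
    then have "G x \<bullet> G x = 0" by meson
    then show ?thesis by simp
  qed
  have c\<phi>: "continuous_on UNIV \<phi>"
    using d\<phi> by (intro continuous_at_imp_continuous_on) (auto intro: has_derivative_continuous)
  have "bounded (G ` cball 0 R)" "bounded (\<phi> ` cball 0 R)"
    by (intro compact_imp_bounded compact_continuous_image continuous_on_subset[OF G] continuous_on_subset[OF c\<phi>]; simp)+
  then obtain B1 B2 where B1: "\<And>x. x \<in> cball 0 R \<Longrightarrow> norm (G x) \<le> B1" and B2: "\<And>x. x \<in> cball 0 R \<Longrightarrow> \<bar>\<phi> x\<bar> \<le> B2"
    by (metis bounded_iff imageI real_norm_def)
  define B where "B = max 0 (max B1 B2)"
  have B: "0 \<le> B" "norm (G x) \<le> B" "\<bar>\<phi> x\<bar> \<le> B" for x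
    using B1[of x] B2[of x] G0[of x] \<phi>0[of x] by (cases "x \<in> ball 0 R"; auto simp: B_def le_max_iff_disj)+
  have \<phi>lip: "\<bar>\<phi> x - \<phi> y\<bar> \<le> B * norm (x - y)" for x y
  proof -
    have "norm (\<phi> x - \<phi> y) \<le> B * norm (x - y)"
    proof (rule differentiable_bound[of UNIV])
      fix z :: 'a
      show "(\<phi> has_derivative (\<lambda>h. G z \<bullet> h)) (at z within UNIV)" using d\<phi> by simp
      show "onorm (\<lambda>h. G z \<bullet> h) \<le> B"
      proof (rule onorm_le)
        fix h :: 'a
        have "norm (G z \<bullet> h) \<le> norm (G z) * norm h" using Cauchy_Schwarz_ineq2 by simp
        also have "\<dots> \<le> B * norm h" by (intro mult_right_mono B) simp
        finally show "norm (G z \<bullet> h) \<le> B * norm h" .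
      qed
    qed auto
    then show ?thesis by simp
  qed
  define P where "P x = (radial_field x \<bullet> j) * \<phi> x" for x
  define D where "D x = (radial_field x \<bullet> j) * (G x \<bullet> i) + radial_hess i j x * \<phi> x" for x
  define K where "K = C * R * B + C * (real m + 3) * B"
  have Fj: "\<bar>radial_field x \<bullet> j\<bar> \<le> C * norm x" for x :: 'a
    using Basis_le_norm[OF ij(2), of "radial_field x"] norm_radial_field_le[of x] by linarith
  have FjR: "\<bar>radial_field x \<bullet> j\<bar> \<le> C * R" if "x \<in> ball 0 R" for x :: 'a
    using Fj[of x] that C_nonneg mult_left_mono[of "norm x" R C] by simp
  have Fjlip: "\<bar>radial_field x \<bullet> j - radial_field y \<bullet> j\<bar> \<le> C * (real m + 3) * norm (x - y)" for x y :: 'a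
    using Basis_le_norm[OF ij(2), of "radial_field x - radial_field y"] radial_field_lipschitz[of x y]
    by (simp add: inner_diff_left)
  \<comment> \<open>Only \<open>x\<close> has to lie in the ball: the size of the field enters at
    \<open>x\<close> alone, and the other bounds are global.\<close>
  have Plip0: "\<bar>P x - P y\<bar> \<le> K * norm (x - y)" if x: "x \<in> ball 0 R" for x y
  proof -
    have "P x - P y = (radial_field x \<bullet> j) * (\<phi> x - \<phi> y) + (radial_field x \<bullet> j - radial_field y \<bullet> j) * \<phi> y"
      by (simp add: P_def algebra_simps)
    then have "\<bar>P x - P y\<bar> \<le> \<bar>radial_field x \<bullet> j\<bar> * \<bar>\<phi> x - \<phi> y\<bar> + \<bar>radial_field x \<bullet> j - radial_field y \<bullet> j\<bar> * \<bar>\<phi> y\<bar>"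
      by (metis abs_mult abs_triangle_ineq)
    also have "\<dots> \<le> C * R * (B * norm (x - y)) + C * (real m + 3) * norm (x - y) * B"
      using C_nonneg order_trans[OF abs_ge_zero FjR[OF x]]
      by (intro add_mono mult_mono FjR[OF x] Fjlip \<phi>lip B) auto
    finally show ?thesis by (simp add: K_def algebra_simps)
  qed
  \<comment> \<open>No sign of \<open>R\<close> is assumed here, so \<open>K\<close> could be
    negative; hence the maximum with \<open>0\<close>.\<close>
  have Plip: "\<bar>P x - P y\<bar> \<le> max 0 K * norm (x - y)" for x y
  proof -
    have m: "K * norm (x - y) \<le> max 0 K * norm (x - y)" by (intro mult_right_mono) auto
    consider "x \<in> ball 0 R" | "y \<in> ball 0 R" | "x \<notin> ball 0 R" "y \<notin> ball 0 R" by blast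
    then show ?thesis
    proof cases
      case 1 then show ?thesis using Plip0[of x y] m by linarith
    next
      case 2 then show ?thesis using Plip0[of y x] m by (simp add: abs_minus_commute norm_minus_commute)
    next
      case 3 then show ?thesis by (simp add: P_def \<phi>0)
    qed
  qed
  have mG: "(\<lambda>x. (radial_field x \<bullet> j) * (G x \<bullet> i)) \<in> borel_measurable borel"
    by (intro borel_measurable_continuous_onI continuous_intros continuous_on_radial_field G)
  have mH: "(\<lambda>x. radial_hess i j x * \<phi> x) \<in> borel_measurable borel"
    by (intro borel_measurable_times radial_hess_measurable borel_measurable_continuous_onI c\<phi>)
  have "AE x in lebesgue. (\<lambda>n. real (Suc n) * (P (x + inverse (real (Suc n)) *\<^sub>R i) - P x)) \<longlonglongrightarrow> D x"
    using radial_field_AE_derivative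
  proof eventually_elim
    case (elim x)
    have "(P has_derivative (\<lambda>h. (radial_field x \<bullet> j) * (G x \<bullet> h) + radial_hess h j x * \<phi> x)) (at x)"
      unfolding P_def by (rule has_derivative_mult[OF elim[rule_format] d\<phi>])
    from has_derivative_difference_quotient[OF this, of i] show ?case by (simp add: D_def)
  qed
  then have "(LINT x|lebesgue. D x) = 0"
    using mG mH Plip unfolding D_def
    by (intro integral_directional_derivative_eq_0[where P = P and K = "max 0 K" and \<rho> = R and e = i]
        measurable_completion borel_measurable_add)
       (auto simp: P_def \<phi>0)
  moreover have "(LINT x|lebesgue. D x) = (LINT x:ball 0 R|lebesgue. (radial_field x \<bullet> j) * (G x \<bullet> i) + radial_hess i j x * \<phi> x)"
    unfolding set_lebesgue_integral_def by (rule Bochner_Integration.integral_cong) (auto simp: D_def indicator_def \<phi>0 G0)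
  moreover have "set_integrable lebesgue (ball 0 R) (\<lambda>x. (radial_field x \<bullet> j) * (G x \<bullet> i))"
    unfolding set_integrable_def
  proof (rule integrableI_bounded_set_indicator[where B = "C * R * B"])
    show "AE x in lebesgue. x \<in> ball 0 R \<longrightarrow> norm ((radial_field x \<bullet> j) * (G x \<bullet> i)) \<le> C * R * B"
    proof (intro AE_I2 impI)
      fix x :: 'a assume x: "x \<in> ball 0 R"
      have "\<bar>G x \<bullet> i\<bar> \<le> B" using Basis_le_norm[OF ij(1), of "G x"] B(2)[of x] by linarith
      moreover have "0 \<le> R" using x norm_ge_zero[of x] by (simp, linarith)
      ultimately show "norm ((radial_field x \<bullet> j) * (G x \<bullet> i)) \<le> C * R * B"
        unfolding real_norm_def abs_mult using FjR[OF x] C_nonneg by (intro mult_mono) auto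
    qed
  qed (use mG in \<open>auto simp: emeasure_lborel_ball_finite[unfolded infinity_ennreal_def] intro!: measurable_completion\<close>)
  moreover have "set_integrable lebesgue (ball 0 R) (\<lambda>x. radial_hess i j x * \<phi> x)"
    unfolding set_integrable_def
  proof (rule integrableI_bounded_set_indicator[where B = "C * (real m + 3) * B"])
    show "AE x in lebesgue. x \<in> ball 0 R \<longrightarrow> norm (radial_hess i j x * \<phi> x) \<le> C * (real m + 3) * B"
      unfolding real_norm_def abs_mult using C_nonneg
      by (intro AE_I2 impI mult_mono abs_radial_hess_le ij B) auto
  qed (use mH in \<open>auto simp: emeasure_lborel_ball_finite[unfolded infinity_ennreal_def] intro!: measurable_completion\<close>)
  ultimately show ?thesis by (simp add: set_integral_add)
qed

end

section \<open>Existence\<close>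

lemma set_lebesgue_integral_radial:
  fixes f :: "real \<Rightarrow> real" and g :: "'a::euclidean_space \<Rightarrow> real"
  assumes f: "f \<in> borel_measurable borel" "\<And>r. \<bar>f r\<bar> \<le> C" "\<And>r. r > \<rho> \<Longrightarrow> f r = 0"
    and g: "g \<in> borel_measurable lebesgue" and S: "S \<in> sets lebesgue"
    and eq: "AE x in lebesgue. x \<in> S \<longrightarrow> g x = f (norm x)" and out: "\<And>x. x \<notin> S \<Longrightarrow> f (norm x) = 0"
  shows "(LINT x:S|lebesgue. g x)
     = DIM('a) * unit_ball_vol DIM('a) * integral {0..\<rho>} (\<lambda>r. r ^ (DIM('a) - 1) * f r)"
proof -
  have "(LINT x:S|lebesgue. g x) = (LINT x|lebesgue. f (norm (x::'a)))"
    unfolding set_lebesgue_integral_def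
  proof (rule Bochner_Integration.integral_cong_AE)
    show "(\<lambda>x. indicator S x *\<^sub>R g x) \<in> borel_measurable lebesgue" using g S by measurable
    have "(\<lambda>x::'a. f (norm x)) \<in> borel_measurable borel" using f(1) by measurable
    then show "(\<lambda>x::'a. f (norm x)) \<in> borel_measurable lebesgue" by (intro measurable_completion) simp
    show "AE x in lebesgue. indicator S x *\<^sub>R g x = f (norm x)"
      using eq by eventually_elim (use out in \<open>auto simp: indicator_def\<close>)
  qed
  then show ?thesis using integral_norm[OF f] by simp
qed

text \<open>Scaling \<open>w\<close> by \<open>\<tau>\<close> with
  \<open>\<tau> powr q = \<tau> * \<mu>\<close> removes the shooting parameter, which is possible
  because \<open>q \<noteq> 1\<close>.\<close>

lemma radial_coeff_pos_sol:
  fixes a :: "'a::euclidean_space \<Rightarrow> real"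
  assumes rc: "radial_coeff \<beta> C (DIM('a) - 1) R R0 q"
    and a: "AE x in lebesgue. x \<in> ball 0 R \<longrightarrow> a x = \<beta> (norm x)"
  shows "\<exists>u. pos_sol_ball R a q u"
proof -
  define m where "m = DIM('a) - 1"
  interpret radial_coeff \<beta> C m R R0 q using rc by (simp add: m_def)
  have m: "Suc m = DIM('a)" using DIM_positive[where 'a='a] by (simp add: m_def)
  have R: "0 < R" using R0 by simp
  obtain \<mu> w where \<mu>: "0 < \<mu>" and wc: "continuous_on UNIV w"
    and weq: "\<And>r. r \<in> {0..R} \<Longrightarrow> w r = 1 - \<mu> * pot (\<lambda>t. w t powr q) r"
    and wpos: "\<And>r. 0 < w r" and wle: "\<And>r. w r \<le> 1"
    and fl: "flux (\<lambda>t. w t powr q) R = 0"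
    using radial_solution by blast
  define h where "h t = w t powr q" for t
  have h01: "0 \<le> h t" "h t \<le> 1" "\<bar>h t\<bar> \<le> 1" for t
    unfolding h_def using wpos[of t] wle[of t] q by (auto simp: powr_le1 less_imp_le)
  have hm [measurable]: "h \<in> borel_measurable borel"
    unfolding h_def using wpos
    by (intro borel_measurable_continuous_onI continuous_intros wc) (metis less_irrefl)
  \<comment> \<open>In this second instance the semilinear equation becomes linear with a bounded
    coefficient, so the results on \<open>radial_field\<close> apply with data
    \<open>1\<close>.\<close>
  interpret S: bounded_coeff "\<lambda>t. \<beta> t * h t" C m
  proof
    show "(\<lambda>t. \<beta> t * h t) \<in> borel_measurable borel" by measurable
    show "\<bar>\<beta> r * h r\<bar> \<le> C" for r
      using mult_mono[OF \<beta>_bound[of r] h01(3)[of r]] C_nonneg by (simp add: abs_mult)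
  qed
  have flux_eq: "S.flux (\<lambda>_. 1) s = flux h s" for s by (simp add: S.flux_def flux_def)
  have flh: "flux h R = 0" using fl by (simp add: h_def[abs_def])
  define \<tau> where "\<tau> = \<mu> powr (- 1 / (1 - q))"
  have \<tau>: "0 < \<tau>" using \<mu> by (simp add: \<tau>_def)
  have "- 1 / (1 - q) * (q - 1) = 1" using q by (simp add: divide_simps)
  then have "\<tau> powr (q - 1) = \<mu>"
    using \<mu> by (simp only: \<tau>_def powr_powr powr_one)
  then have \<tau>q: "\<tau> powr q = \<tau> * \<mu>"
    using \<tau> powr_add[of \<tau> "q - 1" 1] by simp
  \<comment> \<open>Written with \<open>pot\<close> instead of \<open>w\<close>: both agree on the
    closed ball, but this formula is differentiable across the sphere, while \<open>w\<close> comes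
    without an equation beyond \<open>R\<close>.\<close>
  define u where "u x = \<tau> * (1 - \<mu> * pot h (norm x))" for x :: 'a
  define Du where "Du x = - (\<tau> * \<mu>) *\<^sub>R S.radial_field x" for x :: 'a
  define H where "H i j x = - (\<tau> * \<mu>) * S.radial_hess i j x" for i j x :: 'a
  have u_eq: "u x = \<tau> * w (norm x)" if "x \<in> cball 0 R" for x
    using weq[of "norm x"] that by (simp add: u_def h_def[abs_def])
  have du: "(u has_derivative (\<lambda>v. Du x \<bullet> v)) (at x within cball 0 R)" for x
  proof (rule has_derivative_at_withinI, cases "x = 0")
    case True
    have "(u has_derivative (\<lambda>v. 0)) (at 0)"
    \<comment> \<open>The norm is not differentiable at \<open>0\<close>, so the chain rule is
      replaced by the quadratic bound on \<open>pot\<close> near \<open>0\<close>.\<close>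
    proof (rule has_derivativeI_sandwich[where e=1 and H="\<lambda>y. \<tau> * \<mu> * C * norm y"])
      fix y :: 'a assume y: "y \<noteq> 0"
      have "\<bar>pot h (norm y) - pot h 0\<bar> \<le> C * 1 * norm y * (norm y - 0)"
        by (intro pot_lipschitz hm h01) auto
      then have "\<tau> * \<mu> * \<bar>pot h (norm y)\<bar> \<le> \<tau> * \<mu> * (C * norm y * norm y)"
        using \<tau> \<mu> by (intro mult_left_mono) auto
      moreover have "u y - u 0 = - (\<tau> * \<mu> * pot h (norm y))" by (simp add: u_def algebra_simps)
      ultimately have "\<bar>u y - u 0\<bar> \<le> \<tau> * \<mu> * C * norm y * norm y"
        using \<tau> \<mu> by (simp add: abs_mult mult_ac)
      then show "norm (u y - u 0 - 0) / norm (y - 0) \<le> \<tau> * \<mu> * C * norm y"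
        using y by (simp add: divide_le_eq)
    qed (auto intro!: tendsto_eq_intros)
    moreover have "Du x = 0" using True by (simp add: Du_def S.radial_field_def)
    ultimately show "(u has_derivative (\<lambda>v. Du x \<bullet> v)) (at x)" using True by simp
  next
    case False
    have nd: "(norm has_derivative (\<lambda>h. h \<bullet> sgn x)) (at x)" using False by (rule has_derivative_norm)
    have "(pot h has_real_derivative slope h (norm x)) (at (norm x))"
      by (rule pot_has_derivative[OF hm h01(3), where X = "norm x + 1"]) (use False in auto)
    from has_derivative_compose[OF nd this[unfolded has_field_derivative_def]]
    have "((\<lambda>y. pot h (norm y)) has_derivative (\<lambda>v. slope h (norm x) * (v \<bullet> sgn x))) (at x)" .
    then have "(u has_derivative (\<lambda>v. \<tau> * (0 - \<mu> * (slope h (norm x) * (v \<bullet> sgn x))))) (at x)"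
      unfolding u_def by (intro has_derivative_mult_right has_derivative_diff has_derivative_const)
    also have "(\<lambda>v. \<tau> * (0 - \<mu> * (slope h (norm x) * (v \<bullet> sgn x)))) = (\<lambda>v. Du x \<bullet> v)"
      using False
      by (auto simp: fun_eq_iff Du_def S.radial_field_def S.ratio_def flux_eq slope_def sgn_div_norm inner_commute field_simps)
    finally show "(u has_derivative (\<lambda>v. Du x \<bullet> v)) (at x)" .
  qed
  \<comment> \<open>The second derivatives are bounded, so any integrability exponent above the
    dimension is available; \<open>N + 1\<close> is taken.\<close>
  have hess: "H i j \<in> borel_measurable lebesgue \<and>
          set_integrable lebesgue (ball 0 R) (\<lambda>x. \<bar>H i j x\<bar> powr (real DIM('a) + 1)) \<and>
          (\<forall>\<phi> G. c1c_test (ball 0 R) \<phi> G \<longrightarrow>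
             (LINT x:ball 0 R|lebesgue. (Du x \<bullet> j) * (G x \<bullet> i))
               = - (LINT x:ball 0 R|lebesgue. H i j x * \<phi> x))"
    if ij: "i \<in> Basis" "j \<in> Basis" for i j
  proof (intro conjI allI impI)
    have Hm: "H i j \<in> borel_measurable borel"
      unfolding H_def by (intro borel_measurable_times borel_measurable_const S.radial_hess_measurable)
    then show Hl: "H i j \<in> borel_measurable lebesgue" by (intro measurable_completion) simp
    define B where "B = \<tau> * \<mu> * (C * (real m + 3))"
    have HB: "\<bar>H i j x\<bar> \<le> B" for x
      using S.abs_radial_hess_le[OF ij, of x] \<tau> \<mu> by (simp add: H_def B_def abs_mult)
    show "set_integrable lebesgue (ball 0 R) (\<lambda>x. \<bar>H i j x\<bar> powr (real DIM('a) + 1))"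
      unfolding set_integrable_def
    proof (rule integrableI_bounded_set_indicator[where B = "B powr (real DIM('a) + 1)"])
      show "(\<lambda>x. \<bar>H i j x\<bar> powr (real DIM('a) + 1)) \<in> borel_measurable lebesgue" using Hl by measurable
      show "AE x in lebesgue. x \<in> ball 0 R \<longrightarrow> norm (\<bar>H i j x\<bar> powr (real DIM('a) + 1)) \<le> B powr (real DIM('a) + 1)"
        using HB by (intro AE_I2 impI) (auto intro!: powr_mono2)
    qed (auto simp: emeasure_lborel_ball_finite[unfolded infinity_ennreal_def])
    fix \<phi> :: "'a \<Rightarrow> real" and G :: "'a \<Rightarrow> 'a" assume "c1c_test (ball 0 R) \<phi> G"
    note S.radial_field_weak_derivative[OF ij this]
    then have "- (\<tau> * \<mu>) * (LINT x:ball 0 R|lebesgue. (S.radial_field x \<bullet> j) * (G x \<bullet> i))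
        = - (- (\<tau> * \<mu>) * (LINT x:ball 0 R|lebesgue. S.radial_hess i j x * \<phi> x))" by simp
    then show "(LINT x:ball 0 R|lebesgue. (Du x \<bullet> j) * (G x \<bullet> i)) = - (LINT x:ball 0 R|lebesgue. H i j x * \<phi> x)"
      unfolding Du_def H_def inner_scaleR_left mult.assoc[of "- (\<tau> * \<mu>)"] set_integral_mult_right .
  qed
  have n0: "AE x in lebesgue. x \<noteq> (0::'a)" by (rule AE_lebesgue_neq)
  have eqn: "AE x in lebesgue. x \<in> ball 0 R \<longrightarrow> - (\<Sum>i\<in>Basis. H i i x) = a x * u x powr q"
    using a n0
  proof eventually_elim
    case (elim x)
    show ?case
    proof
      assume x: "x \<in> ball 0 R"
      have "- (\<Sum>i\<in>Basis. H i i x) = \<tau> * \<mu> * (\<beta> (norm x) * h (norm x))"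
        using S.radial_hess_trace[OF m elim(2)] by (simp add: H_def sum_negf sum_distrib_left[symmetric])
      also have "\<dots> = \<beta> (norm x) * (\<tau> * w (norm x)) powr q"
        using \<tau> wpos[of "norm x"] by (simp add: h_def powr_mult \<tau>q)
      also have "\<dots> = a x * u x powr q" using elim x u_eq[of x] by simp
      finally show "- (\<Sum>i\<in>Basis. H i i x) = a x * u x powr q" .
    qed
  qed
  have "pos_sol_ball R a q u"
    unfolding pos_sol_ball_def
  proof (intro exI[of _ "real DIM('a) + 1"] exI[of _ Du] exI[of _ H] conjI ballI allI impI)
    show "continuous_on (cball 0 R) Du"
      unfolding Du_def by (intro continuous_intros S.continuous_on_radial_field)
    show "0 < u x" if "x \<in> ball 0 R" for x using u_eq[of x] \<tau> wpos[of "norm x"] that by simp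
    show "Du x \<bullet> x = 0" if "norm x = R" for x
      using that flh by (simp add: Du_def S.radial_field_def S.ratio_def flux_eq)
  qed (use du hess eqn in auto)
  then show ?thesis by blast
qed

text \<open>Polar coordinates express the three integrals through
  \<open>flux (\<lambda>_. 1)\<close> with the common positive factor
  \<open>N * unit_ball_vol N\<close>, which then cancels from the hypotheses.\<close>

lemma radial_pos_sol_exists:
  fixes a :: "'a::euclidean_space \<Rightarrow> real" and \<alpha> :: "real \<Rightarrow> real"
  assumes q: "0 < q" "q < 1"
    and a_meas: "a \<in> borel_measurable lebesgue"
    and a_bdd: "\<exists>C. AE x in lebesgue. x \<in> ball 0 R \<longrightarrow> \<bar>a x\<bar> \<le> C"
    and a_radial: "\<forall>x\<in>ball 0 R. a x = \<alpha> (norm x)"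
    and a_int_neg: "(LINT x:ball 0 R|lebesgue. a x) < 0"
    and R0: "R0 > 0"
    and a_pos_in: "\<forall>x\<in>ball 0 R0. a x \<ge> 0"
    and a_neg_out: "\<forall>x. R0 < norm x \<and> norm x < R \<longrightarrow> a x \<le> 0"
    and \<alpha>_cont: "\<And>\<rho>. \<rho> \<in> {R0<..<R} \<Longrightarrow> isCont \<alpha> \<rho>"
    and \<alpha>_mono: "\<forall>s\<in>{R0<..<R}. \<forall>t\<in>{R0<..<R}. s \<le> t \<longrightarrow> \<alpha> t \<le> \<alpha> s"
    and balance: "(1 - q) / (1 + q) *
        (LINT x:{x. R0 < norm x \<and> norm x < R}|lebesgue. max (- a x) 0)
        \<le> (LINT x:ball 0 R0|lebesgue. max (a x) 0)"
  shows "\<exists>u. pos_sol_ball R a q u"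
proof -
  \<comment> \<open>Otherwise \<open>a\<close> would be nonnegative on the whole ball, against its
    negative integral.\<close>
  have R0R: "R0 < R"
  proof (rule ccontr)
    assume "\<not> R0 < R"
    then have "0 \<le> indicator (ball 0 R) x *\<^sub>R a x" for x
      using a_pos_in by (auto simp: indicator_def)
    then have "0 \<le> (LINT x:ball 0 R|lebesgue. a x)"
      unfolding set_lebesgue_integral_def by (intro Bochner_Integration.integral_nonneg)
    then show False using a_int_neg by simp
  qed
  have \<alpha>_cont': "continuous_on {R0<..<R} \<alpha>"
    using \<alpha>_cont by (intro continuous_at_imp_continuous_on) auto
  obtain \<beta> C where \<beta>: "\<beta> \<in> borel_measurable borel" "\<And>r. \<bar>\<beta> r\<bar> \<le> C" "\<And>r. r \<ge> R \<Longrightarrow> \<beta> r = 0"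
    "\<And>r. r \<le> R0 \<Longrightarrow> 0 \<le> \<beta> r" "\<And>r. R0 < r \<Longrightarrow> r < R \<Longrightarrow> \<beta> r = \<alpha> r" "\<And>r. R0 \<le> r \<Longrightarrow> \<beta> r \<le> 0"
    and a\<beta>: "AE x in lebesgue. x \<in> ball 0 R \<longrightarrow> a x = \<beta> (norm x)"
    using radial_profile[OF a_meas a_bdd a_radial R0 R0R a_pos_in a_neg_out \<alpha>_cont' \<alpha>_mono] by blast
  note [measurable] = \<beta>(1)
  \<comment> \<open>This value makes the cut at \<open>R0\<close> insensitive to open or closed
    intervals, so that the profiles used for the inner ball and for the annulus match the fluxes
    pointwise.\<close>
  have \<beta>R0: "\<beta> R0 = 0" using \<beta>(4)[of R0] \<beta>(6)[of R0] by simp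
  define m where "m = DIM('a) - 1"
  interpret bounded_coeff \<beta> C m by standard (use \<beta> in auto)
  let ?c = "DIM('a) * unit_ball_vol DIM('a)"
  have c: "0 < ?c" by simp
  have i1: "(LINT x:ball 0 R|lebesgue. a x) = ?c * flux (\<lambda>_. 1) R"
  proof -
    have "(LINT x:ball 0 R|lebesgue. a x) = ?c * integral {0..R} (\<lambda>r. r ^ (DIM('a) - 1) * \<beta> r)"
      by (rule set_lebesgue_integral_radial[OF \<beta>(1,2)]) (use \<beta>(3) a_meas a\<beta> in auto)
    then show ?thesis unfolding flux_def unfolding m_def by simp
  qed
  have i2: "(LINT x:ball 0 R0|lebesgue. max (a x) 0) = ?c * flux (\<lambda>_. 1) R0"
  proof -
    let ?f = "\<lambda>r. if r \<le> R0 then \<beta> r else 0"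
    have "(LINT x:ball 0 R0|lebesgue. max (a x) 0) = ?c * integral {0..R0} (\<lambda>r. r ^ (DIM('a) - 1) * ?f r)"
    proof (rule set_lebesgue_integral_radial)
      show "?f \<in> borel_measurable borel" by measurable
      show "\<bar>?f r\<bar> \<le> C" for r using \<beta>(2)[of r] C_nonneg by simp
      show "AE x in lebesgue. x \<in> ball 0 R0 \<longrightarrow> max (a x) 0 = ?f (norm x)"
        using a\<beta> by eventually_elim (use \<beta>(4) R0R in auto)
      show "(\<lambda>x. max (a x) 0) \<in> borel_measurable lebesgue" using a_meas by measurable
    qed (use \<beta>R0 in auto)
    also have "integral {0..R0} (\<lambda>r. r ^ (DIM('a) - 1) * ?f r) = flux (\<lambda>_. 1) R0"
      unfolding flux_def unfolding m_def by (rule integral_cong) auto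
    finally show ?thesis .
  qed
  have i3: "(LINT x:{x. R0 < norm x \<and> norm x < R}|lebesgue. max (- a x) 0) = ?c * (flux (\<lambda>_. 1) R0 - flux (\<lambda>_. 1) R)"
  proof -
    let ?f = "\<lambda>r. if R0 < r then - \<beta> r else 0"
    have "{x::'a. R0 < norm x \<and> norm x < R} = ball 0 R - cball 0 R0" by auto
    then have Sm: "{x::'a. R0 < norm x \<and> norm x < R} \<in> sets lebesgue" by auto
    have "(LINT x:{x. R0 < norm x \<and> norm x < R}|lebesgue. max (- a x) 0) = ?c * integral {0..R} (\<lambda>r. r ^ (DIM('a) - 1) * ?f r)"
    proof (rule set_lebesgue_integral_radial[OF _ _ _ _ Sm])
      show "?f \<in> borel_measurable borel" by measurable
      show "\<bar>?f r\<bar> \<le> C" for r using \<beta>(2)[of r] C_nonneg by simp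
      show "AE x in lebesgue. x \<in> {x. R0 < norm x \<and> norm x < R} \<longrightarrow> max (- a x) 0 = ?f (norm x)"
        using a\<beta> by eventually_elim (use \<beta>(6) in auto)
      show "(\<lambda>x. max (- a x) 0) \<in> borel_measurable lebesgue" using a_meas by measurable
    qed (use \<beta>(3) in auto)
    also have "integral {0..R} (\<lambda>r. r ^ (DIM('a) - 1) * ?f r) = integral {R0..R} (\<lambda>r. - (r ^ m * (\<beta> r * 1)))"
    proof -
      have "integral {0..R} (\<lambda>r. if r \<in> {R0..R} then - (r ^ m * (\<beta> r * 1)) else 0)
          = integral {R0..R} (\<lambda>r. - (r ^ m * (\<beta> r * 1)))"
        using R0 by (subst Henstock_Kurzweil_Integration.integral_restrict_Int) (simp add: Int_absorb1)
      moreover have "integral {0..R} (\<lambda>r. r ^ (DIM('a) - 1) * ?f r)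
          = integral {0..R} (\<lambda>r. if r \<in> {R0..R} then - (r ^ m * (\<beta> r * 1)) else 0)"
        by (rule integral_cong) (use \<beta>R0 in \<open>auto simp: m_def\<close>)
      ultimately show ?thesis by simp
    qed
    also have "\<dots> = flux (\<lambda>_. 1) R0 - flux (\<lambda>_. 1) R"
      using flux_split[of "\<lambda>_. 1" R 1 R0] R0 R0R by simp
    finally show ?thesis .
  qed
  have "radial_coeff \<beta> C (DIM('a) - 1) R R0 q"
    unfolding m_def[symmetric]
  proof
    show "isCont \<beta> r" if r: "R0 < r" "r < R" for r
    proof -
      have "isCont \<alpha> r" using \<alpha>_cont r by simp
      moreover have "\<forall>\<^sub>F x in nhds r. \<beta> x = \<alpha> x"
        using r \<beta>(5) by (intro eventually_mono[OF eventually_nhds_in_open[of "{R0<..<R}"]]) auto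
      ultimately show ?thesis by (simp add: isCont_cong)
    qed
    show "\<beta> s \<le> \<beta> r" if "R0 < r" "r \<le> s" "s < R" for r s
      using \<alpha>_mono \<beta>(5)[of r] \<beta>(5)[of s] that by auto
    show "flux (\<lambda>_. 1) R < 0" using a_int_neg c unfolding i1 by (metis mult_less_0_iff order_less_asym)
    have "?c * ((1 - q) / (1 + q) * (flux (\<lambda>_. 1) R0 - flux (\<lambda>_. 1) R)) \<le> ?c * flux (\<lambda>_. 1) R0"
      using balance unfolding i2 i3 by (simp add: mult_ac)
    then show "(1 - q) / (1 + q) * (flux (\<lambda>_. 1) R0 - flux (\<lambda>_. 1) R) \<le> flux (\<lambda>_. 1) R0"
      using c by (simp only: mult_le_cancel_left_pos)
  qed (use \<beta> R0 R0R q in auto)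
  then show ?thesis using a\<beta> by (rule radial_coeff_pos_sol)
qed

theorem theorem1p2:
  fixes a :: "'a::euclidean_space \<Rightarrow> real" and \<alpha> :: "real \<Rightarrow> real"
    and R R0 q :: real
  assumes R: "R > 0"
    and q: "0 < q" "q < 1"
    and a_meas: "a \<in> borel_measurable lebesgue"
    and a_bdd: "\<exists>C. AE x in lebesgue. x \<in> ball 0 R \<longrightarrow> \<bar>a x\<bar> \<le> C"
    and a_radial: "\<forall>x\<in>ball 0 R. a x = \<alpha> (norm x)"
    and a_int_neg: "(LINT x:ball 0 R|lebesgue. a x) < 0"
    and R0: "R0 > 0"
    and a_pos_in: "\<forall>x\<in>ball 0 R0. a x \<ge> 0"
    and a_neg_out: "\<forall>x. R0 < norm x \<and> norm x < R \<longrightarrow> a x \<le> 0"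
    and \<alpha>_diff: "\<forall>\<rho>\<in>{R0<..<R}. \<alpha> differentiable (at \<rho>)"
    and \<alpha>_mono: "\<forall>s\<in>{R0<..<R}. \<forall>t\<in>{R0<..<R}. s \<le> t \<longrightarrow> \<alpha> t \<le> \<alpha> s"
    and balance: "(1 - q) / (1 + q) *
        (LINT x:{x. R0 < norm x \<and> norm x < R}|lebesgue. max (- a x) 0)
        \<le> (LINT x:ball 0 R0|lebesgue. max (a x) 0)"
  shows "(\<exists>u. pos_sol_ball R a q u) \<and>
         (H1 (ball 0 R) a \<longrightarrow>
            (\<forall>u v. pos_sol_ball R a q u \<and> pos_sol_ball R a q v \<longrightarrow> (\<forall>x\<in>ball 0 R. u x = v x)))"
proof (intro conjI impI allI ballI)
  show "\<exists>u. pos_sol_ball R a q u"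
    by (rule radial_pos_sol_exists[OF q a_meas a_bdd a_radial a_int_neg R0 a_pos_in a_neg_out _ \<alpha>_mono balance])
       (use \<alpha>_diff in \<open>blast intro: differentiable_imp_continuous_within\<close>)
next
  fix u v :: "'a \<Rightarrow> real" and x :: 'a
  assume "pos_sol_ball R a q u \<and> pos_sol_ball R a q v" "x \<in> ball 0 R"
  then show "u x = v x"
    using a_int_neg by (intro pos_sol_ball_unique[OF R q a_meas a_bdd]) auto
qed

end
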